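(* Over the system $\mathsf{ACA}_0^\omega$, the following four principles are provably equivalent: $\mathsf{NIN}$, $\mathsf{NIN}^{C}$, $\mathsf{NIN}^{\mathbb{N}^{\mathbb{N}}}$ and $\mathsf{NIN}^{\mathbb{R}}$. That is, $\mathsf{ACA}_0^\omega$ proves $\mathsf{NIN}\leftrightarrow \mathsf{NIN}^{C}\leftrightarrow \mathsf{NIN}^{\mathbb{N}^{\mathbb{N}}}\leftrightarrow \mathsf{NIN}^{\mathbb{R}}$.
   Context: Work in higher-order arithmetic. $\mathsf{RCA}_0^\omega$ is Kohlenbach's base theory of higher-order Reverse Mathematics, and $\mathsf{ACA}_0^\omega$ is $\mathsf{RCA}_0^\omega$ plus the axiom $(\exists^2)$: there is $\varphi^2\le_2 1$ such that for all $f\in\mathbb{N}^{\mathbb{N}}$, $(\exists n)(f(n)=0)\leftrightarrow \varphi(f)=0$. Real numbers are represented by fast-converging Cauchy sequences of rationals; functions with domain $\mathbb{R}$ or $[0,1]$ are type-two objects respecting equality of reals (extensionality). For $\mathsf{X}$ one of $[0,1]$, $\mathbb{R}$, Cantor space $C=2^{\mathbb{N}}$, or Baire space $\mathbb{N}^{\mathbb{N}}$, $\mathsf{NIN}^{\mathsf{X}}$ is the statement: there is no injection $Y:\mathsf{X}\to\mathbb{N}$, i.e. for every $Y:\mathsf{X}\to\mathbb{N}$ there are $x,y\in\mathsf{X}$ with $x\neq y$ and $Y(x)=Y(y)$. $\mathsf{NIN}$ denotes $\mathsf{NIN}^{[0,1]}$. *)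

theory Defs
  imports Main
begin

section \<open>The language of all finite types\<close>

datatype ty = Nat | Fn ty ty (infixr "\<rightarrow>" 65)

abbreviation ty1 :: ty where "ty1 \<equiv> Nat \<rightarrow> Nat"
abbreviation ty2 :: ty where "ty2 \<equiv> ty1 \<rightarrow> Nat"

text \<open>
  Variables are de Bruijn indices that are counted separately for each type: \<open>Var \<sigma> i\<close> is bound by
  the \<open>i\<close>-th enclosing quantifier (from the inside, starting at \<open>0\<close>) among those that range over
  \<open>\<sigma>\<close>, and it is free if there is none.
  Each variable thus carries its type, and terms are typed without a context.  There are no binders
  in terms: \<open>PiC\<close> and \<open>SigC\<close> are the combinators.
\<close>

datatype tm =
    Var ty nat
  | Zero
  | Succ
  | PiC ty ty
  | SigC ty ty ty
  | Rec
  | App tm tm (infixl "\<cdot>" 200)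

primrec has_type :: "tm \<Rightarrow> ty \<Rightarrow> bool" where
  "has_type (Var \<sigma> i) \<tau> \<longleftrightarrow> \<tau> = \<sigma>"
| "has_type Zero \<tau> \<longleftrightarrow> \<tau> = Nat"
| "has_type Succ \<tau> \<longleftrightarrow> \<tau> = Nat \<rightarrow> Nat"
| "has_type (PiC \<rho> \<sigma>) \<tau> \<longleftrightarrow> \<tau> = \<rho> \<rightarrow> \<sigma> \<rightarrow> \<rho>"
| "has_type (SigC \<delta> \<rho> \<sigma>) \<tau> \<longleftrightarrow> \<tau> = (\<delta> \<rightarrow> \<rho> \<rightarrow> \<sigma>) \<rightarrow> (\<delta> \<rightarrow> \<rho>) \<rightarrow> \<delta> \<rightarrow> \<sigma>"
| "has_type Rec \<tau> \<longleftrightarrow> \<tau> = (Nat \<rightarrow> Nat \<rightarrow> Nat) \<rightarrow> Nat \<rightarrow> Nat \<rightarrow> Nat"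
| "has_type (s \<cdot> t) \<tau> \<longleftrightarrow> (\<exists>\<sigma>. has_type s (\<sigma> \<rightarrow> \<tau>) \<and> has_type t \<sigma>)"

text \<open>The only prime formulas besides falsity are equations between numbers.\<close>

datatype fm =
    Eq tm tm
  | Falsum
  | Imp fm fm (infixr "\<^bold>\<longrightarrow>" 55)
  | Forall ty fm

abbreviation Neg :: "fm \<Rightarrow> fm" ("\<^bold>\<not> _" [70] 70) where
  "\<^bold>\<not> \<phi> \<equiv> \<phi> \<^bold>\<longrightarrow> Falsum"
abbreviation Con :: "fm \<Rightarrow> fm \<Rightarrow> fm" (infixr "\<^bold>\<and>" 65) where
  "\<phi> \<^bold>\<and> \<psi> \<equiv> \<^bold>\<not> (\<phi> \<^bold>\<longrightarrow> \<^bold>\<not> \<psi>)"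
abbreviation Iff :: "fm \<Rightarrow> fm \<Rightarrow> fm" (infix "\<^bold>\<longleftrightarrow>" 52) where
  "\<phi> \<^bold>\<longleftrightarrow> \<psi> \<equiv> (\<phi> \<^bold>\<longrightarrow> \<psi>) \<^bold>\<and> (\<psi> \<^bold>\<longrightarrow> \<phi>)"
abbreviation Exists :: "ty \<Rightarrow> fm \<Rightarrow> fm" where
  "Exists \<sigma> \<phi> \<equiv> \<^bold>\<not> Forall \<sigma> (\<^bold>\<not> \<phi>)"

primrec wf_fm :: "fm \<Rightarrow> bool" where
  "wf_fm (Eq s t) \<longleftrightarrow> has_type s Nat \<and> has_type t Nat"
| "wf_fm Falsum \<longleftrightarrow> True"
| "wf_fm (\<phi> \<^bold>\<longrightarrow> \<psi>) \<longleftrightarrow> wf_fm \<phi> \<and> wf_fm \<psi>"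
| "wf_fm (Forall \<sigma> \<phi>) \<longleftrightarrow> wf_fm \<phi>"

primrec quantifier_free :: "fm \<Rightarrow> bool" where
  "quantifier_free (Eq s t) \<longleftrightarrow> True"
| "quantifier_free Falsum \<longleftrightarrow> True"
| "quantifier_free (\<phi> \<^bold>\<longrightarrow> \<psi>) \<longleftrightarrow> quantifier_free \<phi> \<and> quantifier_free \<psi>"
| "quantifier_free (Forall \<sigma> \<phi>) \<longleftrightarrow> False"

section \<open>Substitution\<close>

primrec tsubst :: "(ty \<Rightarrow> nat \<Rightarrow> tm) \<Rightarrow> tm \<Rightarrow> tm" where
  "tsubst s (Var \<sigma> i) = s \<sigma> i"
| "tsubst s Zero = Zero"
| "tsubst s Succ = Succ"
| "tsubst s (PiC \<rho> \<sigma>) = PiC \<rho> \<sigma>"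
| "tsubst s (SigC \<delta> \<rho> \<sigma>) = SigC \<delta> \<rho> \<sigma>"
| "tsubst s Rec = Rec"
| "tsubst s (t \<cdot> u) = tsubst s t \<cdot> tsubst s u"

definition shift :: "ty \<Rightarrow> ty \<Rightarrow> nat \<Rightarrow> tm" where
  "shift \<sigma> \<tau> i = Var \<tau> (if \<tau> = \<sigma> then Suc i else i)"

definition up :: "ty \<Rightarrow> (ty \<Rightarrow> nat \<Rightarrow> tm) \<Rightarrow> ty \<Rightarrow> nat \<Rightarrow> tm" where
  "up \<sigma> s \<tau> i =
     (if \<tau> = \<sigma> then (case i of 0 \<Rightarrow> Var \<sigma> 0 | Suc j \<Rightarrow> tsubst (shift \<sigma>) (s \<sigma> j))
      else tsubst (shift \<sigma>) (s \<tau> i))"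

primrec fsubst :: "(ty \<Rightarrow> nat \<Rightarrow> tm) \<Rightarrow> fm \<Rightarrow> fm" where
  "fsubst s (Eq t u) = Eq (tsubst s t) (tsubst s u)"
| "fsubst s Falsum = Falsum"
| "fsubst s (\<phi> \<^bold>\<longrightarrow> \<psi>) = fsubst s \<phi> \<^bold>\<longrightarrow> fsubst s \<psi>"
| "fsubst s (Forall \<sigma> \<phi>) = Forall \<sigma> (fsubst (up \<sigma> s) \<phi>)"

abbreviation lift :: "ty \<Rightarrow> tm \<Rightarrow> tm" where "lift \<sigma> \<equiv> tsubst (shift \<sigma>)"
abbreviation flift :: "ty \<Rightarrow> fm \<Rightarrow> fm" where "flift \<sigma> \<equiv> fsubst (shift \<sigma>)"

text \<open>\<open>inst \<sigma> t\<close> replaces \<open>Var \<sigma> 0\<close> by \<open>t\<close> and closes the gap left by it.\<close>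

definition inst :: "ty \<Rightarrow> tm \<Rightarrow> ty \<Rightarrow> nat \<Rightarrow> tm" where
  "inst \<sigma> t \<tau> i = (if \<tau> = \<sigma> then (case i of 0 \<Rightarrow> t | Suc j \<Rightarrow> Var \<sigma> j) else Var \<tau> i)"

section \<open>Derivability\<close>

text \<open>
  Classical many-sorted natural deduction from a set \<open>T\<close> of axioms under local assumptions \<open>\<Gamma>\<close>.  Free
  variables of members of \<open>T\<close> are read universally (rule \<open>AllI\<close> does not restrict them), those of
  \<open>\<Gamma>\<close> are parameters.
\<close>

inductive derives :: "fm set \<Rightarrow> fm set \<Rightarrow> fm \<Rightarrow> bool" ("_, _ \<turnstile> _" [50, 50, 50] 50) for T where
  Axiom: "\<phi> \<in> T \<Longrightarrow> T, \<Gamma> \<turnstile> \<phi>"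
| Assm: "\<phi> \<in> \<Gamma> \<Longrightarrow> wf_fm \<phi> \<Longrightarrow> T, \<Gamma> \<turnstile> \<phi>"
| ImpI: "wf_fm \<phi> \<Longrightarrow> T, insert \<phi> \<Gamma> \<turnstile> \<psi> \<Longrightarrow> T, \<Gamma> \<turnstile> \<phi> \<^bold>\<longrightarrow> \<psi>"
| ImpE: "T, \<Gamma> \<turnstile> \<phi> \<^bold>\<longrightarrow> \<psi> \<Longrightarrow> T, \<Gamma> \<turnstile> \<phi> \<Longrightarrow> T, \<Gamma> \<turnstile> \<psi>"
| Classical: "wf_fm \<phi> \<Longrightarrow> T, insert (\<^bold>\<not> \<phi>) \<Gamma> \<turnstile> Falsum \<Longrightarrow> T, \<Gamma> \<turnstile> \<phi>"
| AllI: "T, flift \<sigma> ` \<Gamma> \<turnstile> \<phi> \<Longrightarrow> T, \<Gamma> \<turnstile> Forall \<sigma> \<phi>"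
| AllE: "T, \<Gamma> \<turnstile> Forall \<sigma> \<phi> \<Longrightarrow> has_type t \<sigma> \<Longrightarrow> T, \<Gamma> \<turnstile> fsubst (inst \<sigma> t) \<phi>"
| Refl: "has_type t Nat \<Longrightarrow> T, \<Gamma> \<turnstile> Eq t t"
| Leibniz: "wf_fm \<phi> \<Longrightarrow> T, \<Gamma> \<turnstile> Eq s t \<Longrightarrow> T, \<Gamma> \<turnstile> fsubst (inst Nat s) \<phi>
    \<Longrightarrow> T, \<Gamma> \<turnstile> fsubst (inst Nat t) \<phi>"

abbreviation provable :: "fm set \<Rightarrow> fm \<Rightarrow> bool" (infix "\<turnstile>" 50) where
  "T \<turnstile> \<phi> \<equiv> T, {} \<turnstile> \<phi>"

section \<open>The systems\<close>

text \<open>Equality at higher types is the usual abbreviation.\<close>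

primrec eq_at :: "ty \<Rightarrow> tm \<Rightarrow> tm \<Rightarrow> fm" where
  "eq_at Nat s t = Eq s t"
| "eq_at (\<sigma> \<rightarrow> \<tau>) s t = Forall \<sigma> (eq_at \<tau> (lift \<sigma> s \<cdot> Var \<sigma> 0) (lift \<sigma> t \<cdot> Var \<sigma> 0))"

text \<open>
  Kohlenbach's E-PRA\<open>\<^sup>\<omega>\<close>: equality is a logical symbol at type \<open>0\<close>; induction is for quantifier-free
  formulas only, and \<open>Rec\<close> is the recursor \<open>R\<^sub>0\<close> (values of type \<open>0\<close>), with
  \<open>Rec f m 0 = m\<close> and \<open>Rec f m (n + 1) = f n (Rec f m n)\<close>.  In \<open>Induction\<close> the induction variable
  is \<open>Var Nat 0\<close>, and the second substitution sends it to its successor.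
\<close>

inductive_set E_PRA_omega :: "fm set" where
  Succ_nonzero: "has_type t Nat \<Longrightarrow> \<^bold>\<not> Eq (Succ \<cdot> t) Zero \<in> E_PRA_omega"
| Succ_inj: "has_type s Nat \<Longrightarrow> has_type t Nat
    \<Longrightarrow> Eq (Succ \<cdot> s) (Succ \<cdot> t) \<^bold>\<longrightarrow> Eq s t \<in> E_PRA_omega"
| PiC: "has_type s \<rho> \<Longrightarrow> has_type t \<sigma> \<Longrightarrow> eq_at \<rho> (PiC \<rho> \<sigma> \<cdot> s \<cdot> t) s \<in> E_PRA_omega"
| SigC: "has_type s (\<delta> \<rightarrow> \<rho> \<rightarrow> \<sigma>) \<Longrightarrow> has_type t (\<delta> \<rightarrow> \<rho>) \<Longrightarrow> has_type u \<delta>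
    \<Longrightarrow> eq_at \<sigma> (SigC \<delta> \<rho> \<sigma> \<cdot> s \<cdot> t \<cdot> u) (s \<cdot> u \<cdot> (t \<cdot> u)) \<in> E_PRA_omega"
| Rec_Zero: "has_type f (Nat \<rightarrow> Nat \<rightarrow> Nat) \<Longrightarrow> has_type m Nat
    \<Longrightarrow> Eq (Rec \<cdot> f \<cdot> m \<cdot> Zero) m \<in> E_PRA_omega"
| Rec_Succ: "has_type f (Nat \<rightarrow> Nat \<rightarrow> Nat) \<Longrightarrow> has_type m Nat \<Longrightarrow> has_type n Nat
    \<Longrightarrow> Eq (Rec \<cdot> f \<cdot> m \<cdot> (Succ \<cdot> n)) (f \<cdot> n \<cdot> (Rec \<cdot> f \<cdot> m \<cdot> n)) \<in> E_PRA_omega"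
| Extensionality: "has_type f (\<sigma> \<rightarrow> \<tau>) \<Longrightarrow> has_type s \<sigma> \<Longrightarrow> has_type t \<sigma>
    \<Longrightarrow> eq_at \<sigma> s t \<^bold>\<longrightarrow> eq_at \<tau> (f \<cdot> s) (f \<cdot> t) \<in> E_PRA_omega"
| Induction: "quantifier_free \<phi> \<Longrightarrow> wf_fm \<phi>
    \<Longrightarrow> fsubst (inst Nat Zero) \<phi>
        \<^bold>\<longrightarrow> Forall Nat (\<phi> \<^bold>\<longrightarrow> fsubst (\<lambda>\<tau> i. if \<tau> = Nat \<and> i = 0 then Succ \<cdot> Var Nat 0 else Var \<tau> i) \<phi>)
        \<^bold>\<longrightarrow> Forall Nat \<phi> \<in> E_PRA_omega"

text \<open>
  In \<open>\<phi>\<close>, \<open>Var ty1 0\<close> is the argument \<open>x\<close> and \<open>Var Nat 0\<close> is the value \<open>y\<close>; in the conclusion \<open>y\<close>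
  becomes \<open>Y x\<close>, with \<open>Y\<close> the newly bound \<open>Var ty2 0\<close>.
\<close>

definition QF_AC_1_0 :: "fm set" where
  "QF_AC_1_0 =
     {Forall ty1 (Exists Nat \<phi>) \<^bold>\<longrightarrow>
      Exists ty2 (Forall ty1 (fsubst (inst Nat (Var ty2 0 \<cdot> Var ty1 0)) (flift ty2 \<phi>)))
      | \<phi>. quantifier_free \<phi> \<and> wf_fm \<phi>}"

definition RCA0_omega :: "fm set" where
  "RCA0_omega = E_PRA_omega \<union> QF_AC_1_0"

section \<open>Arithmetic\<close>

definition tplus :: "tm \<Rightarrow> tm \<Rightarrow> tm" where
  "tplus s t = Rec \<cdot> (PiC ty1 Nat \<cdot> Succ) \<cdot> s \<cdot> t"

text \<open>The step function below maps \<open>k\<close> and \<open>r\<close> to \<open>s + r\<close>.\<close>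

definition ttimes :: "tm \<Rightarrow> tm \<Rightarrow> tm" where
  "ttimes s t = Rec \<cdot> (PiC ty1 Nat \<cdot> (Rec \<cdot> (PiC ty1 Nat \<cdot> Succ) \<cdot> s)) \<cdot> Zero \<cdot> t"

text \<open>Cut-off subtraction; \<open>Rec \<cdot> PiC Nat Nat \<cdot> Zero\<close> is the predecessor function.\<close>

definition tmonus :: "tm \<Rightarrow> tm \<Rightarrow> tm" where
  "tmonus s t = Rec \<cdot> (PiC ty1 Nat \<cdot> (Rec \<cdot> PiC Nat Nat \<cdot> Zero)) \<cdot> s \<cdot> t"

abbreviation num1 :: tm where "num1 \<equiv> Succ \<cdot> Zero"
abbreviation num2 :: tm where "num2 \<equiv> Succ \<cdot> num1"

text \<open>The step function below maps \<open>k\<close> and \<open>r\<close> to \<open>2 \<cdot> r\<close>; its inner part is \<open>r \<mapsto> 2 + r\<close>.\<close>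

definition tpow2 :: "tm \<Rightarrow> tm" where
  "tpow2 t =
     Rec \<cdot> (PiC ty1 Nat \<cdot> (Rec \<cdot> (PiC ty1 Nat \<cdot> (Rec \<cdot> (PiC ty1 Nat \<cdot> Succ) \<cdot> num2)) \<cdot> Zero)) \<cdot> num1 \<cdot> t"

definition le_fm :: "tm \<Rightarrow> tm \<Rightarrow> fm" where
  "le_fm s t = Eq (tmonus s t) Zero"

definition less_fm :: "tm \<Rightarrow> tm \<Rightarrow> fm" where
  "less_fm s t = le_fm (Succ \<cdot> s) t"

text \<open>The axiom \<open>(\<exists>\<^sup>2)\<close>; its first conjunct is \<open>\<phi> \<le>\<^sub>2 1\<close>, with \<open>\<phi>\<close> being \<open>Var ty2 0\<close>.\<close>

definition exists2 :: fm where
  "exists2 =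
     Exists ty2
       (Forall ty1 (le_fm (Var ty2 0 \<cdot> Var ty1 0) num1) \<^bold>\<and>
        Forall ty1 (Exists Nat (Eq (Var ty1 0 \<cdot> Var Nat 0) Zero) \<^bold>\<longleftrightarrow> Eq (Var ty2 0 \<cdot> Var ty1 0) Zero))"

definition ACA0_omega :: "fm set" where
  "ACA0_omega = insert exists2 RCA0_omega"

section \<open>Rational and real numbers\<close>

text \<open>
  The pairing function is \<open>(m + n)\<^sup>2 + m\<close>, and the number \<open>((a, b), c)\<close> codes the rational number
  \<open>(a - b) / (c + 1)\<close>.  A rational number has many codes; they are identified by \<open>=\<^sub>\<rat>\<close>, which is
  implicit in the comparisons below.
\<close>

definition tpair :: "tm \<Rightarrow> tm \<Rightarrow> tm" where
  "tpair s t = tplus (ttimes (tplus s t) (tplus s t)) s"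

definition rat_code :: "tm \<Rightarrow> tm \<Rightarrow> tm \<Rightarrow> tm" where
  "rat_code a b c = tpair (tpair a b) c"

text \<open>
  \<open>rat_diff A q r n\<close> says that \<open>q\<close> and \<open>r\<close> code rational numbers \<open>(a - b) / (c + 1)\<close> and
  \<open>(d - e) / (f + 1)\<close>, and that \<open>A P Q D n\<close> holds for their difference
  \<open>q - r = (P - Q) / D\<close>, where \<open>P = a (f + 1) + e (c + 1)\<close>, \<open>Q = b (f + 1) + d (c + 1)\<close> and
  \<open>D = (c + 1) (f + 1)\<close>.
\<close>

definition rat_diff :: "(tm \<Rightarrow> tm \<Rightarrow> tm \<Rightarrow> tm \<Rightarrow> fm) \<Rightarrow> tm \<Rightarrow> tm \<Rightarrow> tm \<Rightarrow> fm" where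
  "rat_diff A q r n =
     (let a = Var Nat 5; b = Var Nat 4; c = Var Nat 3;
          d = Var Nat 2; e = Var Nat 1; f = Var Nat 0;
          lift6 = lift Nat ^^ 6
      in Exists Nat (Exists Nat (Exists Nat (Exists Nat (Exists Nat (Exists Nat
           (Eq (lift6 q) (rat_code a b c) \<^bold>\<and>
            Eq (lift6 r) (rat_code d e f) \<^bold>\<and>
            A (tplus (ttimes a (Succ \<cdot> f)) (ttimes e (Succ \<cdot> c)))
              (tplus (ttimes b (Succ \<cdot> f)) (ttimes d (Succ \<cdot> c)))
              (ttimes (Succ \<cdot> c) (Succ \<cdot> f))
              (lift6 n))))))))"

definition abs_diff :: "tm \<Rightarrow> tm \<Rightarrow> tm" where
  "abs_diff s t = tplus (tmonus s t) (tmonus t s)"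

text \<open>\<open>\<bar>q - r\<bar> < 2\<^sup>-\<^sup>n\<close>, \<open>\<bar>q - r\<bar> \<le> 2\<^sup>-\<^sup>n\<^sup>+\<^sup>1\<close> and \<open>q - r \<le> 2\<^sup>-\<^sup>n\<^sup>+\<^sup>1\<close>, respectively.\<close>

definition rat_dist_less :: "tm \<Rightarrow> tm \<Rightarrow> tm \<Rightarrow> fm" where
  "rat_dist_less = rat_diff (\<lambda>P Q D n. less_fm (ttimes (tpow2 n) (abs_diff P Q)) D)"

definition rat_dist_le :: "tm \<Rightarrow> tm \<Rightarrow> tm \<Rightarrow> fm" where
  "rat_dist_le = rat_diff (\<lambda>P Q D n. le_fm (ttimes (tpow2 n) (abs_diff P Q)) (ttimes num2 D))"

definition rat_diff_le :: "tm \<Rightarrow> tm \<Rightarrow> tm \<Rightarrow> fm" where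
  "rat_diff_le = rat_diff (\<lambda>P Q D n. le_fm (ttimes (tpow2 n) (tmonus P Q)) (ttimes num2 D))"

text \<open>
  \<open>x \<in> \<real>\<close> iff \<open>\<bar>x n - x (n + i)\<bar> < 2\<^sup>-\<^sup>n\<close> for all \<open>n\<close> and \<open>i\<close>.  Then \<open>\<bar>x n - x\<bar> \<le> 2\<^sup>-\<^sup>n\<close>, whence the
  bound \<open>2\<^sup>-\<^sup>n\<^sup>+\<^sup>1\<close> in the comparisons of two real numbers.
\<close>

definition is_real :: "tm \<Rightarrow> fm" where
  "is_real x =
     (let x' = lift Nat (lift Nat x); n = Var Nat 1; i = Var Nat 0
      in Forall Nat (Forall Nat (rat_dist_less (x' \<cdot> n) (x' \<cdot> tplus n i) n)))"

definition eq_real :: "tm \<Rightarrow> tm \<Rightarrow> fm" where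
  "eq_real x y =
     Forall Nat (rat_dist_le (lift Nat x \<cdot> Var Nat 0) (lift Nat y \<cdot> Var Nat 0) (Var Nat 0))"

definition le_real :: "tm \<Rightarrow> tm \<Rightarrow> fm" where
  "le_real x y =
     Forall Nat (rat_diff_le (lift Nat x \<cdot> Var Nat 0) (lift Nat y \<cdot> Var Nat 0) (Var Nat 0))"

abbreviation zero_real :: tm where
  "zero_real \<equiv> PiC Nat Nat \<cdot> rat_code Zero Zero Zero"
abbreviation one_real :: tm where
  "one_real \<equiv> PiC Nat Nat \<cdot> rat_code num1 Zero Zero"

definition in_unit_interval :: "tm \<Rightarrow> fm" where
  "in_unit_interval x = is_real x \<^bold>\<and> le_real zero_real x \<^bold>\<and> le_real x one_real"

definition in_Cantor :: "tm \<Rightarrow> fm" where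
  "in_Cantor f = Forall Nat (le_fm (lift Nat f \<cdot> Var Nat 0) num1)"

section \<open>The principles\<close>

text \<open>
  Below, \<open>Y = Var ty2 0\<close>, \<open>x = Var ty1 1\<close> and \<open>y = Var ty1 0\<close>.  A function from a set of reals to \<open>\<nat>\<close>
  is a functional of type \<open>2\<close> that respects \<open>=\<^sub>\<real>\<close> on that set; on Cantor and Baire space, every
  functional of type \<open>2\<close> respects equality by the axiom of extensionality.
\<close>

definition NIN_of_reals :: "(tm \<Rightarrow> fm) \<Rightarrow> fm" where
  "NIN_of_reals D =
     (let Y = Var ty2 0; x = Var ty1 1; y = Var ty1 0
      in Forall ty2
           (Forall ty1 (Forall ty1 (D x \<^bold>\<and> D y \<^bold>\<and> eq_real x y \<^bold>\<longrightarrow> Eq (Y \<cdot> x) (Y \<cdot> y)))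
            \<^bold>\<longrightarrow> Exists ty1 (Exists ty1 (D x \<^bold>\<and> D y \<^bold>\<and> \<^bold>\<not> eq_real x y \<^bold>\<and> Eq (Y \<cdot> x) (Y \<cdot> y)))))"

definition NIN :: fm where "NIN = NIN_of_reals in_unit_interval"
definition NIN_Real :: fm where "NIN_Real = NIN_of_reals is_real"

definition NIN_Cantor :: fm where
  "NIN_Cantor =
     (let Y = Var ty2 0; x = Var ty1 1; y = Var ty1 0
      in Forall ty2 (Exists ty1 (Exists ty1
           (in_Cantor x \<^bold>\<and> in_Cantor y \<^bold>\<and> \<^bold>\<not> eq_at ty1 x y \<^bold>\<and> Eq (Y \<cdot> x) (Y \<cdot> y)))))"

definition NIN_Baire :: fm where
  "NIN_Baire =
     (let Y = Var ty2 0; x = Var ty1 1; y = Var ty1 0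
      in Forall ty2 (Exists ty1 (Exists ty1 (\<^bold>\<not> eq_at ty1 x y \<^bold>\<and> Eq (Y \<cdot> x) (Y \<cdot> y)))))"

end

theory Submission
  imports Defs "HOL-Library.Countable_Set" "HOL-Computational_Algebra.Fraction_Field"
begin

text \<open>
  By completeness it suffices to show the equivalences in the term model of every maximal consistent
  Henkin extension of \<open>ACA0_omega\<close>.  Its numbers may be nonstandard, but the functional of \<open>(\<exists>\<^sup>2)\<close> makes
  every arithmetical predicate decidable in it, so that its functions are closed under arithmetical
  comprehension and induction holds for arithmetical predicates; its numbers embed into the ordered
  field of fractions of their difference ring, where rational numbers can be compared.  An injection
  into the numbers is then carried from one space to another by composing it with an injection
  between the spaces: graphs send Baire space to Cantor space, Dedekind cuts send the real line to
  Cantor space and do not depend on the representation of a real number, and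
  \<open>f \<mapsto> \<Sum>k. f k / 4 ^ (k + 1)\<close> sends Cantor space to \<open>[0,1]\<close>.
\<close>

section \<open>Substitution and derivations\<close>

text \<open>An injection \<open>F\<close> from a space \<open>X\<close> to a space \<open>X'\<close>
  yields the implication from the principle for \<open>X\<close> to the one for \<open>X'\<close>: a
  collision of the composition of \<open>Y\<close> with \<open>F\<close> is a collision of
  \<open>Y\<close> at two points that \<open>F\<close> keeps apart. Cantor space is part of Baire
  space and \<open>[0,1]\<close> of the line, so three maps remain. Such a map is of use only if the
  composition is again an object of the model, hence it must be given by a term; \<open>R\<close>
  keeps track of this, and \<open>Q\<close> of the predicates with an induction axiom. A map out of
  the reals must agree on all representations of a real number, so it cannot read off digits or
  approximations; the set of smaller rationals is canonical, and as an existential statement about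
  numbers it is decided by \<open>(\<exists>\<^sup>2)\<close>. A map into the reals must keep points
  apart. Binary expansions fail because of 0111... and 1000..., whereas in base 4 with digits 0 and
  1 the later digits cannot make up for a differing one. As the numbers can be nonstandard, neither
  \<open>nat\<close> nor \<open>real\<close> supplies the sums, powers and estimates; all of them
  are formed inside the model.\<close>

definition well_typed :: "(ty \<Rightarrow> nat \<Rightarrow> tm) \<Rightarrow> bool" where
  "well_typed s \<longleftrightarrow> (\<forall>\<sigma> i. has_type (s \<sigma> i) \<sigma>)"

text \<open>Extension of an assignment by a value for the innermost variable of one type. It
  contains \<open>inst\<close> as the case \<open>s = Var\<close> and describes instantiation after
  \<open>up\<close>, so it becomes the update of environments in the semantics of
  quantifiers.\<close>

definition push :: "ty \<Rightarrow> tm \<Rightarrow> (ty \<Rightarrow> nat \<Rightarrow> tm) \<Rightarrow> ty \<Rightarrow> nat \<Rightarrow> tm" where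
  "push \<sigma> t s \<tau> i = (if \<tau> = \<sigma> then (case i of 0 \<Rightarrow> t | Suc j \<Rightarrow> s \<sigma> j) else s \<tau> i)"

lemma push_simps [simp]:
  "push \<sigma> t s \<sigma> 0 = t" "push \<sigma> t s \<sigma> (Suc j) = s \<sigma> j" "\<tau> \<noteq> \<sigma> \<Longrightarrow> push \<sigma> t s \<tau> i = s \<tau> i"
  by (auto simp: push_def)

lemma inst_eq_push: "inst \<sigma> t = push \<sigma> t Var"
  by (auto simp: inst_def push_def fun_eq_iff split: nat.split)

lemma tsubst_tsubst: "tsubst s (tsubst r t) = tsubst (\<lambda>\<tau> i. tsubst s (r \<tau> i)) t"
  by (induction t) auto

lemma tsubst_Var [simp]: "tsubst Var t = t"
  by (induction t) auto

lemma tsubst_push_lift [simp]: "tsubst (push \<sigma> t s) (lift \<sigma> u) = tsubst s u"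
proof -
  have "(\<lambda>\<tau> i. tsubst (push \<sigma> t s) (shift \<sigma> \<tau> i)) = s"
    by (auto simp: fun_eq_iff shift_def)
  then show ?thesis by (simp add: tsubst_tsubst)
qed

lemma tsubst_up_lift [simp]: "tsubst (up \<sigma> s) (lift \<sigma> u) = lift \<sigma> (tsubst s u)"
proof -
  have "(\<lambda>\<tau> i. tsubst (up \<sigma> s) (shift \<sigma> \<tau> i)) = (\<lambda>\<tau> i. lift \<sigma> (s \<tau> i))"
    by (auto simp: fun_eq_iff shift_def up_def)
  then show ?thesis by (simp add: tsubst_tsubst)
qed

lemma lift_commute: "\<sigma> \<noteq> \<tau> \<Longrightarrow> lift \<sigma> (lift \<tau> u) = lift \<tau> (lift \<sigma> u)"
proof -
  assume "\<sigma> \<noteq> \<tau>"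
  then have "(\<lambda>\<rho> i. lift \<sigma> (shift \<tau> \<rho> i)) = (\<lambda>\<rho> i. lift \<tau> (shift \<sigma> \<rho> i))"
    by (auto simp: fun_eq_iff shift_def)
  then show ?thesis by (simp only: tsubst_tsubst)
qed

lemma up_comp: "(\<lambda>\<tau> i. tsubst (up \<sigma> s) (up \<sigma> r \<tau> i)) = up \<sigma> (\<lambda>\<tau> i. tsubst s (r \<tau> i))"
proof (intro ext)
  fix \<tau> i
  show "tsubst (up \<sigma> s) (up \<sigma> r \<tau> i) = up \<sigma> (\<lambda>\<tau> i. tsubst s (r \<tau> i)) \<tau> i"
    by (cases i) (auto simp: up_def[of \<sigma> r] up_def[of \<sigma> "\<lambda>\<tau> i. tsubst s (r \<tau> i)"], simp add: up_def)
qed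

lemma fsubst_fsubst: "fsubst s (fsubst r \<phi>) = fsubst (\<lambda>\<tau> i. tsubst s (r \<tau> i)) \<phi>"
  by (induction \<phi> arbitrary: s r) (auto simp: tsubst_tsubst up_comp)

lemma up_Var [simp]: "up \<sigma> Var = Var"
  by (auto simp: fun_eq_iff up_def shift_def split: nat.split)

lemma fsubst_Var [simp]: "fsubst Var \<phi> = \<phi>"
  by (induction \<phi>) auto

lemma push_up: "(\<lambda>\<tau> i. tsubst (push \<sigma> t r) (up \<sigma> s \<tau> i)) = push \<sigma> t (\<lambda>\<tau> i. tsubst r (s \<tau> i))"
  by (auto simp: fun_eq_iff up_def push_def[of \<sigma> t "\<lambda>\<tau> i. tsubst r (s \<tau> i)"] split: nat.split)

lemma fsubst_inst_up: "fsubst (inst \<sigma> t) (fsubst (up \<sigma> s) \<phi>) = fsubst (push \<sigma> t s) \<phi>"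
  by (simp add: inst_eq_push fsubst_fsubst push_up)

lemma comp_inst: "(\<lambda>\<tau> i. tsubst s (inst \<sigma> t \<tau> i)) = push \<sigma> (tsubst s t) s"
  by (auto simp: fun_eq_iff inst_def push_def split: nat.split)

lemma fsubst_inst: "fsubst s (fsubst (inst \<sigma> t) \<phi>) = fsubst (push \<sigma> (tsubst s t) s) \<phi>"
  by (simp add: fsubst_fsubst comp_inst)

lemma fsubst_up_flift: "fsubst (up \<sigma> s) (flift \<sigma> \<phi>) = flift \<sigma> (fsubst s \<phi>)"
proof -
  have "(\<lambda>\<tau> i. tsubst (up \<sigma> s) (shift \<sigma> \<tau> i)) = (\<lambda>\<tau> i. lift \<sigma> (s \<tau> i))"
    by (auto simp: fun_eq_iff shift_def up_def)
  then show ?thesis by (simp add: fsubst_fsubst)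
qed

lemma has_type_tsubst: "well_typed s \<Longrightarrow> has_type t \<tau> \<Longrightarrow> has_type (tsubst s t) \<tau>"
  by (induction t arbitrary: \<tau>) (auto simp: well_typed_def)

lemma well_typed_shift [simp]: "well_typed (shift \<sigma>)"
  by (simp add: well_typed_def shift_def)

lemma well_typed_Var [simp]: "well_typed Var"
  by (simp add: well_typed_def)

lemma has_type_lift [simp]: "has_type t \<tau> \<Longrightarrow> has_type (lift \<sigma> t) \<tau>"
  by (simp add: has_type_tsubst)

lemma well_typed_up [simp]: "well_typed s \<Longrightarrow> well_typed (up \<sigma> s)"
  by (auto simp: well_typed_def up_def split: nat.split)

lemma well_typed_push [simp]: "well_typed s \<Longrightarrow> has_type t \<sigma> \<Longrightarrow> well_typed (push \<sigma> t s)"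
  by (auto simp: well_typed_def push_def split: nat.split)

lemma well_typed_inst [simp]: "has_type t \<sigma> \<Longrightarrow> well_typed (inst \<sigma> t)"
  by (simp add: inst_eq_push)

lemma wf_fsubst: "well_typed s \<Longrightarrow> wf_fm \<phi> \<Longrightarrow> wf_fm (fsubst s \<phi>)"
  by (induction \<phi> arbitrary: s) (auto simp: has_type_tsubst)

lemma quantifier_free_fsubst [simp]: "quantifier_free (fsubst s \<phi>) = quantifier_free \<phi>"
  by (induction \<phi> arbitrary: s) auto

lemma fsubst_eq_at [simp]: "fsubst s (eq_at \<sigma> t u) = eq_at \<sigma> (tsubst s t) (tsubst s u)"
  by (induction \<sigma> arbitrary: s t u) (auto simp: up_def)

lemma wf_eq_at: "has_type t \<sigma> \<Longrightarrow> has_type u \<sigma> \<Longrightarrow> wf_fm (eq_at \<sigma> t u)"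
  by (induction \<sigma> arbitrary: t u) auto

text \<open>Each axiom is a schema over arbitrary terms, so a substituted axiom is another instance.
  Only for induction does the substitution have to pass under the binder of the induction
  variable.\<close>

lemma E_PRA_omega_fsubst: "\<phi> \<in> E_PRA_omega \<Longrightarrow> well_typed s \<Longrightarrow> fsubst s \<phi> \<in> E_PRA_omega"
proof (induction rule: E_PRA_omega.induct)
  case (Induction \<phi>)
  let ?r = "\<lambda>\<tau> i. if \<tau> = Nat \<and> i = 0 then Succ \<cdot> Var Nat 0 else Var \<tau> i"
  have 1: "fsubst s (fsubst (inst Nat Zero) \<phi>) = fsubst (inst Nat Zero) (fsubst (up Nat s) \<phi>)"
    by (simp add: fsubst_inst fsubst_inst_up)
  have "tsubst ?r (up Nat s \<tau> i) = tsubst (up Nat s) (?r \<tau> i)" for \<tau> i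
  proof (cases "\<tau> = Nat \<and> i = 0")
    case True then show ?thesis by (simp add: up_def)
  next
    case False
    \<comment> \<open>A lifted term does not mention \<open>Var Nat 0\<close>, the only variable
      that \<open>?r\<close> changes.\<close>
    have "(\<lambda>\<tau> i. tsubst ?r (shift Nat \<tau> i)) = shift Nat"
      by (auto simp: fun_eq_iff shift_def)
    then have "tsubst ?r (lift Nat u) = lift Nat u" for u
      by (simp only: tsubst_tsubst)
    then show ?thesis using False by (auto simp: up_def split: nat.split)
  qed
  then have 2: "fsubst (up Nat s) (fsubst ?r \<phi>) = fsubst ?r (fsubst (up Nat s) \<phi>)"
    by (simp add: fsubst_fsubst)
  show ?case
    unfolding fsubst.simps 1 2
    by (rule E_PRA_omega.Induction) (use Induction in \<open>auto simp: wf_fsubst\<close>)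
qed (simp_all add: E_PRA_omega.intros has_type_tsubst E_PRA_omega.PiC E_PRA_omega.SigC)

text \<open>The result is the instance for \<open>\<psi>\<close> substituted under both binders. The
  two substitutions to be compared apply lifts for the distinct types \<open>Nat\<close>,
  \<open>ty1\<close> and \<open>ty2\<close> in different orders, and such lifts commute.\<close>

lemma QF_AC_1_0_fsubst:
  assumes "\<phi> \<in> QF_AC_1_0" "well_typed s" shows "fsubst s \<phi> \<in> QF_AC_1_0"
proof -
  obtain \<psi> where \<psi>: "quantifier_free \<psi>" "wf_fm \<psi>"
    and \<phi>: "\<phi> = Forall ty1 (Exists Nat \<psi>) \<^bold>\<longrightarrow>
      Exists ty2 (Forall ty1 (fsubst (inst Nat (Var ty2 0 \<cdot> Var ty1 0)) (flift ty2 \<psi>)))"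
    using assms(1) by (auto simp: QF_AC_1_0_def)
  let ?\<psi> = "fsubst (up Nat (up ty1 s)) \<psi>"
  have "(\<lambda>\<tau> i. tsubst (push Nat (Var ty2 0 \<cdot> Var ty1 0) (up ty1 (up ty2 s))) (shift ty2 \<tau> i)) =
        (\<lambda>\<tau> i. tsubst (inst Nat (Var ty2 0 \<cdot> Var ty1 0)) (tsubst (shift ty2) (up Nat (up ty1 s) \<tau> i)))"
    (is "?f = ?g")
  proof (intro ext)
    fix \<tau> i
    have *: "tsubst (inst Nat u) (lift ty2 (lift Nat v)) = lift ty2 v" for u v
      by (simp add: lift_commute[of ty2 Nat] inst_eq_push)
    have **: "lift ty2 (lift ty1 v) = lift ty1 (lift ty2 v)" for v
      by (rule lift_commute) simp
    show "?f \<tau> i = ?g \<tau> i"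
      by (cases i; cases "\<tau> = Nat"; cases "\<tau> = ty1"; cases "\<tau> = ty2")
        (auto simp: up_def shift_def * ** push_def inst_def split: nat.split)
  qed
  have "fsubst (up ty1 (up ty2 s)) (fsubst (inst Nat (Var ty2 0 \<cdot> Var ty1 0)) (flift ty2 \<psi>)) =
      fsubst (inst Nat (Var ty2 0 \<cdot> Var ty1 0)) (flift ty2 ?\<psi>)"
    (is "?l = ?r")
  proof -
    have "tsubst (up ty1 (up ty2 s)) (Var ty2 0 \<cdot> Var ty1 0) = Var ty2 0 \<cdot> Var ty1 0"
      by (simp add: up_def shift_def)
    then have "?l = fsubst ?f \<psi>" unfolding fsubst_inst by (simp only: fsubst_fsubst)
    moreover have "?r = fsubst ?g \<psi>" by (simp only: fsubst_fsubst)
    ultimately show ?thesis using \<open>?f = ?g\<close> by simp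
  qed
  then show ?thesis
    using \<psi> assms(2) unfolding \<phi> QF_AC_1_0_def by (auto intro!: exI[of _ ?\<psi>] simp: wf_fsubst)
qed

lemma exists2_fsubst: "fsubst s exists2 = exists2"
  by (simp add: exists2_def le_fm_def tmonus_def up_def shift_def)

lemma ACA0_omega_fsubst: "\<phi> \<in> ACA0_omega \<Longrightarrow> well_typed s \<Longrightarrow> fsubst s \<phi> \<in> ACA0_omega"
  unfolding ACA0_omega_def RCA0_omega_def
  using exists2_fsubst E_PRA_omega_fsubst QF_AC_1_0_fsubst by auto

lemma has_type_tplus [simp]: "has_type (tplus s t) \<tau> \<longleftrightarrow> \<tau> = Nat \<and> has_type s Nat \<and> has_type t Nat"
  and has_type_ttimes [simp]: "has_type (ttimes s t) \<tau> \<longleftrightarrow> \<tau> = Nat \<and> has_type s Nat \<and> has_type t Nat"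
  and has_type_tmonus [simp]: "has_type (tmonus s t) \<tau> \<longleftrightarrow> \<tau> = Nat \<and> has_type s Nat \<and> has_type t Nat"
  and has_type_tpow2 [simp]: "has_type (tpow2 t) \<tau> \<longleftrightarrow> \<tau> = Nat \<and> has_type t Nat"
  by (auto simp: tplus_def ttimes_def tmonus_def tpow2_def)

lemma E_PRA_omega_wf: "\<phi> \<in> E_PRA_omega \<Longrightarrow> wf_fm \<phi>"
proof (induction rule: E_PRA_omega.induct)
  case (PiC s \<rho> t \<sigma>)
  have "has_type (PiC \<rho> \<sigma> \<cdot> s \<cdot> t) \<rho>" using PiC by auto
  then show ?case using PiC by (auto intro: wf_eq_at)
next
  case (SigC s \<delta> \<rho> \<sigma> t u)
  have "has_type (SigC \<delta> \<rho> \<sigma> \<cdot> s \<cdot> t \<cdot> u) \<sigma>" "has_type (s \<cdot> u \<cdot> (t \<cdot> u)) \<sigma>"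
    unfolding has_type.simps using SigC by blast+
  then show ?case by (rule wf_eq_at)
next
  case (Extensionality f \<sigma> \<tau> s t)
  have "has_type (f \<cdot> s) \<tau>" "has_type (f \<cdot> t) \<tau>" using Extensionality by auto
  then show ?case using Extensionality by (simp del: has_type.simps add: wf_eq_at)
next
  case (Induction \<phi>)
  have "well_typed (\<lambda>\<tau> i. if \<tau> = Nat \<and> i = 0 then Succ \<cdot> Var Nat 0 else Var \<tau> i)"
    by (simp add: well_typed_def)
  then show ?case using Induction by (simp add: wf_fsubst)
qed auto

lemma ACA0_omega_wf: "\<phi> \<in> ACA0_omega \<Longrightarrow> wf_fm \<phi>"
  unfolding ACA0_omega_def RCA0_omega_def
  using E_PRA_omega_wf
  by (auto simp: QF_AC_1_0_def exists2_def le_fm_def intro!: wf_fsubst)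

section \<open>Weakening and substitution in derivations\<close>

lemma derives_weaken: "T, \<Gamma> \<turnstile> \<phi> \<Longrightarrow> \<Gamma> \<subseteq> \<Delta> \<Longrightarrow> T, \<Delta> \<turnstile> \<phi>"
proof (induction arbitrary: \<Delta> rule: derives.induct)
  case (AllI \<sigma> \<Gamma> \<phi>)
  then show ?case by (meson derives.AllI image_mono)
next
  case (ImpI \<phi> \<Gamma> \<psi>)
  then show ?case by (meson derives.ImpI insert_mono)
next
  case (Classical \<phi> \<Gamma>)
  then show ?case by (meson derives.Classical insert_mono)
next
  case (Leibniz \<phi> \<Gamma> s t)
  then show ?case by (meson derives.Leibniz)
qed (auto intro: derives.intros)

text \<open>Derivations are closed under substitution because the axioms are; rule
  \<open>AllI\<close> uses the induction hypothesis for \<open>up \<sigma> s\<close>, which commutes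
  with lifting the assumptions.\<close>

lemma derives_fsubst:
  assumes T: "\<And>\<phi> s. \<phi> \<in> T \<Longrightarrow> well_typed s \<Longrightarrow> fsubst s \<phi> \<in> T"
  shows "T, \<Gamma> \<turnstile> \<phi> \<Longrightarrow> well_typed s \<Longrightarrow> T, fsubst s ` \<Gamma> \<turnstile> fsubst s \<phi>"
proof (induction arbitrary: s rule: derives.induct)
  case (AllI \<sigma> \<Gamma> \<phi>)
  have "fsubst (up \<sigma> s) ` flift \<sigma> ` \<Gamma> = flift \<sigma> ` fsubst s ` \<Gamma>"
    by (simp add: image_image fsubst_up_flift)
  then show ?case using AllI.IH[of "up \<sigma> s"] AllI.prems by (auto intro: derives.AllI)
next
  case (AllE \<Gamma> \<sigma> \<phi> t)
  have "T, fsubst s ` \<Gamma> \<turnstile> Forall \<sigma> (fsubst (up \<sigma> s) \<phi>)"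
    using AllE.IH[OF AllE.prems] by simp
  then have "T, fsubst s ` \<Gamma> \<turnstile> fsubst (inst \<sigma> (tsubst s t)) (fsubst (up \<sigma> s) \<phi>)"
    by (rule derives.AllE) (use AllE in \<open>simp add: has_type_tsubst\<close>)
  then show ?case by (simp add: fsubst_inst_up fsubst_inst)
next
  case (Leibniz \<phi> \<Gamma> t u)
  have 1: "T, fsubst s ` \<Gamma> \<turnstile> Eq (tsubst s t) (tsubst s u)"
    using Leibniz by simp
  have 2: "T, fsubst s ` \<Gamma> \<turnstile> fsubst (inst Nat (tsubst s t)) (fsubst (up Nat s) \<phi>)"
    using Leibniz.IH(2)[OF Leibniz.prems] by (simp add: fsubst_inst_up fsubst_inst)
  have "T, fsubst s ` \<Gamma> \<turnstile> fsubst (inst Nat (tsubst s u)) (fsubst (up Nat s) \<phi>)"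
    using Leibniz by (intro derives.Leibniz[OF _ 1 2]) (simp add: wf_fsubst)
  then show ?case by (simp add: fsubst_inst_up fsubst_inst)
next
  case (Axiom \<phi> \<Gamma>)
  then show ?case by (simp add: T derives.Axiom)
next
  case (Assm \<phi> \<Gamma>)
  then show ?case by (simp add: derives.Assm wf_fsubst)
next
  case (ImpI \<phi> \<Gamma> \<psi>)
  then show ?case by (simp add: derives.ImpI wf_fsubst)
next
  case (ImpE \<Gamma> \<phi> \<psi>)
  show ?case by (rule derives.ImpE[OF ImpE.IH(1)[OF ImpE.prems, simplified] ImpE.IH(2)[OF ImpE.prems]])
next
  case (Classical \<phi> \<Gamma>)
  then show ?case by (simp add: derives.Classical wf_fsubst)
next
  case (Refl t \<Gamma>)
  then show ?case by (simp add: derives.Refl has_type_tsubst)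
qed

section \<open>Maximal consistent sets\<close>

primrec tfv :: "tm \<Rightarrow> (ty \<times> nat) set" where
  "tfv (Var \<sigma> i) = {(\<sigma>, i)}"
| "tfv Zero = {}"
| "tfv Succ = {}"
| "tfv (PiC \<rho> \<sigma>) = {}"
| "tfv (SigC \<delta> \<rho> \<sigma>) = {}"
| "tfv Rec = {}"
| "tfv (s \<cdot> t) = tfv s \<union> tfv t"

text \<open>The renaming that \<open>shift\<close> performs on variables; its preimage removes the
  variable bound by a quantifier and renumbers the others of that type.\<close>

definition bump :: "ty \<Rightarrow> ty \<times> nat \<Rightarrow> ty \<times> nat" where
  "bump \<sigma> = (\<lambda>(\<tau>, i). (\<tau>, if \<tau> = \<sigma> then Suc i else i))"

primrec ffv :: "fm \<Rightarrow> (ty \<times> nat) set" where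
  "ffv (Eq s t) = tfv s \<union> tfv t"
| "ffv Falsum = {}"
| "ffv (\<phi> \<^bold>\<longrightarrow> \<psi>) = ffv \<phi> \<union> ffv \<psi>"
| "ffv (Forall \<sigma> \<phi>) = bump \<sigma> -` ffv \<phi>"

lemma finite_ffv: "finite (ffv \<phi>)"
proof (induction \<phi>)
  case (Eq s t)
  have "finite (tfv u)" for u by (induction u) auto
  then show ?case by simp
next
  case (Forall \<sigma> \<phi>)
  have "inj (bump \<sigma>)" by (auto simp: inj_def bump_def split: if_splits)
  then show ?case using Forall by (simp add: finite_vimageI)
qed auto

lemma tsubst_cong_fv: "(\<And>\<tau> i. (\<tau>, i) \<in> tfv t \<Longrightarrow> s \<tau> i = r \<tau> i) \<Longrightarrow> tsubst s t = tsubst r t"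
  by (induction t) auto

lemma fsubst_cong_fv:
  "(\<And>\<tau> i. (\<tau>, i) \<in> ffv \<phi> \<Longrightarrow> s \<tau> i = r \<tau> i) \<Longrightarrow> fsubst s \<phi> = fsubst r \<phi>"
proof (induction \<phi> arbitrary: s r)
  case (Eq t u)
  have "tsubst s t = tsubst r t" "tsubst s u = tsubst r u"
    by (rule tsubst_cong_fv, simp add: Eq)+
  then show ?case by simp
next
  case (Imp \<phi> \<psi>)
  have "fsubst s \<phi> = fsubst r \<phi>" "fsubst s \<psi> = fsubst r \<psi>"
    by (rule Imp.IH, simp add: Imp.prems)+
  then show ?case by simp
next
  case (Forall \<sigma> \<phi>)
  have "fsubst (up \<sigma> s) \<phi> = fsubst (up \<sigma> r) \<phi>"
  proof (rule Forall.IH)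
    fix \<tau> i assume "(\<tau>, i) \<in> ffv \<phi>"
    then show "up \<sigma> s \<tau> i = up \<sigma> r \<tau> i"
      using Forall.prems[of \<tau> i] Forall.prems[of \<tau> "i - 1"]
      by (cases i) (auto simp: up_def bump_def)
  qed
  then show ?case by simp
qed simp

text \<open>The rule with an eigenvariable. Renaming \<open>Var \<sigma> k\<close> to index
  \<open>0\<close> and shifting all other variables turns the instance back into
  \<open>\<psi>\<close> and, as \<open>k\<close> is fresh, acts on \<open>\<Gamma>\<close> as plain
  lifting, which gives the premise of \<open>AllI\<close>.\<close>

lemma AllI_fresh:
  assumes T: "\<And>\<phi> s. \<phi> \<in> T \<Longrightarrow> well_typed s \<Longrightarrow> fsubst s \<phi> \<in> T"
    and \<Gamma>: "\<And>\<gamma>. \<gamma> \<in> \<Gamma> \<Longrightarrow> (\<sigma>, k) \<notin> ffv \<gamma>" and \<psi>: "(\<sigma>, k) \<notin> ffv (Forall \<sigma> \<psi>)"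
    and d: "T, \<Gamma> \<turnstile> fsubst (inst \<sigma> (Var \<sigma> k)) \<psi>"
  shows "T, \<Gamma> \<turnstile> Forall \<sigma> \<psi>"
proof (rule derives.AllI)
  let ?r = "\<lambda>\<tau> i. if \<tau> = \<sigma> \<and> i = k then Var \<sigma> 0 else shift \<sigma> \<tau> i"
  have "fsubst ?r \<gamma> = flift \<sigma> \<gamma>" if "\<gamma> \<in> \<Gamma>" for \<gamma>
    using \<Gamma>[OF that] by (intro fsubst_cong_fv) auto
  then have "fsubst ?r ` \<Gamma> = flift \<sigma> ` \<Gamma>" by (intro image_cong) auto
  moreover have "fsubst ?r (fsubst (inst \<sigma> (Var \<sigma> k)) \<psi>) = fsubst Var \<psi>"
    unfolding fsubst_inst using \<psi>
    by (intro fsubst_cong_fv) (auto simp: push_def shift_def bump_def split: nat.split)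
  moreover have "well_typed ?r" by (simp add: well_typed_def shift_def)
  ultimately show "T, flift \<sigma> ` \<Gamma> \<turnstile> \<psi>"
    using derives_fsubst[OF T d, of ?r] by simp
qed

instance ty :: countable by countable_datatype
instance tm :: countable by countable_datatype
instance fm :: countable by countable_datatype

text \<open>Membership in \<open>M\<close> obeys the clauses of truth, with quantifiers ranging over
  all terms of the type in question, open ones included.\<close>

locale henkin =
  fixes T M :: "fm set"
  assumes M_wf: "\<phi> \<in> M \<Longrightarrow> wf_fm \<phi>"
    and M_axiom: "\<phi> \<in> T \<Longrightarrow> \<phi> \<in> M"
    and M_Falsum [simp]: "Falsum \<notin> M"
    and M_Imp: "wf_fm \<phi> \<Longrightarrow> wf_fm \<psi> \<Longrightarrow> \<phi> \<^bold>\<longrightarrow> \<psi> \<in> M \<longleftrightarrow> (\<phi> \<in> M \<longrightarrow> \<psi> \<in> M)"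
    and M_Forall: "wf_fm \<phi> \<Longrightarrow>
      Forall \<sigma> \<phi> \<in> M \<longleftrightarrow> (\<forall>t. has_type t \<sigma> \<longrightarrow> fsubst (inst \<sigma> t) \<phi> \<in> M)"
    and M_Refl: "has_type t Nat \<Longrightarrow> Eq t t \<in> M"
    and M_Leibniz: "wf_fm \<phi> \<Longrightarrow> Eq s t \<in> M \<Longrightarrow> fsubst (inst Nat s) \<phi> \<in> M
      \<Longrightarrow> fsubst (inst Nat t) \<phi> \<in> M"

text \<open>A rejected formula that is not universal leaves the stage unchanged, since its negation
  is already derivable; a rejected universal formula also receives a counterexample.\<close>

definition henkin_step :: "fm set \<Rightarrow> fm set \<Rightarrow> fm \<Rightarrow> fm set" where
  "henkin_step T \<Gamma> \<phi> =
    (if \<not> wf_fm \<phi> then \<Gamma> else if \<not> T, insert \<phi> \<Gamma> \<turnstile> Falsum then insert \<phi> \<Gamma>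
     else (case \<phi> of Forall \<sigma> \<psi> \<Rightarrow>
        let k = SOME k. (\<sigma>, k) \<notin> ffv (Forall \<sigma> \<psi>) \<union> \<Union> (ffv ` \<Gamma>)
        in insert (\<^bold>\<not> fsubst (inst \<sigma> (Var \<sigma> k)) \<psi>) \<Gamma>
      | _ \<Rightarrow> \<Gamma>))"

lemma henkin_step_Forall:
  assumes "wf_fm (Forall \<sigma> \<psi>)" "T, insert (Forall \<sigma> \<psi>) \<Gamma> \<turnstile> Falsum" "finite \<Gamma>"
  obtains k where "henkin_step T \<Gamma> (Forall \<sigma> \<psi>) = insert (\<^bold>\<not> fsubst (inst \<sigma> (Var \<sigma> k)) \<psi>) \<Gamma>"
    and "(\<sigma>, k) \<notin> ffv (Forall \<sigma> \<psi>)" and "\<And>\<gamma>. \<gamma> \<in> \<Gamma> \<Longrightarrow> (\<sigma>, k) \<notin> ffv \<gamma>"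
proof -
  let ?F = "ffv (Forall \<sigma> \<psi>) \<union> \<Union> (ffv ` \<Gamma>)"
  let ?k = "SOME k. (\<sigma>, k) \<notin> ?F"
  have "finite (Pair \<sigma> -` ?F)"
    using assms(3) finite_ffv by (intro finite_vimageI) (auto simp del: ffv.simps intro: injI)
  then have "\<exists>k. k \<notin> Pair \<sigma> -` ?F" using ex_new_if_finite infinite_UNIV_nat by blast
  then have "\<exists>k. (\<sigma>, k) \<notin> ?F" by simp
  then have "(\<sigma>, ?k) \<notin> ?F" by (rule someI_ex)
  moreover have "henkin_step T \<Gamma> (Forall \<sigma> \<psi>) = insert (\<^bold>\<not> fsubst (inst \<sigma> (Var \<sigma> ?k)) \<psi>) \<Gamma>"
    using assms(1,2) by (simp add: henkin_step_def Let_def)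
  ultimately show ?thesis using that[of ?k] by blast
qed

text \<open>Consistency is at risk only when a counterexample is added. If that were inconsistent,
  the instance at the fresh variable would be derivable, hence the universal formula as well, which
  the stage refutes.\<close>

lemma henkin_step:
  assumes T: "\<And>\<phi> s. \<phi> \<in> T \<Longrightarrow> well_typed s \<Longrightarrow> fsubst s \<phi> \<in> T"
    and fin: "finite \<Gamma>" and wf: "\<forall>\<gamma>\<in>\<Gamma>. wf_fm \<gamma>" and cons: "\<not> T, \<Gamma> \<turnstile> Falsum"
  shows "\<Gamma> \<subseteq> henkin_step T \<Gamma> \<phi>" "finite (henkin_step T \<Gamma> \<phi>)"
    "\<forall>\<gamma>\<in>henkin_step T \<Gamma> \<phi>. wf_fm \<gamma>" "\<not> T, henkin_step T \<Gamma> \<phi> \<turnstile> Falsum"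
proof -
  let ?\<Delta> = "henkin_step T \<Gamma> \<phi>"
  have "\<Gamma> \<subseteq> ?\<Delta> \<and> finite ?\<Delta> \<and> (\<forall>\<gamma>\<in>?\<Delta>. wf_fm \<gamma>) \<and> \<not> T, ?\<Delta> \<turnstile> Falsum"
  proof (cases "wf_fm \<phi> \<and> T, insert \<phi> \<Gamma> \<turnstile> Falsum \<and> (\<exists>\<sigma> \<psi>. \<phi> = Forall \<sigma> \<psi>)")
    case True
    then obtain \<sigma> \<psi> where \<phi>: "\<phi> = Forall \<sigma> \<psi>" by blast
    with True obtain k where k: "?\<Delta> = insert (\<^bold>\<not> fsubst (inst \<sigma> (Var \<sigma> k)) \<psi>) \<Gamma>"
      "(\<sigma>, k) \<notin> ffv (Forall \<sigma> \<psi>)" "\<And>\<gamma>. \<gamma> \<in> \<Gamma> \<Longrightarrow> (\<sigma>, k) \<notin> ffv \<gamma>"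
      using henkin_step_Forall[of \<sigma> \<psi> T \<Gamma>] fin by metis
    have wf': "wf_fm (fsubst (inst \<sigma> (Var \<sigma> k)) \<psi>)" using True \<phi> by (simp add: wf_fsubst)
    have "\<not> T, ?\<Delta> \<turnstile> Falsum"
    proof
      assume "T, ?\<Delta> \<turnstile> Falsum"
      then have "T, \<Gamma> \<turnstile> fsubst (inst \<sigma> (Var \<sigma> k)) \<psi>"
        using wf' by (simp add: k(1) derives.Classical)
      then have "T, \<Gamma> \<turnstile> \<phi>" unfolding \<phi> using k(2,3) by (intro AllI_fresh[OF T])
      moreover have "T, \<Gamma> \<turnstile> \<^bold>\<not> \<phi>" using True by (simp add: derives.ImpI)
      ultimately show False using cons derives.ImpE by blast
    qed
    then show ?thesis using k(1) fin wf wf' by auto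
  next
    case False
    then have "?\<Delta> = \<Gamma> \<or> wf_fm \<phi> \<and> \<not> T, insert \<phi> \<Gamma> \<turnstile> Falsum \<and> ?\<Delta> = insert \<phi> \<Gamma>"
      by (auto simp: henkin_step_def split: fm.split)
    then show ?thesis using fin wf cons by auto
  qed
  then show "\<Gamma> \<subseteq> ?\<Delta>" "finite ?\<Delta>" "\<forall>\<gamma>\<in>?\<Delta>. wf_fm \<gamma>" "\<not> T, ?\<Delta> \<turnstile> Falsum" by blast+
qed

text \<open>Free variables serve as Henkin constants: every stage is finite, so a fresh one always exists.\<close>

primrec henkin_chain :: "fm set \<Rightarrow> fm \<Rightarrow> nat \<Rightarrow> fm set" where
  "henkin_chain T \<chi> 0 = {\<^bold>\<not> \<chi>}"
| "henkin_chain T \<chi> (Suc n) = henkin_step T (henkin_chain T \<chi> n) (from_nat n)"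

theorem henkin_extension:
  assumes T: "\<And>\<phi> s. \<phi> \<in> T \<Longrightarrow> well_typed s \<Longrightarrow> fsubst s \<phi> \<in> T"
    and T_wf: "\<And>\<phi>. \<phi> \<in> T \<Longrightarrow> wf_fm \<phi>"
    and wf: "wf_fm \<chi>" and unprovable: "\<not> T \<turnstile> \<chi>"
  obtains M where "henkin T M" "\<chi> \<notin> M"
proof -
  let ?C = "henkin_chain T \<chi>"
  \<comment> \<open>Collecting what the stages derive, rather than their union, makes closure under
    the rules immediate: two premises meet at the later of their stages.\<close>
  define M where "M = {\<phi>. wf_fm \<phi> \<and> (\<exists>n. T, ?C n \<turnstile> \<phi>)}"
  have inv: "finite (?C n) \<and> (\<forall>\<gamma>\<in>?C n. wf_fm \<gamma>) \<and> \<not> T, ?C n \<turnstile> Falsum" for n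
  proof (induction n)
    case 0
    show ?case using wf unprovable derives.Classical[of \<chi> T "{}"] by auto
  next
    case (Suc n)
    then show ?case using henkin_step[OF T, of "?C n" "from_nat n"] by auto
  qed
  have "?C n \<subseteq> ?C (Suc n)" for n
    using henkin_step(1)[OF T, of "?C n" "from_nat n"] inv[of n] by simp
  then have mono: "?C m \<subseteq> ?C n" if "m \<le> n" for m n
    using that by (rule lift_Suc_mono_le)
  have MP: "\<psi> \<in> M" if "\<phi> \<^bold>\<longrightarrow> \<psi> \<in> M" "\<phi> \<in> M" for \<phi> \<psi>
  proof -
    obtain m n where "T, ?C m \<turnstile> \<phi> \<^bold>\<longrightarrow> \<psi>" "T, ?C n \<turnstile> \<phi>" "wf_fm \<psi>"
      using \<open>\<phi> \<^bold>\<longrightarrow> \<psi> \<in> M\<close> \<open>\<phi> \<in> M\<close> by (auto simp: M_def)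
    then have "T, ?C (max m n) \<turnstile> \<psi>"
      using derives_weaken mono by (metis derives.ImpE max.cobounded1 max.cobounded2)
    with \<open>wf_fm \<psi>\<close> show ?thesis by (auto simp: M_def)
  qed
  have bot: "Falsum \<notin> M" using inv by (simp add: M_def)
  \<comment> \<open>The formula \<open>\<phi>\<close> is decided at stage
    \<open>to_nat \<phi>\<close>, where the enumeration reaches it.\<close>
  have step: "T, ?C (Suc (to_nat \<phi>)) \<turnstile> \<phi> \<or> T, insert \<phi> (?C (to_nat \<phi>)) \<turnstile> Falsum" if "wf_fm \<phi>" for \<phi>
    using that derives.Assm[of \<phi> "?C (Suc (to_nat \<phi>))" T] by (auto simp: henkin_step_def)
  have neg: "\<phi> \<in> M \<or> \<^bold>\<not> \<phi> \<in> M" if "wf_fm \<phi>" for \<phi>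
    using step[OF that] that by (auto simp: M_def simp del: henkin_chain.simps intro: derives.ImpI)
  have "henkin T M"
  proof
    show "Falsum \<notin> M" by (rule bot)
    show "wf_fm \<phi>" if "\<phi> \<in> M" for \<phi> using that by (simp add: M_def)
    show "\<phi> \<in> M" if "\<phi> \<in> T" for \<phi> using that T_wf by (auto simp: M_def intro: derives.Axiom)
    show "Eq t t \<in> M" if "has_type t Nat" for t using that by (auto simp: M_def intro: derives.Refl)
    show "\<phi> \<^bold>\<longrightarrow> \<psi> \<in> M \<longleftrightarrow> (\<phi> \<in> M \<longrightarrow> \<psi> \<in> M)" if "wf_fm \<phi>" "wf_fm \<psi>" for \<phi> \<psi>
    proof
      show "\<phi> \<^bold>\<longrightarrow> \<psi> \<in> M" if "\<phi> \<in> M \<longrightarrow> \<psi> \<in> M"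
      proof (cases "\<psi> \<in> M")
        case True
        then obtain n where "T, ?C n \<turnstile> \<psi>" by (auto simp: M_def)
        then have "T, ?C n \<turnstile> \<phi> \<^bold>\<longrightarrow> \<psi>" using \<open>wf_fm \<phi>\<close> by (blast intro: derives.ImpI derives_weaken)
        then show ?thesis using \<open>wf_fm \<phi>\<close> \<open>wf_fm \<psi>\<close> by (auto simp: M_def)
      next
        case False
        then have "\<^bold>\<not> \<phi> \<in> M" using that neg \<open>wf_fm \<phi>\<close> by blast
        then obtain n where n: "T, ?C n \<turnstile> \<^bold>\<not> \<phi>" by (auto simp: M_def)
        let ?G = "insert (\<^bold>\<not> \<psi>) (insert \<phi> (?C n))"
        have "T, ?G \<turnstile> \<^bold>\<not> \<phi>" using n by (rule derives_weaken) blast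
        moreover have "T, ?G \<turnstile> \<phi>" using \<open>wf_fm \<phi>\<close> by (simp add: derives.Assm)
        ultimately have "T, insert \<phi> (?C n) \<turnstile> \<psi>"
          using \<open>wf_fm \<psi>\<close> by (meson derives.Classical derives.ImpE)
        then show ?thesis using \<open>wf_fm \<phi>\<close> \<open>wf_fm \<psi>\<close> by (auto simp: M_def intro: derives.ImpI)
      qed
    qed (use MP in blast)
    show "fsubst (inst Nat t) \<phi> \<in> M"
      if "wf_fm \<phi>" and eq: "Eq s t \<in> M" "fsubst (inst Nat s) \<phi> \<in> M" for \<phi> s t
    proof -
      obtain m n where "T, ?C m \<turnstile> Eq s t" "T, ?C n \<turnstile> fsubst (inst Nat s) \<phi>" "has_type t Nat"
        using eq by (auto simp: M_def)
      then have "T, ?C (max m n) \<turnstile> fsubst (inst Nat t) \<phi>"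
        using derives_weaken mono derives.Leibniz[OF \<open>wf_fm \<phi>\<close>]
        by (metis max.cobounded1 max.cobounded2)
      then show ?thesis using \<open>wf_fm \<phi>\<close> \<open>has_type t Nat\<close> by (auto simp: M_def wf_fsubst)
    qed
    show "Forall \<sigma> \<phi> \<in> M \<longleftrightarrow> (\<forall>t. has_type t \<sigma> \<longrightarrow> fsubst (inst \<sigma> t) \<phi> \<in> M)"
      if "wf_fm \<phi>" for \<phi> \<sigma>
    proof
      show "\<forall>t. has_type t \<sigma> \<longrightarrow> fsubst (inst \<sigma> t) \<phi> \<in> M" if "Forall \<sigma> \<phi> \<in> M"
        using that by (auto simp: M_def wf_fsubst intro: derives.AllE)
      show "Forall \<sigma> \<phi> \<in> M" if all: "\<forall>t. has_type t \<sigma> \<longrightarrow> fsubst (inst \<sigma> t) \<phi> \<in> M"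
      proof (rule ccontr)
        assume not: "Forall \<sigma> \<phi> \<notin> M"
        \<comment> \<open>The step that rejects the universal formula adds the negation of one
          instance, against \<open>all\<close>.\<close>
        let ?n = "to_nat (Forall \<sigma> \<phi>)"
        have "T, insert (Forall \<sigma> \<phi>) (?C ?n) \<turnstile> Falsum"
          using step[of "Forall \<sigma> \<phi>"] not \<open>wf_fm \<phi>\<close> by (auto simp: M_def simp del: henkin_chain.simps)
        then obtain k where
          "henkin_step T (?C ?n) (Forall \<sigma> \<phi>) = insert (\<^bold>\<not> fsubst (inst \<sigma> (Var \<sigma> k)) \<phi>) (?C ?n)"
          using inv[of ?n] \<open>wf_fm \<phi>\<close> by (metis henkin_step_Forall wf_fm.simps(4))
        then have "?C (Suc ?n) = insert (\<^bold>\<not> fsubst (inst \<sigma> (Var \<sigma> k)) \<phi>) (?C ?n)" by simp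
        moreover have "wf_fm (fsubst (inst \<sigma> (Var \<sigma> k)) \<phi>)" using \<open>wf_fm \<phi>\<close> by (simp add: wf_fsubst)
        ultimately have "\<^bold>\<not> fsubst (inst \<sigma> (Var \<sigma> k)) \<phi> \<in> M"
          using derives.Assm[of "\<^bold>\<not> fsubst (inst \<sigma> (Var \<sigma> k)) \<phi>" "?C (Suc ?n)" T]
          by (simp add: M_def del: henkin_chain.simps) metis
        moreover have "fsubst (inst \<sigma> (Var \<sigma> k)) \<phi> \<in> M" using all by simp
        ultimately show False using MP bot by blast
      qed
    qed
  qed
  moreover have "\<^bold>\<not> \<chi> \<in> M"
    using wf derives.Assm[of "\<^bold>\<not> \<chi>" "?C 0" T] by (simp add: M_def) (metis henkin_chain.simps(1))
  then have "\<chi> \<notin> M" using MP bot by blast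
  ultimately show ?thesis using that by blast
qed

section \<open>The term model\<close>

definition ncons :: "'a \<Rightarrow> (nat \<Rightarrow> 'a) \<Rightarrow> nat \<Rightarrow> 'a" (infixr "##" 65) where
  "m ## n = case_nat m n"

lemma ncons_simps [simp]: "(m ## n) 0 = m" "(m ## n) (Suc i) = n i"
  by (simp_all add: ncons_def)

lemma ncons_numeral [simp]: "(m ## n) (numeral k) = n (pred_numeral k)"
  by (simp add: numeral_eq_Suc)

type_synonym 'n ctx_fun = "(('n \<Rightarrow> 'n) \<Rightarrow> 'n) \<Rightarrow> (nat \<Rightarrow> 'n \<Rightarrow> 'n) \<Rightarrow> (nat \<Rightarrow> 'n) \<Rightarrow> 'n"
type_synonym 'n ctx_pred = "(('n \<Rightarrow> 'n) \<Rightarrow> 'n) \<Rightarrow> (nat \<Rightarrow> 'n \<Rightarrow> 'n) \<Rightarrow> (nat \<Rightarrow> 'n) \<Rightarrow> bool"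

text \<open>
  \<open>R\<close> and \<open>Q\<close> are the functions and predicates that are definable by a term or by a quantifier-free
  formula from a functional \<open>Y\<close>, functions \<open>x 0, x 1, \<dots>\<close> and numbers \<open>n 0, n 1, \<dots>\<close>; a bound number or
  function variable becomes entry \<open>0\<close>.  \<open>E\<close> is the functional of \<open>(\<exists>\<^sup>2)\<close>.  Elements of \<open>D2\<close> matter only
  through their values on \<open>D1\<close>.  The variables \<open>f\<close>, \<open>F\<close> and \<open>P\<close> in \<open>R_D1\<close>, \<open>R_D2\<close> and \<open>Q_induct\<close> are
  there because \<open>g Y x (m ## n)\<close> is not a higher-order pattern and does not unify well.
\<close>

locale omega_model =
  fixes zero :: 'n and suc :: "'n \<Rightarrow> 'n" and pr :: "'n \<Rightarrow> 'n"
    and plus times monus :: "'n \<Rightarrow> 'n \<Rightarrow> 'n" and pow2 :: "'n \<Rightarrow> 'n"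
    and D1 :: "('n \<Rightarrow> 'n) set" and D2 :: "(('n \<Rightarrow> 'n) \<Rightarrow> 'n) set" and E :: "('n \<Rightarrow> 'n) \<Rightarrow> 'n"
    and R :: "'n ctx_fun \<Rightarrow> bool" and Q :: "'n ctx_pred \<Rightarrow> bool"
  assumes suc_inj: "suc a = suc b \<Longrightarrow> a = b" and suc_nonzero: "suc a \<noteq> zero"
    and pr_zero: "pr zero = zero" and pr_suc: "pr (suc a) = a"
    and plus_zero: "plus a zero = a" and plus_suc: "plus a (suc b) = suc (plus a b)"
    and times_zero: "times a zero = zero" and times_suc: "times a (suc b) = plus a (times a b)"
    and monus_zero: "monus a zero = a" and monus_suc: "monus a (suc b) = pr (monus a b)"
    and pow2_zero: "pow2 zero = suc zero" and pow2_suc: "pow2 (suc a) = times (suc (suc zero)) (pow2 a)"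
    and D1_nonempty: "D1 \<noteq> {}" and E_in_D2: "E \<in> D2"
    and E_zero: "f \<in> D1 \<Longrightarrow> E f = zero \<longleftrightarrow> (\<exists>n. f n = zero)"
    and E_le: "f \<in> D1 \<Longrightarrow> monus (E f) (suc zero) = zero"
    and R_num: "R (\<lambda>Y x n. n i)"
    and R_zero: "R (\<lambda>Y x n. zero)"
    and R_suc: "R g \<Longrightarrow> R (\<lambda>Y x n. suc (g Y x n))"
    and R_plus: "R g \<Longrightarrow> R h \<Longrightarrow> R (\<lambda>Y x n. plus (g Y x n) (h Y x n))"
    and R_times: "R g \<Longrightarrow> R h \<Longrightarrow> R (\<lambda>Y x n. times (g Y x n) (h Y x n))"
    and R_monus: "R g \<Longrightarrow> R h \<Longrightarrow> R (\<lambda>Y x n. monus (g Y x n) (h Y x n))"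
    and R_pow2: "R g \<Longrightarrow> R (\<lambda>Y x n. pow2 (g Y x n))"
    and R_fun: "R g \<Longrightarrow> R (\<lambda>Y x n. x i (g Y x n))"
    and R_Y: "R g \<Longrightarrow> R (\<lambda>Y x n. Y (\<lambda>m. g Y x (m ## n)))"
    and R_E: "R g \<Longrightarrow> R (\<lambda>Y x n. E (\<lambda>m. g Y x (m ## n)))"
    and R_rec: "R g \<Longrightarrow> R h \<Longrightarrow> \<exists>r. R r \<and>
      (\<forall>Y\<in>D2. \<forall>x n. (\<forall>i. x i \<in> D1) \<longrightarrow> r Y x (zero ## n) = h Y x n \<and>
        (\<forall>m. r Y x (suc m ## n) = g Y x (r Y x (m ## n) ## m ## n)))"
    and R_D1: "R g \<Longrightarrow> Y \<in> D2 \<Longrightarrow> (\<And>i. x i \<in> D1) \<Longrightarrow> (\<And>m. f m = g Y x (m ## n)) \<Longrightarrow> f \<in> D1"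
    and R_D2: "R g \<Longrightarrow> Y \<in> D2 \<Longrightarrow> (\<And>i. x i \<in> D1) \<Longrightarrow> (\<And>z. F z = g Y (z ## x) n) \<Longrightarrow>
      \<exists>Z\<in>D2. \<forall>z\<in>D1. Z z = F z"
    and Q_eq: "R g \<Longrightarrow> R h \<Longrightarrow> Q (\<lambda>Y x n. g Y x n = h Y x n)"
    and Q_False: "Q (\<lambda>Y x n. False)"
    and Q_imp: "Q p \<Longrightarrow> Q q \<Longrightarrow> Q (\<lambda>Y x n. p Y x n \<longrightarrow> q Y x n)"
    and Q_induct: "Q p \<Longrightarrow> Y \<in> D2 \<Longrightarrow> (\<And>i. x i \<in> D1) \<Longrightarrow> (\<And>m. P m = p Y x (m ## n)) \<Longrightarrow>
      P zero \<Longrightarrow> (\<And>m. P m \<Longrightarrow> P (suc m)) \<Longrightarrow> (\<forall>m. P m)"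
begin

section \<open>Real numbers and the principles, read inside a model\<close>

definition pair :: "'n \<Rightarrow> 'n \<Rightarrow> 'n" where
  "pair m n = plus (times (plus m n) (plus m n)) m"

definition code :: "'n \<Rightarrow> 'n \<Rightarrow> 'n \<Rightarrow> 'n" where
  "code a b c = pair (pair a b) c"

definition diff_holds :: "('n \<Rightarrow> 'n \<Rightarrow> 'n \<Rightarrow> 'n \<Rightarrow> bool) \<Rightarrow> 'n \<Rightarrow> 'n \<Rightarrow> 'n \<Rightarrow> bool" where
  "diff_holds A q r n \<longleftrightarrow> (\<exists>a b c d e f. q = code a b c \<and> r = code d e f \<and>
     A (plus (times a (suc f)) (times e (suc c))) (plus (times b (suc f)) (times d (suc c)))
       (times (suc c) (suc f)) n)"

definition real_seq :: "('n \<Rightarrow> 'n) \<Rightarrow> bool" where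
  "real_seq x \<longleftrightarrow> (\<forall>n i. diff_holds
     (\<lambda>P Q D n. monus (suc (times (pow2 n) (plus (monus P Q) (monus Q P)))) D = zero)
     (x n) (x (plus n i)) n)"

definition real_eq :: "('n \<Rightarrow> 'n) \<Rightarrow> ('n \<Rightarrow> 'n) \<Rightarrow> bool" where
  "real_eq x y \<longleftrightarrow> (\<forall>n. diff_holds
     (\<lambda>P Q D n. monus (times (pow2 n) (plus (monus P Q) (monus Q P))) (times (suc (suc zero)) D) = zero)
     (x n) (y n) n)"

definition real_le :: "('n \<Rightarrow> 'n) \<Rightarrow> ('n \<Rightarrow> 'n) \<Rightarrow> bool" where
  "real_le x y \<longleftrightarrow> (\<forall>n. diff_holds
     (\<lambda>P Q D n. monus (times (pow2 n) (monus P Q)) (times (suc (suc zero)) D) = zero)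
     (x n) (y n) n)"

definition unit_real :: "('n \<Rightarrow> 'n) \<Rightarrow> bool" where
  "unit_real x \<longleftrightarrow> real_seq x \<and> real_le (\<lambda>_. code zero zero zero) x \<and> real_le x (\<lambda>_. code (suc zero) zero zero)"

definition Cantor :: "('n \<Rightarrow> 'n) \<Rightarrow> bool" where
  "Cantor f \<longleftrightarrow> (\<forall>n. monus (f n) (suc zero) = zero)"

definition nin_reals :: "(('n \<Rightarrow> 'n) \<Rightarrow> bool) \<Rightarrow> bool" where
  "nin_reals D \<longleftrightarrow> (\<forall>Y\<in>D2. (\<forall>x\<in>D1. \<forall>y\<in>D1. D x \<and> D y \<and> real_eq x y \<longrightarrow> Y x = Y y) \<longrightarrow>
     (\<exists>x\<in>D1. \<exists>y\<in>D1. D x \<and> D y \<and> \<not> real_eq x y \<and> Y x = Y y))"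

definition nin_Cantor :: bool where
  "nin_Cantor \<longleftrightarrow> (\<forall>Y\<in>D2. \<exists>x\<in>D1. \<exists>y\<in>D1. Cantor x \<and> Cantor y \<and> x \<noteq> y \<and> Y x = Y y)"

definition nin_Baire :: bool where
  "nin_Baire \<longleftrightarrow> (\<forall>Y\<in>D2. \<exists>x\<in>D1. \<exists>y\<in>D1. x \<noteq> y \<and> Y x = Y y)"

definition nin_equivalent :: bool where
  "nin_equivalent \<longleftrightarrow> (nin_reals unit_real \<longleftrightarrow> nin_Cantor) \<and> (nin_Cantor \<longleftrightarrow> nin_Baire) \<and>
     (nin_Baire \<longleftrightarrow> nin_reals real_seq)"

end

context henkin begin

text \<open>Truth under an assignment of terms is membership in \<open>M\<close> after substitution;
  the conditions of \<open>henkin\<close> then become the usual recursion for truth.\<close>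

definition sat :: "(ty \<Rightarrow> nat \<Rightarrow> tm) \<Rightarrow> fm \<Rightarrow> bool" where
  "sat e \<phi> \<longleftrightarrow> fsubst e \<phi> \<in> M"

lemma sat_Imp [simp]: "well_typed e \<Longrightarrow> wf_fm \<phi> \<Longrightarrow> wf_fm \<psi> \<Longrightarrow>
    sat e (\<phi> \<^bold>\<longrightarrow> \<psi>) \<longleftrightarrow> (sat e \<phi> \<longrightarrow> sat e \<psi>)"
  by (simp add: sat_def M_Imp wf_fsubst)

lemma sat_Falsum [simp]: "\<not> sat e Falsum"
  by (simp add: sat_def)

lemma sat_Forall: "well_typed e \<Longrightarrow> wf_fm \<phi> \<Longrightarrow>
    sat e (Forall \<sigma> \<phi>) \<longleftrightarrow> (\<forall>t. has_type t \<sigma> \<longrightarrow> sat (push \<sigma> t e) \<phi>)"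
  by (simp add: sat_def M_Forall wf_fsubst fsubst_inst_up)

lemma sat_Exists: "well_typed e \<Longrightarrow> wf_fm \<phi> \<Longrightarrow>
    sat e (Exists \<sigma> \<phi>) \<longleftrightarrow> (\<exists>t. has_type t \<sigma> \<and> sat (push \<sigma> t e) \<phi>)"
  by (auto simp: sat_Forall)

definition eqv :: "ty \<Rightarrow> tm \<Rightarrow> tm \<Rightarrow> bool" where
  "eqv \<sigma> s t \<longleftrightarrow> has_type s \<sigma> \<and> has_type t \<sigma> \<and> eq_at \<sigma> s t \<in> M"

lemma eqv_types: "eqv \<sigma> s t \<Longrightarrow> has_type s \<sigma>" "eqv \<sigma> s t \<Longrightarrow> has_type t \<sigma>"
  by (simp_all add: eqv_def)

lemma eqv_Fn: "eqv (\<sigma> \<rightarrow> \<tau>) s t \<longleftrightarrow> has_type s (\<sigma> \<rightarrow> \<tau>) \<and> has_type t (\<sigma> \<rightarrow> \<tau>) \<and>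
    (\<forall>u. has_type u \<sigma> \<longrightarrow> eqv \<tau> (s \<cdot> u) (t \<cdot> u))"
proof (cases "has_type s (\<sigma> \<rightarrow> \<tau>) \<and> has_type t (\<sigma> \<rightarrow> \<tau>)")
  case True
  have "has_type (s \<cdot> u) \<tau>" "has_type (t \<cdot> u) \<tau>" if "has_type u \<sigma>" for u
    using True that by auto
  moreover have "wf_fm (eq_at \<tau> (lift \<sigma> s \<cdot> Var \<sigma> 0) (lift \<sigma> t \<cdot> Var \<sigma> 0))"
    using True by (auto intro!: wf_eq_at)
  ultimately show ?thesis
    using True by (simp add: eqv_def M_Forall del: has_type.simps, simp add: inst_eq_push)
qed (auto simp: eqv_def)

lemma eqv_refl: "has_type s \<sigma> \<Longrightarrow> eqv \<sigma> s s"
proof (induction \<sigma> arbitrary: s)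
  case Nat
  then show ?case by (simp add: eqv_def M_Refl)
next
  case (Fn \<sigma> \<tau>)
  have "eqv \<tau> (s \<cdot> u) (s \<cdot> u)" if "has_type u \<sigma>" for u
    using Fn that by (intro Fn.IH) auto
  then show ?case using Fn.prems by (simp add: eqv_Fn)
qed

lemma eqv_sym: "eqv \<sigma> s t \<Longrightarrow> eqv \<sigma> t s"
proof (induction \<sigma> arbitrary: s t)
  case Nat
  then show ?case
    using M_Leibniz[of "Eq (Var Nat 0) (lift Nat s)" s t] M_Refl[of s]
    by (simp add: eqv_def inst_eq_push)
qed (auto simp: eqv_Fn)

lemma eqv_trans: "eqv \<sigma> s t \<Longrightarrow> eqv \<sigma> t u \<Longrightarrow> eqv \<sigma> s u"
proof (induction \<sigma> arbitrary: s t u)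
  case Nat
  then show ?case
    using M_Leibniz[of "Eq (lift Nat s) (Var Nat 0)" t u]
    by (simp add: eqv_def inst_eq_push)
next
  case (Fn \<sigma> \<tau>)
  then show ?case unfolding eqv_Fn by blast
qed

end

text \<open>\<open>ab\<close> identifies the numerical terms, free variables included, that \<open>M\<close> proves equal.\<close>

locale aca_model = henkin ACA0_omega M for M +
  fixes ab :: "tm \<Rightarrow> 'n"
  assumes ab_eq: "has_type s Nat \<Longrightarrow> has_type t Nat \<Longrightarrow> ab s = ab t \<longleftrightarrow> Eq s t \<in> M"
    and ab_surj: "\<exists>t. has_type t Nat \<and> ab t = n"
begin

lemma M_PRA: "\<phi> \<in> E_PRA_omega \<Longrightarrow> \<phi> \<in> M"
  by (rule M_axiom) (simp add: ACA0_omega_def RCA0_omega_def)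

lemma eqv_Nat: "eqv Nat s t \<longleftrightarrow> has_type s Nat \<and> has_type t Nat \<and> ab s = ab t"
  by (auto simp: eqv_def ab_eq)

text \<open>The axiom of extensionality replaces the argument under a fixed function; replacing the
  function is pointwise equality, which is how equality of functions is defined.\<close>

lemma eqv_app:
  assumes fg: "eqv (\<sigma> \<rightarrow> \<tau>) f g" and st: "eqv \<sigma> s t"
  shows "eqv \<tau> (f \<cdot> s) (g \<cdot> t)"
proof -
  have ty: "has_type f (\<sigma> \<rightarrow> \<tau>)" "has_type s \<sigma>" "has_type t \<sigma>"
    using fg st by (auto dest: eqv_types)
  have ty': "has_type (f \<cdot> s) \<tau>" "has_type (f \<cdot> t) \<tau>" using ty by auto
  have "eq_at \<sigma> s t \<^bold>\<longrightarrow> eq_at \<tau> (f \<cdot> s) (f \<cdot> t) \<in> M"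
    using ty by (intro M_PRA E_PRA_omega.Extensionality)
  then have "eqv \<tau> (f \<cdot> s) (f \<cdot> t)"
    using st ty ty' by (simp add: M_Imp wf_eq_at eqv_def del: has_type.simps)
  moreover have "eqv \<tau> (f \<cdot> t) (g \<cdot> t)" using fg ty by (simp add: eqv_Fn)
  ultimately show ?thesis by (rule eqv_trans)
qed

lemma eqv_PiC: "has_type s \<rho> \<Longrightarrow> has_type t \<sigma> \<Longrightarrow> eqv \<rho> (PiC \<rho> \<sigma> \<cdot> s \<cdot> t) s"
  by (auto simp: eqv_def M_PRA E_PRA_omega.PiC)

lemma eqv_SigC:
  assumes "has_type s (\<delta> \<rightarrow> \<rho> \<rightarrow> \<sigma>)" "has_type t (\<delta> \<rightarrow> \<rho>)" "has_type u \<delta>"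
  shows "eqv \<sigma> (SigC \<delta> \<rho> \<sigma> \<cdot> s \<cdot> t \<cdot> u) (s \<cdot> u \<cdot> (t \<cdot> u))"
  using assms M_PRA[OF E_PRA_omega.SigC[OF assms]] unfolding eqv_def has_type.simps by blast

text \<open>Bracket abstraction: terms have no binders, so the lambda term is assembled from
  combinators by recursion on the body. One \<open>l\<close> serves all assignments \<open>e\<close>
  to the parameters.\<close>

lemma abstraction:
  assumes "has_type t \<tau>"
  obtains l where "has_type l (\<sigma> \<rightarrow> \<tau>)"
    and "\<And>e u. well_typed e \<Longrightarrow> has_type u \<sigma> \<Longrightarrow> eqv \<tau> (tsubst e l \<cdot> u) (tsubst (push \<sigma> u e) t)"
proof -
  let ?P = "\<lambda>t \<tau> l. has_type l (\<sigma> \<rightarrow> \<tau>) \<and> (\<forall>e u. well_typed e \<longrightarrow> has_type u \<sigma> \<longrightarrow>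
    eqv \<tau> (tsubst e l \<cdot> u) (tsubst (push \<sigma> u e) t))"
  have const: "\<exists>l. ?P t \<tau> l" if "has_type c \<tau>" "\<And>e u. tsubst (push \<sigma> u e) t = tsubst e c" for t c \<tau>
    using that by (intro exI[of _ "PiC \<tau> \<sigma> \<cdot> c"]) (auto intro: eqv_PiC simp: has_type_tsubst)
  have const0: "\<exists>l. ?P t \<tau> l" if "has_type t \<tau>" "\<And>e. tsubst e t = t" for t \<tau>
    using that by (intro const[of t]) auto
  have "\<exists>l. ?P t \<tau> l" using assms
  proof (induction t arbitrary: \<tau>)
    case (Var \<rho> i)
    show ?case
    proof (cases "\<rho> = \<sigma> \<and> i = 0")
      case True
      \<comment> \<open>The identity in the familiar form S K K.\<close>
      let ?I = "SigC \<sigma> (\<sigma> \<rightarrow> \<sigma>) \<sigma> \<cdot> PiC \<sigma> (\<sigma> \<rightarrow> \<sigma>) \<cdot> PiC \<sigma> \<sigma>"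
      have "eqv \<sigma> (?I \<cdot> u) u" if "has_type u \<sigma>" for u
        by (rule eqv_trans[OF eqv_SigC eqv_PiC]) (use that in auto)
      then show ?thesis using True Var by (intro exI[of _ ?I]) auto
    next
      case False
      \<comment> \<open>Abstraction removes index \<open>0\<close> of type \<open>\<sigma>\<close>,
        so the higher indices of that type go down by one.\<close>
      then show ?thesis using Var
        by (intro const[of "Var \<rho> (if \<rho> = \<sigma> then i - 1 else i)"]) (cases i; auto)+
    qed
  next
    case (App s t)
    then obtain \<rho> where "has_type s (\<rho> \<rightarrow> \<tau>)" "has_type t \<rho>" by auto
    then obtain k l where k: "?P s (\<rho> \<rightarrow> \<tau>) k" and l: "?P t \<rho> l"
      using App.IH by meson
    have "eqv \<tau> (tsubst e (SigC \<sigma> \<rho> \<tau> \<cdot> k \<cdot> l) \<cdot> u) (tsubst (push \<sigma> u e) (s \<cdot> t))"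
      if "well_typed e" "has_type u \<sigma>" for e u
    proof -
      have "eqv \<tau> (SigC \<sigma> \<rho> \<tau> \<cdot> tsubst e k \<cdot> tsubst e l \<cdot> u) (tsubst e k \<cdot> u \<cdot> (tsubst e l \<cdot> u))"
        using k l that by (intro eqv_SigC) (auto simp: has_type_tsubst)
      moreover have "eqv \<tau> (tsubst e k \<cdot> u \<cdot> (tsubst e l \<cdot> u)) (tsubst (push \<sigma> u e) s \<cdot> tsubst (push \<sigma> u e) t)"
        using k l that by (intro eqv_app) auto
      ultimately show ?thesis by (auto intro: eqv_trans)
    qed
    then show ?case using k l by (intro exI[of _ "SigC \<sigma> \<rho> \<tau> \<cdot> k \<cdot> l"]) auto
  qed (rule const0; simp)+
  then show ?thesis using that by blast
qed

section \<open>Numbers, functions and functionals named by terms\<close>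

definition re :: "'n \<Rightarrow> tm" where "re n = (SOME t. has_type t Nat \<and> ab t = n)"

lemma re_type [simp]: "has_type (re n) Nat" and ab_re [simp]: "ab (re n) = n"
  using someI_ex[OF ab_surj[of n]] by (simp_all add: re_def)

lemma eqv_re: "has_type t Nat \<Longrightarrow> eqv Nat (re (ab t)) t"
  by (simp add: eqv_Nat)

lemma ab_app1: "eqv (Nat \<rightarrow> Nat) f g \<Longrightarrow> eqv Nat s t \<Longrightarrow> ab (f \<cdot> s) = ab (g \<cdot> t)"
  using eqv_app[of Nat Nat f g s t] by (simp add: eqv_Nat)

definition fun1 :: "tm \<Rightarrow> 'n \<Rightarrow> 'n" where "fun1 f n = ab (f \<cdot> re n)"

definition D1 :: "('n \<Rightarrow> 'n) set" where "D1 = fun1 ` {f. has_type f ty1}"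

definition re1 :: "('n \<Rightarrow> 'n) \<Rightarrow> tm" where "re1 x = (SOME f. has_type f ty1 \<and> fun1 f = x)"

lemma fun1_D1: "has_type f ty1 \<Longrightarrow> fun1 f \<in> D1"
  by (simp add: D1_def)

lemma re1_props: "x \<in> D1 \<Longrightarrow> has_type (re1 x) ty1 \<and> fun1 (re1 x) = x"
  unfolding re1_def by (rule someI_ex) (auto simp: D1_def)

lemma re1_type: "x \<in> D1 \<Longrightarrow> has_type (re1 x) ty1"
  and fun1_re1: "x \<in> D1 \<Longrightarrow> fun1 (re1 x) = x"
  using re1_props by auto

lemma fun1_ab: "has_type f ty1 \<Longrightarrow> has_type t Nat \<Longrightarrow> fun1 f (ab t) = ab (f \<cdot> t)"
  unfolding fun1_def by (intro ab_app1 eqv_refl eqv_re)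

lemma fun1_eq_iff: "has_type f ty1 \<Longrightarrow> has_type g ty1 \<Longrightarrow> fun1 f = fun1 g \<longleftrightarrow> eqv ty1 f g"
proof
  assume f: "has_type f ty1" "has_type g ty1" and "fun1 f = fun1 g"
  then have "ab (f \<cdot> u) = ab (g \<cdot> u)" if "has_type u Nat" for u
    using that by (metis fun1_ab)
  then show "eqv ty1 f g" using f by (auto simp: eqv_Fn eqv_Nat)
next
  assume "eqv ty1 f g"
  then show "fun1 f = fun1 g" by (auto simp: fun1_def eqv_Fn eqv_Nat)
qed

text \<open>Only the values on \<open>D1\<close> are determined by \<open>y\<close>; elsewhere
  \<open>re1\<close> picks a term without further meaning.\<close>

definition fun2 :: "tm \<Rightarrow> ('n \<Rightarrow> 'n) \<Rightarrow> 'n" where "fun2 y x = ab (y \<cdot> re1 x)"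

definition D2 :: "(('n \<Rightarrow> 'n) \<Rightarrow> 'n) set" where "D2 = fun2 ` {y. has_type y ty2}"

definition re2 :: "(('n \<Rightarrow> 'n) \<Rightarrow> 'n) \<Rightarrow> tm" where "re2 Y = (SOME y. has_type y ty2 \<and> fun2 y = Y)"

lemma re2_props: "Y \<in> D2 \<Longrightarrow> has_type (re2 Y) ty2 \<and> fun2 (re2 Y) = Y"
  unfolding re2_def by (rule someI_ex) (auto simp: D2_def)

lemma re2_type: "Y \<in> D2 \<Longrightarrow> has_type (re2 Y) ty2"
  and fun2_re2: "Y \<in> D2 \<Longrightarrow> fun2 (re2 Y) = Y"
  using re2_props by auto

text \<open>The chosen name of \<open>fun1 f\<close> may differ from \<open>f\<close>, but the two
  are equal in \<open>M\<close>, and by extensionality \<open>y\<close> ignores the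
  difference.\<close>

lemma fun2_fun1:
  assumes "has_type y ty2" "has_type f ty1" shows "fun2 y (fun1 f) = ab (y \<cdot> f)"
proof -
  have "eqv ty1 (re1 (fun1 f)) f"
    using fun1_D1[OF assms(2)] assms(2) re1_type fun1_re1 fun1_eq_iff by blast
  then have "eqv Nat (y \<cdot> re1 (fun1 f)) (y \<cdot> f)"
    using assms(1) by (intro eqv_app eqv_refl)
  then show ?thesis by (simp add: fun2_def eqv_Nat)
qed

lemma sat_Eq [simp]: "well_typed e \<Longrightarrow> has_type s Nat \<Longrightarrow> has_type t Nat \<Longrightarrow>
    sat e (Eq s t) \<longleftrightarrow> ab (tsubst e s) = ab (tsubst e t)"
  by (simp add: sat_def ab_eq has_type_tsubst)

abbreviation "zero \<equiv> ab Zero"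
definition suc :: "'n \<Rightarrow> 'n" where "suc a = ab (Succ \<cdot> re a)"
definition pr :: "'n \<Rightarrow> 'n" where "pr a = ab (Rec \<cdot> PiC Nat Nat \<cdot> Zero \<cdot> re a)"
definition plus :: "'n \<Rightarrow> 'n \<Rightarrow> 'n" where "plus a b = ab (tplus (re a) (re b))"
definition times :: "'n \<Rightarrow> 'n \<Rightarrow> 'n" where "times a b = ab (ttimes (re a) (re b))"
definition monus :: "'n \<Rightarrow> 'n \<Rightarrow> 'n" where "monus a b = ab (tmonus (re a) (re b))"
definition pow2 :: "'n \<Rightarrow> 'n" where "pow2 a = ab (tpow2 (re a))"

lemma ab_Succ: "has_type t Nat \<Longrightarrow> ab (Succ \<cdot> t) = suc (ab t)"
  unfolding suc_def by (intro ab_app1 eqv_refl eqv_sym[OF eqv_re]) auto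

lemma Rec_type: "has_type f (Nat \<rightarrow> Nat \<rightarrow> Nat) \<Longrightarrow> has_type m Nat \<Longrightarrow> has_type (Rec \<cdot> f \<cdot> m) ty1"
  by auto

lemma eqv_Rec: "eqv (Nat \<rightarrow> Nat \<rightarrow> Nat) f g \<Longrightarrow> eqv Nat m n \<Longrightarrow> eqv ty1 (Rec \<cdot> f \<cdot> m) (Rec \<cdot> g \<cdot> n)"
  by (intro eqv_app[of Nat ty1] eqv_app[of "Nat \<rightarrow> Nat \<rightarrow> Nat" "Nat \<rightarrow> Nat \<rightarrow> Nat"] eqv_refl) auto

lemma ab_Rec_Zero: "has_type f (Nat \<rightarrow> Nat \<rightarrow> Nat) \<Longrightarrow> has_type m Nat \<Longrightarrow> ab (Rec \<cdot> f \<cdot> m \<cdot> Zero) = ab m"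
  using M_PRA[OF E_PRA_omega.Rec_Zero[of f m]] by (subst ab_eq) auto

lemma ab_Rec_Succ: "has_type f (Nat \<rightarrow> Nat \<rightarrow> Nat) \<Longrightarrow> has_type m Nat \<Longrightarrow> has_type n Nat \<Longrightarrow>
    ab (Rec \<cdot> f \<cdot> m \<cdot> (Succ \<cdot> n)) = ab (f \<cdot> n \<cdot> (Rec \<cdot> f \<cdot> m \<cdot> n))"
  using M_PRA[OF E_PRA_omega.Rec_Succ[of f m n]] by (subst ab_eq) auto

lemma ab_Rec_PiC_Succ:
  assumes "has_type f ty1" "has_type m Nat" "has_type n Nat"
  shows "ab (Rec \<cdot> (PiC ty1 Nat \<cdot> f) \<cdot> m \<cdot> (Succ \<cdot> n)) = ab (f \<cdot> (Rec \<cdot> (PiC ty1 Nat \<cdot> f) \<cdot> m \<cdot> n))"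
  using assms by (subst ab_Rec_Succ) (auto intro!: ab_app1 eqv_PiC eqv_refl)

lemma eqv_PiC_cong: "eqv \<rho> s t \<Longrightarrow> eqv (\<sigma> \<rightarrow> \<rho>) (PiC \<rho> \<sigma> \<cdot> s) (PiC \<rho> \<sigma> \<cdot> t)"
  by (rule eqv_app[OF eqv_refl]) auto

lemma eqv_adder: "eqv Nat s t \<Longrightarrow> eqv ty1 (Rec \<cdot> (PiC ty1 Nat \<cdot> Succ) \<cdot> s) (Rec \<cdot> (PiC ty1 Nat \<cdot> Succ) \<cdot> t)"
  by (intro eqv_Rec eqv_refl) auto

lemma ab_tplus: "has_type s Nat \<Longrightarrow> has_type t Nat \<Longrightarrow> ab (tplus s t) = plus (ab s) (ab t)"
  unfolding plus_def tplus_def by (intro ab_app1 eqv_adder eqv_sym[OF eqv_re])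

lemma ab_ttimes: "has_type s Nat \<Longrightarrow> has_type t Nat \<Longrightarrow> ab (ttimes s t) = times (ab s) (ab t)"
  unfolding times_def ttimes_def
  by (intro ab_app1 eqv_Rec eqv_PiC_cong eqv_adder eqv_sym[OF eqv_re] eqv_refl) auto

lemma ab_tmonus: "has_type s Nat \<Longrightarrow> has_type t Nat \<Longrightarrow> ab (tmonus s t) = monus (ab s) (ab t)"
  unfolding monus_def tmonus_def
  by (intro ab_app1 eqv_Rec eqv_sym[OF eqv_re] eqv_refl) auto

lemma ab_tpow2: "has_type t Nat \<Longrightarrow> ab (tpow2 t) = pow2 (ab t)"
  unfolding pow2_def tpow2_def
  by (intro ab_app1 eqv_sym[OF eqv_re] eqv_refl) auto

lemmas ab_simps = ab_Succ ab_tplus ab_ttimes ab_tmonus ab_tpow2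

text \<open>Every number has a name, so each law is an axiom about names; the recursion laws arise
  from unfolding the recursor once.\<close>

lemma arithmetic:
  "suc a = suc b \<Longrightarrow> a = b" "suc a \<noteq> zero" "pr zero = zero" "pr (suc a) = a"
  "plus a zero = a" "plus a (suc b) = suc (plus a b)"
  "times a zero = zero" "times a (suc b) = plus a (times a b)"
  "monus a zero = a" "monus a (suc b) = pr (monus a b)"
  "pow2 zero = suc zero" "pow2 (suc a) = times (suc (suc zero)) (pow2 a)"
proof -
  obtain s t where s: "has_type s Nat" "ab s = a" and t: "has_type t Nat" "ab t = b"
    using ab_surj by metis
  show "suc a = suc b \<Longrightarrow> a = b"
    using M_PRA[OF E_PRA_omega.Succ_inj[OF s(1) t(1)]] s t
    by (simp add: M_Imp flip: ab_eq) (simp add: ab_Succ)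
  show "suc a \<noteq> zero"
    using M_PRA[OF E_PRA_omega.Succ_nonzero[OF s(1)]] s
    by (simp add: M_Imp flip: ab_eq) (simp add: ab_Succ)
  have pr: "pr (ab u) = ab (Rec \<cdot> PiC Nat Nat \<cdot> Zero \<cdot> u)" if "has_type u Nat" for u
    using that unfolding pr_def by (intro ab_app1 eqv_re eqv_refl) auto
  show "pr zero = zero" by (simp add: pr ab_Rec_Zero)
  have "pr (suc (ab s)) = ab (PiC Nat Nat \<cdot> s \<cdot> (Rec \<cdot> PiC Nat Nat \<cdot> Zero \<cdot> s))"
    using s(1) by (simp add: pr ab_Rec_Succ flip: ab_Succ)
  also have "\<dots> = ab s" using eqv_PiC[of s Nat "Rec \<cdot> PiC Nat Nat \<cdot> Zero \<cdot> s" Nat] s by (simp add: eqv_Nat)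
  finally show "pr (suc a) = a" using s by simp
  show "plus a zero = a" using s ab_tplus[of s Zero] by (simp add: tplus_def ab_Rec_Zero)
  show "plus a (suc b) = suc (plus a b)"
    using s t ab_tplus[of s "Succ \<cdot> t"] ab_tplus[of s t] ab_Succ[of "tplus s t"]
    by (simp add: tplus_def ab_Rec_PiC_Succ ab_Succ)
  show "times a zero = zero" using s ab_ttimes[of s Zero] by (simp add: ttimes_def ab_Rec_Zero)
  show "times a (suc b) = plus a (times a b)"
    using s t ab_ttimes[of s "Succ \<cdot> t"] ab_ttimes[of s t] ab_tplus[of s "ttimes s t"]
    by (simp add: ttimes_def ab_Rec_PiC_Succ ab_Succ) (simp add: tplus_def)
  show "monus a zero = a" using s ab_tmonus[of s Zero] by (simp add: tmonus_def ab_Rec_Zero)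
  show "monus a (suc b) = pr (monus a b)"
    using s t ab_tmonus[of s "Succ \<cdot> t"] ab_tmonus[of s t] pr[of "tmonus s t"]
    by (simp add: tmonus_def ab_Rec_PiC_Succ ab_Succ)
  show "pow2 zero = suc zero" using ab_tpow2[of Zero] by (simp add: tpow2_def ab_Rec_Zero ab_Succ)
  show "pow2 (suc a) = times (suc (suc zero)) (pow2 a)"
    using s ab_tpow2[of "Succ \<cdot> s"] ab_tpow2[of s] ab_ttimes[of num2 "tpow2 s"]
    by (simp add: tpow2_def ab_Rec_PiC_Succ ab_Succ) (simp add: ttimes_def)
qed

end

lemma tsubst_arith [simp]:
  "tsubst e (tplus s t) = tplus (tsubst e s) (tsubst e t)"
  "tsubst e (ttimes s t) = ttimes (tsubst e s) (tsubst e t)"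
  "tsubst e (tmonus s t) = tmonus (tsubst e s) (tsubst e t)"
  "tsubst e (tpow2 t) = tpow2 (tsubst e t)"
  by (simp_all add: tplus_def ttimes_def tmonus_def tpow2_def)

lemma lift_Var [simp]:
  "lift \<sigma> (Var \<sigma> i) = Var \<sigma> (Suc i)" "\<tau> \<noteq> \<sigma> \<Longrightarrow> lift \<sigma> (Var \<tau> i) = Var \<tau> i"
  by (simp_all add: shift_def)

declare has_type.simps(7) [simp del]

lemma has_type_App: "has_type f (\<sigma> \<rightarrow> \<tau>) \<Longrightarrow> has_type t \<sigma> \<Longrightarrow> has_type (f \<cdot> t) \<tau>"
  by (auto simp: has_type.simps(7))

lemma has_type_App_simps [simp]:
  "has_type (Var (\<sigma> \<rightarrow> \<tau>) i \<cdot> t) \<tau>' \<longleftrightarrow> \<tau>' = \<tau> \<and> has_type t \<sigma>"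
  "has_type (Succ \<cdot> t) \<tau> \<longleftrightarrow> \<tau> = Nat \<and> has_type t Nat"
  "has_type (PiC \<rho> \<sigma> \<cdot> s) \<tau> \<longleftrightarrow> \<tau> = \<sigma> \<rightarrow> \<rho> \<and> has_type s \<rho>"
  by (auto simp: has_type.simps(7))

lemma wf_le_fm [simp]: "wf_fm (le_fm s t) \<longleftrightarrow> has_type s Nat \<and> has_type t Nat"
  by (simp add: le_fm_def)

lemma wf_less_fm [simp]: "wf_fm (less_fm s t) \<longleftrightarrow> has_type s Nat \<and> has_type t Nat"
  by (simp add: less_fm_def)

lemma wf_rat_diff:
  "has_type q Nat \<Longrightarrow> has_type r Nat \<Longrightarrow> has_type n Nat \<Longrightarrow>
   (\<And>s t u v. has_type s Nat \<Longrightarrow> has_type t Nat \<Longrightarrow> has_type u Nat \<Longrightarrow> has_type v Nat \<Longrightarrow> wf_fm (A s t u v)) \<Longrightarrow>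
   wf_fm (rat_diff A q r n)"
  by (simp add: rat_diff_def Let_def rat_code_def tpair_def eval_nat_numeral)

lemma tsubst_rat_code [simp]: "tsubst e (rat_code a b c) = rat_code (tsubst e a) (tsubst e b) (tsubst e c)"
  by (simp add: rat_code_def tpair_def)

lemma has_type_rat_code [simp]:
  "has_type (rat_code a b c) \<tau> \<longleftrightarrow> \<tau> = Nat \<and> has_type a Nat \<and> has_type b Nat \<and> has_type c Nat"
  by (auto simp: rat_code_def tpair_def)

context henkin begin

lemma tsubst_eqv:
  assumes "\<And>\<sigma> i. eqv \<sigma> (e \<sigma> i) (e' \<sigma> i)"
    and app: "\<And>\<sigma> \<tau> f g s t. eqv (\<sigma> \<rightarrow> \<tau>) f g \<Longrightarrow> eqv \<sigma> s t \<Longrightarrow> eqv \<tau> (f \<cdot> s) (g \<cdot> t)"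
  shows "has_type t \<tau> \<Longrightarrow> eqv \<tau> (tsubst e t) (tsubst e' t)"
proof (induction t arbitrary: \<tau>)
  case (App s t)
  then show ?case using app by (fastforce simp: has_type.simps(7))
qed (use assms in \<open>auto intro: eqv_refl\<close>)

end

context aca_model begin

text \<open>Truth depends only on denotations: prime formulas by congruence, quantifiers by
  extending both assignments with the same value. This permits quantifying over numbers, functions
  and functionals in place of their names.\<close>

lemma sat_eqv:
  assumes "\<And>\<sigma> i. eqv \<sigma> (e \<sigma> i) (e' \<sigma> i)" "wf_fm \<phi>"
  shows "sat e \<phi> \<longleftrightarrow> sat e' \<phi>"
  using assms
proof (induction \<phi> arbitrary: e e')
  case (Eq s t)
  have "well_typed e" "well_typed e'" using Eq.prems(1) by (auto simp: well_typed_def intro: eqv_types)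
  moreover have "eqv Nat (tsubst e s) (tsubst e' s)" "eqv Nat (tsubst e t) (tsubst e' t)"
    using Eq.prems by (auto intro: tsubst_eqv eqv_app)
  ultimately show ?case using Eq.prems by (simp add: eqv_Nat)
next
  case (Imp \<phi> \<psi>)
  have "well_typed e" "well_typed e'" using Imp.prems(1) by (auto simp: well_typed_def intro: eqv_types)
  then show ?case using Imp.prems Imp.IH[of e e'] by simp
next
  case (Forall \<sigma> \<phi>)
  have "well_typed e" "well_typed e'" using Forall.prems(1) by (auto simp: well_typed_def intro: eqv_types)
  moreover have "sat (push \<sigma> t e) \<phi> \<longleftrightarrow> sat (push \<sigma> t e') \<phi>" if "has_type t \<sigma>" for t
    using Forall.prems that by (intro Forall.IH) (auto simp: push_def eqv_refl split: nat.split)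
  ultimately show ?case using Forall.prems by (auto simp: sat_Forall)
qed simp

lemma sat_push_eqv:
  "well_typed e \<Longrightarrow> eqv \<sigma> s t \<Longrightarrow> wf_fm \<phi> \<Longrightarrow> sat (push \<sigma> s e) \<phi> \<longleftrightarrow> sat (push \<sigma> t e) \<phi>"
  by (rule sat_eqv) (auto simp: push_def well_typed_def eqv_refl split: nat.split)

lemma sat_Forall_Nat [simp]:
  "well_typed e \<Longrightarrow> wf_fm \<phi> \<Longrightarrow> sat e (Forall Nat \<phi>) \<longleftrightarrow> (\<forall>n. sat (push Nat (re n) e) \<phi>)"
  using sat_push_eqv[OF _ eqv_re] by (simp add: sat_Forall) (metis re_type)

lemma sat_Exists_Nat: "well_typed e \<Longrightarrow> wf_fm \<phi> \<Longrightarrow>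
    sat e (Exists Nat \<phi>) \<longleftrightarrow> (\<exists>n. sat (push Nat (re n) e) \<phi>)"
  by simp

lemma sat_Forall_ty1 [simp]:
  assumes "well_typed e" "wf_fm \<phi>"
  shows "sat e (Forall ty1 \<phi>) \<longleftrightarrow> (\<forall>x\<in>D1. sat (push ty1 (re1 x) e) \<phi>)"
proof -
  have "eqv ty1 (re1 (fun1 f)) f" if "has_type f ty1" for f
    using that fun1_D1 re1_type fun1_re1 fun1_eq_iff by blast
  then show ?thesis using assms sat_push_eqv[of e ty1 _ _ \<phi>] re1_type fun1_D1
    by (simp add: sat_Forall del: has_type.simps) blast
qed

lemma sat_Forall_ty2 [simp]:
  assumes "well_typed e" "wf_fm \<phi>"
  shows "sat e (Forall ty2 \<phi>) \<longleftrightarrow> (\<forall>Y\<in>D2. sat (push ty2 (re2 Y) e) \<phi>)"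
proof -
  \<comment> \<open>The chosen name of the functional agrees with \<open>y\<close> at every term of
    type 1, hence equals it in \<open>M\<close>.\<close>
  have "eqv ty2 (re2 (fun2 y)) y" if y: "has_type y ty2" for y
  proof -
    have D2: "fun2 y \<in> D2" using y by (simp add: D2_def)
    have "ab (re2 (fun2 y) \<cdot> f) = ab (y \<cdot> f)" if "has_type f ty1" for f
      using fun2_fun1[OF _ that] y re2_type[OF D2] fun2_re2[OF D2] by metis
    then show ?thesis using y re2_type[OF D2] by (subst eqv_Fn) (auto simp: eqv_Nat intro: has_type_App)
  qed
  moreover have "fun2 y \<in> D2" if "has_type y ty2" for y using that by (simp add: D2_def)
  ultimately show ?thesis using assms sat_push_eqv[of e ty2 _ _ \<phi>] re2_type
    by (simp add: sat_Forall del: has_type.simps) blast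
qed

lemma ab_app_fun1: "has_type f ty1 \<Longrightarrow> has_type t Nat \<Longrightarrow> ab (f \<cdot> t) = fun1 f (ab t)"
  by (simp add: fun1_ab)

lemma ab_re2_app: "Y \<in> D2 \<Longrightarrow> has_type f ty1 \<Longrightarrow> ab (re2 Y \<cdot> f) = Y (fun1 f)"
  using fun2_fun1[of "re2 Y" f] by (simp add: re2_type fun2_re2)

lemma sat_le_fm [simp]: "well_typed e \<Longrightarrow> has_type s Nat \<Longrightarrow> has_type t Nat \<Longrightarrow>
    sat e (le_fm s t) \<longleftrightarrow> monus (ab (tsubst e s)) (ab (tsubst e t)) = zero"
  by (simp add: le_fm_def ab_tmonus has_type_tsubst)

lemma sat_less_fm [simp]: "well_typed e \<Longrightarrow> has_type s Nat \<Longrightarrow> has_type t Nat \<Longrightarrow>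
    sat e (less_fm s t) \<longleftrightarrow> monus (suc (ab (tsubst e s))) (ab (tsubst e t)) = zero"
  by (simp add: less_fm_def ab_simps has_type_tsubst)

declare re1_type [simp] re2_type [simp] fun1_re1 [simp]

lemma ab_app_re1 [simp]: "x \<in> D1 \<Longrightarrow> has_type t Nat \<Longrightarrow> ab (re1 x \<cdot> t) = x (ab t)"
  by (simp add: ab_app_fun1)

lemma has_type_re_app [simp]:
  "x \<in> D1 \<Longrightarrow> has_type t Nat \<Longrightarrow> has_type (re1 x \<cdot> t) Nat"
  "Y \<in> D2 \<Longrightarrow> has_type f ty1 \<Longrightarrow> has_type (re2 Y \<cdot> f) Nat"
  by (auto intro: has_type_App re1_type re2_type)

lemma ex_Phi: "\<exists>y. has_type y ty2 \<and> (\<forall>x\<in>D1. monus (fun2 y x) (suc zero) = zero \<and>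
    ((\<exists>n. x n = zero) \<longleftrightarrow> fun2 y x = zero))"
proof -
  let ?\<phi> = "Forall ty1 (le_fm (Var ty2 0 \<cdot> Var ty1 0) num1) \<^bold>\<and>
        Forall ty1 (Exists Nat (Eq (Var ty1 0 \<cdot> Var Nat 0) Zero) \<^bold>\<longleftrightarrow> Eq (Var ty2 0 \<cdot> Var ty1 0) Zero)"
  have "sat Var exists2"
    unfolding sat_def by (simp, rule M_axiom) (simp add: ACA0_omega_def)
  then obtain y where y: "has_type y ty2" "sat (push ty2 y Var) ?\<phi>"
    unfolding exists2_def by (subst (asm) sat_Exists) auto
  have app: "has_type (y \<cdot> re1 x) Nat" "ab (y \<cdot> re1 x) = fun2 y x" if "x \<in> D1" for x
    using that y(1) by (auto intro: has_type_App re1_type simp: fun2_def)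
  show ?thesis using y by (intro exI[of _ y]) (simp add: app ab_simps cong: ball_cong, blast)
qed


definition Phi :: tm where
  "Phi = (SOME y. has_type y ty2 \<and> (\<forall>x\<in>D1. monus (fun2 y x) (suc zero) = zero \<and>
    ((\<exists>n. x n = zero) \<longleftrightarrow> fun2 y x = zero)))"

lemma Phi_type [simp]: "has_type Phi ty2"
  and Phi_le: "x \<in> D1 \<Longrightarrow> monus (fun2 Phi x) (suc zero) = zero"
  and Phi_zero: "x \<in> D1 \<Longrightarrow> fun2 Phi x = zero \<longleftrightarrow> (\<exists>n. x n = zero)"
  using someI_ex[OF ex_Phi, folded Phi_def] by auto

text \<open>Every variable of type 2 other than \<open>Var ty2 0\<close> stands for the functional of \<open>(\<exists>\<^sup>2)\<close>.\<close>

definition env :: "(('n \<Rightarrow> 'n) \<Rightarrow> 'n) \<Rightarrow> (nat \<Rightarrow> 'n \<Rightarrow> 'n) \<Rightarrow> (nat \<Rightarrow> 'n) \<Rightarrow> ty \<Rightarrow> nat \<Rightarrow> tm" where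
  "env Y x n \<sigma> i = (if \<sigma> = Nat then re (n i) else if \<sigma> = ty1 then re1 (x i)
     else if \<sigma> = ty2 then (if i = 0 then re2 Y else Phi) else Var \<sigma> i)"

definition ctx :: "(('n \<Rightarrow> 'n) \<Rightarrow> 'n) \<Rightarrow> (nat \<Rightarrow> 'n \<Rightarrow> 'n) \<Rightarrow> bool" where
  "ctx Y x \<longleftrightarrow> Y \<in> D2 \<and> (\<forall>i. x i \<in> D1)"

lemma well_typed_env [simp]: "ctx Y x \<Longrightarrow> well_typed (env Y x n)"
  by (auto simp: well_typed_def env_def ctx_def)

lemma env_simps [simp]:
  "env Y x n Nat i = re (n i)" "env Y x n ty1 i = re1 (x i)" "env Y x n ty2 0 = re2 Y"
  "env Y x n ty2 (Suc i) = Phi"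
  by (simp_all add: env_def)

lemma push_env_Nat: "push Nat (re m) (env Y x n) = env Y x (m ## n)"
  by (auto simp: fun_eq_iff push_def env_def ncons_def split: nat.split)

lemma push_env_ty1: "push ty1 (re1 z) (env Y x n) = env Y (z ## x) n"
  by (auto simp: fun_eq_iff push_def env_def ncons_def split: nat.split)

text \<open>Only contexts made of objects of the model are constrained, since other functions and
  functionals have no names.\<close>

definition R :: "'n ctx_fun \<Rightarrow> bool" where
  "R g \<longleftrightarrow> (\<exists>t. has_type t Nat \<and> (\<forall>Y x n. ctx Y x \<longrightarrow> g Y x n = ab (tsubst (env Y x n) t)))"

definition Q :: "'n ctx_pred \<Rightarrow> bool" where
  "Q p \<longleftrightarrow> (\<exists>\<phi>. quantifier_free \<phi> \<and> wf_fm \<phi> \<and> (\<forall>Y x n. ctx Y x \<longrightarrow> p Y x n = sat (env Y x n) \<phi>))"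

lemma R_I: "has_type t Nat \<Longrightarrow> (\<And>Y x n. ctx Y x \<Longrightarrow> g Y x n = ab (tsubst (env Y x n) t)) \<Longrightarrow> R g"
  by (auto simp: R_def)

lemma R_E: "R g \<Longrightarrow> (\<And>t. has_type t Nat \<Longrightarrow>
    (\<And>Y x n. ctx Y x \<Longrightarrow> has_type (tsubst (env Y x n) t) Nat \<and> ab (tsubst (env Y x n) t) = g Y x n) \<Longrightarrow> P) \<Longrightarrow> P"
  by (fastforce simp: R_def has_type_tsubst)

text \<open>Abstraction over the innermost number variable; the parameters stay variables of
  \<open>l\<close>, so a single term works in all contexts.\<close>

lemma R_lam:
  assumes "R g"
  obtains l where "has_type l ty1"
    and "\<And>Y x n. ctx Y x \<Longrightarrow> has_type (tsubst (env Y x n) l) ty1"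
    and "\<And>Y x n. ctx Y x \<Longrightarrow> fun1 (tsubst (env Y x n) l) = (\<lambda>m. g Y x (m ## n))"
proof -
  obtain t where t: "has_type t Nat" "\<And>Y x n. ctx Y x \<Longrightarrow> ab (tsubst (env Y x n) t) = g Y x n"
    using R_E[OF assms] by metis
  obtain l where l: "has_type l ty1"
    "\<And>e u. well_typed e \<Longrightarrow> has_type u Nat \<Longrightarrow> eqv Nat (tsubst e l \<cdot> u) (tsubst (push Nat u e) t)"
    using abstraction[OF t(1), of Nat] by metis
  have "fun1 (tsubst (env Y x n) l) m = g Y x (m ## n)" if "ctx Y x" for Y x n m
    using l(2)[of "env Y x n" "re m"] that by (simp add: fun1_def eqv_Nat push_env_Nat t(2))
  then show ?thesis using l(1) by (intro that[of l]) (auto simp: has_type_tsubst)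
qed

lemma R_app2:
  assumes "R g" and y: "has_type y ty2"
    "\<And>Y x n. ctx Y x \<Longrightarrow> has_type (tsubst (env Y x n) y) ty2 \<and> fun2 (tsubst (env Y x n) y) = F Y"
  shows "R (\<lambda>Y x n. F Y (\<lambda>m. g Y x (m ## n)))"
proof -
  obtain l where l: "has_type l ty1"
    "\<And>Y x n. ctx Y x \<Longrightarrow> has_type (tsubst (env Y x n) l) ty1"
    "\<And>Y x n. ctx Y x \<Longrightarrow> fun1 (tsubst (env Y x n) l) = (\<lambda>m. g Y x (m ## n))"
    using R_lam[OF assms(1)] by metis
  have "F Y (\<lambda>m. g Y x (m ## n)) = ab (tsubst (env Y x n) (y \<cdot> l))" if "ctx Y x" for Y x n
    using fun2_fun1[of "tsubst (env Y x n) y" "tsubst (env Y x n) l"] l(2,3) y(2) that by simp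
  then show ?thesis using l(1) y(1) by (intro R_I[of "y \<cdot> l"]) (auto intro: has_type_App)
qed

lemma R_D1: "R g \<Longrightarrow> ctx Y x \<Longrightarrow> (\<lambda>m. g Y x (m ## n)) \<in> D1"
proof -
  assume c: "ctx Y x" and "R g"
  from this(2) obtain l where l: "has_type l ty1"
    "\<And>Y x n. ctx Y x \<Longrightarrow> has_type (tsubst (env Y x n) l) ty1"
    "\<And>Y x n. ctx Y x \<Longrightarrow> fun1 (tsubst (env Y x n) l) = (\<lambda>m. g Y x (m ## n))"
    using R_lam by metis
  show ?thesis using fun1_D1[OF l(2)[OF c]] l(3)[OF c] by metis
qed

lemma R_D2:
  assumes "R g" "ctx Y x"
  shows "\<exists>Z\<in>D2. \<forall>z\<in>D1. Z z = g Y (z ## x) n"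
proof -
  obtain t where t: "has_type t Nat" "\<And>Y x n. ctx Y x \<Longrightarrow> ab (tsubst (env Y x n) t) = g Y x n"
    using R_E[OF assms(1)] by metis
  obtain l where l: "has_type l ty2"
    "\<And>e u. well_typed e \<Longrightarrow> has_type u ty1 \<Longrightarrow> eqv Nat (tsubst e l \<cdot> u) (tsubst (push ty1 u e) t)"
    using abstraction[OF t(1), of ty1] by metis
  have "fun2 (tsubst (env Y x n) l) z = g Y (z ## x) n" if z: "z \<in> D1" for z
  proof -
    have "ctx Y (z ## x)" using assms(2) z by (auto simp: ctx_def ncons_def split: nat.split)
    then show ?thesis
      using l(2)[of "env Y x n" "re1 z"] z assms(2) by (simp add: fun2_def eqv_Nat push_env_ty1 t(2))
  qed
  moreover have "fun2 (tsubst (env Y x n) l) \<in> D2"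
    using l(1) assms(2) by (auto simp: D2_def has_type_tsubst)
  ultimately show ?thesis by blast
qed

text \<open>The step is abstracted twice: \<open>k\<close> takes the counter and returns a function
  of the previous value, which is entry \<open>0\<close> of the context. This is the order in which
  \<open>Rec\<close> supplies them.\<close>

lemma R_rec:
  assumes "R g" "R h"
  shows "\<exists>r. R r \<and> (\<forall>Y x n. ctx Y x \<longrightarrow> r Y x (zero ## n) = h Y x n \<and>
    (\<forall>m. r Y x (suc m ## n) = g Y x (r Y x (m ## n) ## m ## n)))"
proof -
  obtain s where s: "has_type s Nat" "\<And>Y x n. ctx Y x \<Longrightarrow> ab (tsubst (env Y x n) s) = h Y x n"
    using R_E[OF assms(2)] by metis
  obtain l where l: "has_type l ty1"
    "\<And>Y x n. ctx Y x \<Longrightarrow> has_type (tsubst (env Y x n) l) ty1"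
    "\<And>Y x n. ctx Y x \<Longrightarrow> fun1 (tsubst (env Y x n) l) = (\<lambda>m. g Y x (m ## n))"
    using R_lam[OF assms(1)] by metis
  obtain k where k: "has_type k (Nat \<rightarrow> ty1)"
    "\<And>e u. well_typed e \<Longrightarrow> has_type u Nat \<Longrightarrow> eqv ty1 (tsubst e k \<cdot> u) (tsubst (push Nat u e) l)"
    using abstraction[OF l(1), of Nat] by metis
  \<comment> \<open>\<open>Var Nat 0\<close> is the argument of the recursion; being lifted, the
    step and the initial value do not see it.\<close>
  let ?t = "Rec \<cdot> lift Nat k \<cdot> lift Nat s \<cdot> Var Nat 0"
  let ?r = "\<lambda>Y x n. ab (tsubst (env Y x n) ?t)"
  have types: "has_type (tsubst e k) (Nat \<rightarrow> ty1)" "has_type (tsubst e s) Nat" if "well_typed e" for e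
    using k(1) s(1) that by (auto simp: has_type_tsubst)
  have r: "?r Y x (ab u ## n) = ab (Rec \<cdot> tsubst (env Y x n) k \<cdot> tsubst (env Y x n) s \<cdot> u)"
    if "ctx Y x" "has_type u Nat" for Y x n u
    using that types[of "env Y x n"]
    by (auto simp flip: push_env_Nat intro!: ab_app1 eqv_refl eqv_re Rec_type)
  have "?r Y x (suc m ## n) = g Y x (?r Y x (m ## n) ## m ## n)" if c: "ctx Y x" for Y x n m
  proof -
    let ?e = "env Y x n"
    let ?u = "Rec \<cdot> tsubst ?e k \<cdot> tsubst ?e s \<cdot> re m"
    have ty: "has_type ?u Nat" "has_type (tsubst ?e k \<cdot> re m) ty1"
      using types[of ?e] c by (auto intro: has_type_App Rec_type)
    have "?r Y x (suc m ## n) = ab (Rec \<cdot> tsubst ?e k \<cdot> tsubst ?e s \<cdot> (Succ \<cdot> re m))"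
      using r[OF c, of "Succ \<cdot> re m"] by (simp add: ab_Succ)
    also have "\<dots> = ab (tsubst ?e k \<cdot> re m \<cdot> ?u)"
      using types[of ?e] c by (intro ab_Rec_Succ) auto
    also have "\<dots> = ab (tsubst (env Y x (m ## n)) l \<cdot> ?u)"
      using k(2)[of ?e "re m"] c ty by (intro ab_app1) (auto simp: push_env_Nat eqv_refl)
    also have "\<dots> = g Y x (ab ?u ## m ## n)"
      using fun1_ab[of "tsubst (env Y x (m ## n)) l" ?u] l(2,3) c ty by simp
    also have "ab ?u = ?r Y x (m ## n)" using r[OF c, of "re m"] by simp
    finally show ?thesis .
  qed
  moreover have "?r Y x (zero ## n) = h Y x n" if c: "ctx Y x" for Y x n
    using r[OF c, of Zero] types[of "env Y x n"] c by (simp add: ab_Rec_Zero s(2))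
  moreover have "has_type ?t Nat" using k(1) s(1) by (intro has_type_App Rec_type) auto
  then have "R ?r" by (rule R_I) simp
  ultimately show ?thesis by blast
qed

text \<open>The axiom is instantiated with \<open>\<phi>\<close> after its parameters have been
  replaced by their names, which keeps it quantifier-free.\<close>

lemma Q_induct:
  assumes "Q p" "ctx Y x" and base: "p Y x (zero ## n)"
    and step: "\<And>m. p Y x (m ## n) \<Longrightarrow> p Y x (suc m ## n)"
  shows "p Y x (m ## n)"
proof -
  obtain \<phi> where \<phi>: "quantifier_free \<phi>" "wf_fm \<phi>" and p: "\<And>Y x n. ctx Y x \<Longrightarrow> p Y x n = sat (env Y x n) \<phi>"
    using assms(1) by (auto simp: Q_def)
  let ?e = "env Y x n"
  let ?r = "\<lambda>\<tau> i. if \<tau> = Nat \<and> i = 0 then Succ \<cdot> Var Nat 0 else Var \<tau> i"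
  let ?\<psi> = "fsubst (up Nat ?e) \<phi>"
  have e: "well_typed ?e" using assms(2) by simp
  have P: "sat (push Nat u ?e) \<phi> \<longleftrightarrow> p Y x (ab u ## n)" if "has_type u Nat" for u
    using that p[OF assms(2)] sat_push_eqv[OF e eqv_sym[OF eqv_re] \<phi>(2)] by (simp add: push_env_Nat)
  have r: "well_typed ?r" by (simp add: well_typed_def)
  have wf: "wf_fm ?\<psi>" "wf_fm (fsubst ?r ?\<psi>)" "wf_fm (fsubst (inst Nat Zero) ?\<psi>)"
    using e \<phi>(2) r by (auto simp: wf_fsubst)
  have inst: "fsubst (inst Nat u) ?\<psi> \<in> M \<longleftrightarrow> p Y x (ab u ## n)" if "has_type u Nat" for u
    using P[OF that] by (simp add: sat_def fsubst_inst_up)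
  have "(\<lambda>\<tau> i. tsubst (inst Nat u) (?r \<tau> i)) = inst Nat (Succ \<cdot> u)" for u
    by (auto simp: fun_eq_iff inst_def split: nat.split)
  then have "fsubst (inst Nat u) (fsubst ?r \<psi>) = fsubst (inst Nat (Succ \<cdot> u)) \<psi>" for u \<psi>
    by (simp add: fsubst_fsubst)
  then have inst': "fsubst (inst Nat u) (fsubst ?r ?\<psi>) \<in> M \<longleftrightarrow> p Y x (suc (ab u) ## n)"
    if "has_type u Nat" for u
    using inst[of "Succ \<cdot> u"] that by (simp add: ab_Succ)
  have "fsubst (inst Nat Zero) ?\<psi> \<^bold>\<longrightarrow> Forall Nat (?\<psi> \<^bold>\<longrightarrow> fsubst ?r ?\<psi>) \<^bold>\<longrightarrow> Forall Nat ?\<psi> \<in> M"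
    by (intro M_PRA E_PRA_omega.Induction) (use \<phi> wf in auto)
  moreover have "fsubst (inst Nat Zero) ?\<psi> \<in> M" using base by (simp add: inst)
  moreover have "Forall Nat (?\<psi> \<^bold>\<longrightarrow> fsubst ?r ?\<psi>) \<in> M"
    using wf step by (simp add: M_Forall M_Imp wf_fsubst inst inst')
  ultimately have "Forall Nat ?\<psi> \<in> M" using wf by (simp add: M_Imp)
  then have "fsubst (inst Nat (re m)) ?\<psi> \<in> M" using wf(1) by (simp add: M_Forall)
  then show ?thesis by (simp add: inst)
qed

lemma omega_model: "omega_model zero suc pr plus times monus pow2 D1 D2 (fun2 Phi) R Q"
proof (unfold_locales, goal_cases)
  case 13
  have "fun1 Succ \<in> D1" by (rule fun1_D1) simp
  then show ?case by blast
next
  case 14 show ?case by (simp add: D2_def)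
next
  case (15 f) then show ?case by (rule Phi_zero)
next
  case (16 f) then show ?case by (rule Phi_le)
next
  case (17 i) show ?case by (rule R_I[of "Var Nat i"]) auto
next
  case 18 show ?case by (rule R_I[of Zero]) auto
next
  case (19 g)
  then obtain t where "has_type t Nat" "\<And>Y x n. ctx Y x \<Longrightarrow>
    has_type (tsubst (env Y x n) t) Nat \<and> ab (tsubst (env Y x n) t) = g Y x n" by (metis R_E)
  then show ?case by (intro R_I[of "Succ \<cdot> t"]) (auto simp: ab_simps)
next
  case (20 g h)
  then obtain s t where "has_type t Nat" "\<And>Y x n. ctx Y x \<Longrightarrow>
    has_type (tsubst (env Y x n) t) Nat \<and> ab (tsubst (env Y x n) t) = g Y x n"
    "has_type s Nat" "\<And>Y x n. ctx Y x \<Longrightarrow>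
    has_type (tsubst (env Y x n) s) Nat \<and> ab (tsubst (env Y x n) s) = h Y x n" by (metis R_E)
  then show ?case by (intro R_I[of "tplus t s"]) (auto simp: ab_simps)
next
  case (21 g h)
  then obtain s t where "has_type t Nat" "\<And>Y x n. ctx Y x \<Longrightarrow>
    has_type (tsubst (env Y x n) t) Nat \<and> ab (tsubst (env Y x n) t) = g Y x n"
    "has_type s Nat" "\<And>Y x n. ctx Y x \<Longrightarrow>
    has_type (tsubst (env Y x n) s) Nat \<and> ab (tsubst (env Y x n) s) = h Y x n" by (metis R_E)
  then show ?case by (intro R_I[of "ttimes t s"]) (auto simp: ab_simps)
next
  case (22 g h)
  then obtain s t where "has_type t Nat" "\<And>Y x n. ctx Y x \<Longrightarrow>
    has_type (tsubst (env Y x n) t) Nat \<and> ab (tsubst (env Y x n) t) = g Y x n"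
    "has_type s Nat" "\<And>Y x n. ctx Y x \<Longrightarrow>
    has_type (tsubst (env Y x n) s) Nat \<and> ab (tsubst (env Y x n) s) = h Y x n" by (metis R_E)
  then show ?case by (intro R_I[of "tmonus t s"]) (auto simp: ab_simps)
next
  case (23 g)
  then obtain t where "has_type t Nat" "\<And>Y x n. ctx Y x \<Longrightarrow>
    has_type (tsubst (env Y x n) t) Nat \<and> ab (tsubst (env Y x n) t) = g Y x n" by (metis R_E)
  then show ?case by (intro R_I[of "tpow2 t"]) (auto simp: ab_simps)
next
  case (24 g i)
  then obtain t where "has_type t Nat" "\<And>Y x n. ctx Y x \<Longrightarrow>
    has_type (tsubst (env Y x n) t) Nat \<and> ab (tsubst (env Y x n) t) = g Y x n" by (metis R_E)
  then show ?case by (intro R_I[of "Var ty1 i \<cdot> t"]) (auto simp: ctx_def)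
next
  case (25 g)
  then show ?case using R_app2[of g "Var ty2 0" "\<lambda>Y. Y"] by (simp add: ctx_def fun2_re2)
next
  case (26 g)
  then show ?case using R_app2[of g "Var ty2 1" "\<lambda>Y. fun2 Phi"] by (simp add: ctx_def)
next
  case (27 g h) then show ?case using R_rec[of g h] by (auto simp: ctx_def)
next
  case (28 g Y x f n)
  then have "f = (\<lambda>m. g Y x (m ## n))" by auto
  then show ?case using R_D1[of g Y x n] 28 by (simp add: ctx_def)
next
  case (29 g Y x F n) then show ?case using R_D2[of g Y x n] by (simp add: ctx_def)
next
  case (30 g h)
  then obtain s t where "has_type t Nat" "\<And>Y x n. ctx Y x \<Longrightarrow>
    has_type (tsubst (env Y x n) t) Nat \<and> ab (tsubst (env Y x n) t) = g Y x n"
    "has_type s Nat" "\<And>Y x n. ctx Y x \<Longrightarrow>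
    has_type (tsubst (env Y x n) s) Nat \<and> ab (tsubst (env Y x n) s) = h Y x n" by (metis R_E)
  then show ?case unfolding Q_def by (intro exI[of _ "Eq t s"]) auto
next
  case 31 show ?case unfolding Q_def by (intro exI[of _ Falsum]) auto
next
  case (32 p q)
  then obtain \<phi> \<psi> where "quantifier_free \<phi>" "wf_fm \<phi>" "\<And>Y x n. ctx Y x \<Longrightarrow> p Y x n = sat (env Y x n) \<phi>"
    "quantifier_free \<psi>" "wf_fm \<psi>" "\<And>Y x n. ctx Y x \<Longrightarrow> q Y x n = sat (env Y x n) \<psi>"
    unfolding Q_def by metis
  then show ?case unfolding Q_def by (intro exI[of _ "\<phi> \<^bold>\<longrightarrow> \<psi>"]) auto
next
  case (33 p Y x P n) then show ?case using Q_induct[of p Y x n] by (simp add: ctx_def)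
qed (fact arithmetic)+

sublocale omega: omega_model zero suc pr plus times monus pow2 D1 D2 "fun2 Phi" R Q
  by (rule omega_model)

lemma ab_rat_code: "has_type a Nat \<Longrightarrow> has_type b Nat \<Longrightarrow> has_type c Nat \<Longrightarrow>
    ab (rat_code a b c) = omega.code (ab a) (ab b) (ab c)"
  by (simp add: rat_code_def tpair_def omega.code_def omega.pair_def ab_simps)

text \<open>Generic in the comparison: \<open>A\<close> may be any formula whose truth depends only
  on the numbers denoted, through \<open>B\<close>. The three comparisons of rational numbers are
  instances.\<close>

lemma sat_rat_diff:
  assumes "well_typed e" "has_type q Nat" "has_type r Nat" "has_type n Nat"
    and "\<And>s t u v. has_type s Nat \<Longrightarrow> has_type t Nat \<Longrightarrow> has_type u Nat \<Longrightarrow> has_type v Nat \<Longrightarrow> wf_fm (A s t u v)"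
    and "\<And>e s t u v. well_typed e \<Longrightarrow> has_type s Nat \<Longrightarrow> has_type t Nat \<Longrightarrow> has_type u Nat \<Longrightarrow> has_type v Nat \<Longrightarrow>
      sat e (A s t u v) \<longleftrightarrow> B (ab (tsubst e s)) (ab (tsubst e t)) (ab (tsubst e u)) (ab (tsubst e v))"
  shows "sat e (rat_diff A q r n) \<longleftrightarrow>
    omega.diff_holds B (ab (tsubst e q)) (ab (tsubst e r)) (ab (tsubst e n))"
proof -
  let ?L = "lift Nat ^^ 6"
  let ?a = "Var Nat 5" and ?b = "Var Nat 4" and ?c = "Var Nat 3"
    and ?d = "Var Nat 2" and ?e = "Var Nat 1" and ?f = "Var Nat 0"
  let ?\<phi> = "Eq (?L q) (rat_code ?a ?b ?c)" and ?\<psi> = "Eq (?L r) (rat_code ?d ?e ?f)"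
  let ?A = "A (tplus (ttimes ?a (Succ \<cdot> ?f)) (ttimes ?e (Succ \<cdot> ?c)))
    (tplus (ttimes ?b (Succ \<cdot> ?f)) (ttimes ?d (Succ \<cdot> ?c)))
    (ttimes (Succ \<cdot> ?c) (Succ \<cdot> ?f)) (?L n)"
  have L: "has_type (?L t) Nat" if "has_type t Nat" for t
    using that by (simp add: eval_nat_numeral)
  have wf: "wf_fm ?\<phi>" "wf_fm ?\<psi>" "wf_fm ?A" using assms(2-5) by (simp_all add: L)
  \<comment> \<open>The assignment after six quantifiers, the outermost of which binds
    \<open>a\<close> and thus has index \<open>5\<close>.\<close>
  have body: "sat (push Nat (re f) (push Nat (re e') (push Nat (re d) (push Nat (re c) (push Nat (re b) (push Nat (re a) e))))))
      (?\<phi> \<^bold>\<and> ?\<psi> \<^bold>\<and> ?A) \<longleftrightarrow> ab (tsubst e q) = omega.code a b c \<and> ab (tsubst e r) = omega.code d e' f \<and>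
      B (plus (times a (suc f)) (times e' (suc c))) (plus (times b (suc f)) (times d (suc c)))
        (times (suc c) (suc f)) (ab (tsubst e n))" (is "sat ?E _ \<longleftrightarrow> _") for a b c d e' f
  proof -
    have E: "well_typed ?E" using assms(1) by simp
    have tL: "tsubst ?E (?L t) = tsubst e t" for t by (simp add: eval_nat_numeral)
    have v: "?E Nat 0 = re f" "?E Nat 1 = re e'" "?E Nat 2 = re d" "?E Nat 3 = re c"
      "?E Nat 4 = re b" "?E Nat 5 = re a"
      by (simp_all add: eval_nat_numeral)
    have 1: "sat ?E ?\<phi> \<longleftrightarrow> ab (tsubst e q) = omega.code a b c"
      using E wf assms(2) by (simp only: sat_Eq L tL has_type_rat_code tsubst_rat_code tsubst.simps v has_type.simps) (simp add: ab_rat_code)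
    have 2: "sat ?E ?\<psi> \<longleftrightarrow> ab (tsubst e r) = omega.code d e' f"
      using E wf assms(3) by (simp only: sat_Eq L tL has_type_rat_code tsubst_rat_code tsubst.simps v has_type.simps) (simp add: ab_rat_code)
    have 3: "sat ?E ?A \<longleftrightarrow> B (plus (times a (suc f)) (times e' (suc c))) (plus (times b (suc f)) (times d (suc c)))
        (times (suc c) (suc f)) (ab (tsubst e n))"
      using E assms(4) by (subst assms(6)) (simp_all only: L tL tsubst.simps tsubst_arith v has_type_tplus
          has_type_ttimes has_type_App_simps has_type.simps, simp_all add: ab_simps)
    show ?thesis using E wf 1 2 3 by (simp only: sat_Imp sat_Falsum wf_fm.simps) blast
  qed
  show ?thesis
    using assms(1) wf unfolding rat_diff_def Let_def omega.diff_holds_def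
    by (simp only: sat_Exists_Nat well_typed_push re_type wf_fm.simps body)
qed

end

section \<open>Truth of the principles in the term model\<close>

lemma has_type_app1 [simp]: "has_type f ty1 \<Longrightarrow> has_type t Nat \<Longrightarrow> has_type (f \<cdot> t) Nat"
  by (rule has_type_App)

lemma wf_real_fms [simp]:
  "has_type x ty1 \<Longrightarrow> wf_fm (is_real x)"
  "has_type x ty1 \<Longrightarrow> has_type y ty1 \<Longrightarrow> wf_fm (eq_real x y)"
  "has_type x ty1 \<Longrightarrow> has_type y ty1 \<Longrightarrow> wf_fm (le_real x y)"
  "has_type x ty1 \<Longrightarrow> wf_fm (in_unit_interval x)"
  by (auto simp: is_real_def eq_real_def le_real_def in_unit_interval_def rat_dist_less_def
      rat_dist_le_def rat_diff_le_def abs_diff_def Let_def intro!: wf_rat_diff)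

lemma wf_in_Cantor [simp]: "has_type x ty1 \<Longrightarrow> wf_fm (in_Cantor x)"
  by (auto simp: in_Cantor_def intro!: has_type_App)

lemma wf_eq_at_ty1: "has_type x ty1 \<Longrightarrow> has_type y ty1 \<Longrightarrow> wf_fm (eq_at ty1 x y)"
  by (rule wf_eq_at)

lemma wf_NIN_of_reals:
  "(\<And>x. has_type x ty1 \<Longrightarrow> wf_fm (D x)) \<Longrightarrow> wf_fm (NIN_of_reals D)"
  by (simp add: NIN_of_reals_def Let_def)

lemma wf_NIN: "wf_fm NIN" "wf_fm NIN_Real" "wf_fm NIN_Cantor" "wf_fm NIN_Baire"
  by (simp_all add: NIN_def NIN_Real_def NIN_Cantor_def NIN_Baire_def Let_def wf_NIN_of_reals
      wf_eq_at_ty1 del: eq_at.simps)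

context aca_model begin

lemma fun1_Succ [simp]: "fun1 Succ n = suc n"
  by (simp add: fun1_def suc_def)

lemma sat_is_real:
  assumes "well_typed e" "has_type x ty1"
  shows "sat e (is_real x) \<longleftrightarrow> omega.real_seq (fun1 (tsubst e x))"
proof -
  let ?x = "lift Nat (lift Nat x)"
  let ?\<phi> = "rat_dist_less (?x \<cdot> Var Nat 1) (?x \<cdot> tplus (Var Nat 1) (Var Nat 0)) (Var Nat 1)"
  have ty: "has_type (?x \<cdot> t) Nat" if "has_type t Nat" for t
    using that assms(2) by (intro has_type_App) auto
  have "sat (push Nat (re i) (push Nat (re n) e)) ?\<phi> \<longleftrightarrow> omega.diff_holds
     (\<lambda>P Q D n. monus (suc (times (pow2 n) (plus (monus P Q) (monus Q P)))) D = zero)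
     (fun1 (tsubst e x) n) (fun1 (tsubst e x) (plus n i)) n" for n i
    unfolding rat_dist_less_def using assms ty
    by (subst sat_rat_diff[where B = "\<lambda>P Q D n. monus (suc (times (pow2 n) (plus (monus P Q) (monus Q P)))) D = zero"])
      (simp_all add: abs_diff_def ab_simps ab_app_fun1 has_type_tsubst)
  moreover have "wf_fm ?\<phi>"
    unfolding rat_dist_less_def using ty by (intro wf_rat_diff) (auto simp: abs_diff_def)
  ultimately show ?thesis
    using assms by (simp add: is_real_def Let_def omega.real_seq_def)
qed

lemma sat_eq_real:
  assumes "well_typed e" "has_type x ty1" "has_type y ty1"
  shows "sat e (eq_real x y) \<longleftrightarrow> omega.real_eq (fun1 (tsubst e x)) (fun1 (tsubst e y))"
proof -
  let ?\<phi> = "rat_dist_le (lift Nat x \<cdot> Var Nat 0) (lift Nat y \<cdot> Var Nat 0) (Var Nat 0)"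
  let ?B = "\<lambda>P Q D n. monus (times (pow2 n) (plus (monus P Q) (monus Q P))) (times (suc (suc zero)) D) = zero"
  have ty: "has_type (lift Nat x \<cdot> Var Nat 0) Nat" "has_type (lift Nat y \<cdot> Var Nat 0) Nat"
    using assms by (auto intro!: has_type_App)
  have "sat (push Nat (re n) e) ?\<phi> \<longleftrightarrow>
      omega.diff_holds ?B (fun1 (tsubst e x) n) (fun1 (tsubst e y) n) n" for n
    unfolding rat_dist_le_def using assms ty
    by (subst sat_rat_diff[where B = ?B])
      (simp_all add: abs_diff_def ab_simps ab_app_fun1 has_type_tsubst)
  moreover have "wf_fm ?\<phi>"
    unfolding rat_dist_le_def using ty by (intro wf_rat_diff) (auto simp: abs_diff_def)
  ultimately show ?thesis
    using assms by (simp add: eq_real_def omega.real_eq_def)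
qed

lemma sat_le_real:
  assumes "well_typed e" "has_type x ty1" "has_type y ty1"
  shows "sat e (le_real x y) \<longleftrightarrow> omega.real_le (fun1 (tsubst e x)) (fun1 (tsubst e y))"
proof -
  let ?\<phi> = "rat_diff_le (lift Nat x \<cdot> Var Nat 0) (lift Nat y \<cdot> Var Nat 0) (Var Nat 0)"
  let ?B = "\<lambda>P Q D n. monus (times (pow2 n) (monus P Q)) (times (suc (suc zero)) D) = zero"
  have ty: "has_type (lift Nat x \<cdot> Var Nat 0) Nat" "has_type (lift Nat y \<cdot> Var Nat 0) Nat"
    using assms by (auto intro!: has_type_App)
  have "sat (push Nat (re n) e) ?\<phi> \<longleftrightarrow>
      omega.diff_holds ?B (fun1 (tsubst e x) n) (fun1 (tsubst e y) n) n" for n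
    unfolding rat_diff_le_def using assms ty
    by (subst sat_rat_diff[where B = ?B])
      (simp_all add: ab_simps ab_app_fun1 has_type_tsubst)
  moreover have "wf_fm ?\<phi>"
    unfolding rat_diff_le_def using ty by (intro wf_rat_diff) auto
  ultimately show ?thesis
    using assms by (simp add: le_real_def omega.real_le_def)
qed

lemma fun1_const: "has_type c Nat \<Longrightarrow> fun1 (PiC Nat Nat \<cdot> c) = (\<lambda>_. ab c)"
  using eqv_PiC[of c Nat _ Nat] by (auto simp: fun_eq_iff fun1_def eqv_Nat)

lemma sat_in_unit_interval:
  assumes "well_typed e" "has_type x ty1"
  shows "sat e (in_unit_interval x) \<longleftrightarrow> omega.unit_real (fun1 (tsubst e x))"
  using assms
  by (simp add: in_unit_interval_def omega.unit_real_def sat_is_real sat_le_real fun1_const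
      ab_rat_code ab_Succ)

lemma sat_in_Cantor:
  assumes "well_typed e" "has_type x ty1"
  shows "sat e (in_Cantor x) \<longleftrightarrow> omega.Cantor (fun1 (tsubst e x))"
proof -
  have "has_type (lift Nat x \<cdot> Var Nat 0) Nat" using assms by (auto intro!: has_type_App)
  then show ?thesis
    using assms by (simp add: in_Cantor_def omega.Cantor_def ab_simps ab_app_fun1 has_type_tsubst)
qed

lemma sat_eq_at_ty1:
  assumes "well_typed e" "has_type x ty1" "has_type y ty1"
  shows "sat e (eq_at ty1 x y) \<longleftrightarrow> fun1 (tsubst e x) = fun1 (tsubst e y)"
  using assms by (simp add: fun1_eq_iff eqv_def has_type_tsubst sat_def del: eq_at.simps)

lemma sat_NIN_of_reals:
  assumes "\<And>x. has_type x ty1 \<Longrightarrow> wf_fm (D x)"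
    and "\<And>e x. well_typed e \<Longrightarrow> has_type x ty1 \<Longrightarrow> sat e (D x) \<longleftrightarrow> P (fun1 (tsubst e x))"
    and "well_typed e"
  shows "sat e (NIN_of_reals D) \<longleftrightarrow> omega.nin_reals P"
  using assms
  by (simp add: NIN_of_reals_def Let_def omega.nin_reals_def sat_eq_real ab_re2_app)

lemma sat_NIN_Cantor: "well_typed e \<Longrightarrow> sat e NIN_Cantor \<longleftrightarrow> omega.nin_Cantor"
  by (simp_all add: NIN_Cantor_def Let_def omega.nin_Cantor_def sat_in_Cantor ab_re2_app
      sat_eq_at_ty1 wf_eq_at_ty1 del: eq_at.simps)

lemma sat_NIN_Baire: "well_typed e \<Longrightarrow> sat e NIN_Baire \<longleftrightarrow> omega.nin_Baire"
  by (simp_all add: NIN_Baire_def Let_def omega.nin_Baire_def ab_re2_app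
      sat_eq_at_ty1 wf_eq_at_ty1 del: eq_at.simps)

lemma equivalences_iff:
  "NIN \<^bold>\<longleftrightarrow> NIN_Cantor \<in> M \<and> NIN_Cantor \<^bold>\<longleftrightarrow> NIN_Baire \<in> M \<and> NIN_Baire \<^bold>\<longleftrightarrow> NIN_Real \<in> M
     \<longleftrightarrow> omega.nin_equivalent"
proof -
  have "sat Var NIN \<longleftrightarrow> omega.nin_reals omega.unit_real"
    unfolding NIN_def by (intro sat_NIN_of_reals sat_in_unit_interval) simp_all
  moreover have "sat Var NIN_Real \<longleftrightarrow> omega.nin_reals omega.real_seq"
    unfolding NIN_Real_def by (intro sat_NIN_of_reals sat_is_real) simp_all
  moreover have "sat Var NIN_Cantor \<longleftrightarrow> omega.nin_Cantor" by (simp add: sat_NIN_Cantor)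
  moreover have "sat Var NIN_Baire \<longleftrightarrow> omega.nin_Baire" by (simp add: sat_NIN_Baire)
  ultimately have "sat Var (NIN \<^bold>\<longleftrightarrow> NIN_Cantor) \<and> sat Var (NIN_Cantor \<^bold>\<longleftrightarrow> NIN_Baire) \<and>
      sat Var (NIN_Baire \<^bold>\<longleftrightarrow> NIN_Real) \<longleftrightarrow> omega.nin_equivalent"
    unfolding omega.nin_equivalent_def
    by (simp only: sat_Imp well_typed_Var wf_fm.simps wf_NIN sat_Falsum) argo
  then show ?thesis by (simp only: sat_def fsubst_Var)
qed

end

text \<open>
  Type class instances require one fixed type of numbers, whereas the model depends on the formula to
  be refuted.  Since term models are countably infinite, all of them can be copied to \<open>onum\<close>.
\<close>

typedef onum = "UNIV :: nat set" ..

primrec numeral_tm :: "nat \<Rightarrow> tm" where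
  "numeral_tm 0 = Zero" | "numeral_tm (Suc n) = Succ \<cdot> numeral_tm n"

lemma has_type_numeral_tm [simp]: "has_type (numeral_tm n) Nat"
  by (induction n) (auto intro: has_type_App)

text \<open>The classes of numerical terms are countable because terms are, and infinite because the
  successor axioms keep the numerals apart; so they can be numbered by all of \<open>nat\<close>,
  hence by \<open>onum\<close>.\<close>

lemma aca_model_exists:
  assumes "henkin ACA0_omega M"
  shows "\<exists>ab :: tm \<Rightarrow> onum. aca_model M ab"
proof -
  interpret henkin ACA0_omega M by fact
  have PRA: "\<phi> \<in> E_PRA_omega \<Longrightarrow> \<phi> \<in> M" for \<phi>
    by (rule M_axiom) (simp add: ACA0_omega_def RCA0_omega_def)
  let ?T = "{t. has_type t Nat}"
  let ?c = "\<lambda>t. {u. eqv Nat t u}"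
  have c: "?c s = ?c t \<longleftrightarrow> Eq s t \<in> M" if "has_type s Nat" "has_type t Nat" for s t
  proof -
    have "?c s = ?c t \<longleftrightarrow> eqv Nat s t"
      using that by (auto intro: eqv_refl eqv_sym eqv_trans)
    then show ?thesis using that by (simp add: eqv_def)
  qed
  have "m = n" if "Eq (numeral_tm m) (numeral_tm n) \<in> M" for m n
    using that
  proof (induction m arbitrary: n)
    case 0
    have "eqv Nat Zero (numeral_tm n)" using 0 by (simp add: eqv_def)
    then have "eqv Nat (numeral_tm n) Zero" by (rule eqv_sym)
    then show ?case
      using PRA[OF E_PRA_omega.Succ_nonzero[of "numeral_tm (n - 1)"]]
      by (cases n) (auto simp: eqv_def M_Imp)
  next
    case (Suc m)
    show ?case
    proof (cases n)
      case 0
      then show ?thesis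
        using Suc.prems PRA[OF E_PRA_omega.Succ_nonzero[of "numeral_tm m"]] by (auto simp: M_Imp)
    next
      case (Suc k)
      then show ?thesis
        using Suc.prems Suc.IH[of k] PRA[OF E_PRA_omega.Succ_inj[of "numeral_tm m" "numeral_tm k"]]
        by (auto simp: M_Imp)
    qed
  qed
  then have "inj (\<lambda>n. ?c (numeral_tm n))" by (intro injI) (simp add: c)
  then have "infinite (range (\<lambda>n. ?c (numeral_tm n)))" using finite_imageD infinite_UNIV_nat by blast
  moreover have "range (\<lambda>n. ?c (numeral_tm n)) \<subseteq> ?c ` ?T" by auto
  ultimately have "infinite (?c ` ?T)" using finite_subset by blast
  then have bij: "bij_betw (to_nat_on (?c ` ?T)) (?c ` ?T) UNIV"
    by (intro to_nat_on_infinite countable_image) auto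
  have "aca_model M (\<lambda>t. Abs_onum (to_nat_on (?c ` ?T) (?c t)))"
  proof unfold_locales
    fix s t assume st: "has_type s Nat" "has_type t Nat"
    then show "Abs_onum (to_nat_on (?c ` ?T) (?c s)) = Abs_onum (to_nat_on (?c ` ?T) (?c t)) \<longleftrightarrow> Eq s t \<in> M"
      using bij_betw_imp_inj_on[OF bij] c[OF st] by (subst Abs_onum_inject) (auto dest: inj_onD)
  next
    fix n :: onum
    have "Rep_onum n \<in> to_nat_on (?c ` ?T) ` (?c ` ?T)" using bij by (auto simp: bij_betw_def)
    then obtain t where t: "has_type t Nat" "Rep_onum n = to_nat_on (?c ` ?T) (?c t)" by auto
    then show "\<exists>t. has_type t Nat \<and> Abs_onum (to_nat_on (?c ` ?T) (?c t)) = n"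
      by (intro exI[of _ t]) (simp flip: t(2) add: Rep_onum_inverse)
  qed
  then show ?thesis by blast
qed

section \<open>Arithmetic in a model\<close>

context omega_model begin

notation plus (infixl "\<oplus>" 65) and times (infixl "\<otimes>" 70) and monus (infixl "\<ominus>" 65)

declare suc_nonzero [simp] pr_zero [simp] pr_suc [simp] plus_zero [simp] plus_suc [simp]
  times_zero [simp] times_suc [simp] monus_zero [simp] monus_suc [simp]

lemma suc_nonzero' [simp]: "zero \<noteq> suc a"
  using suc_nonzero by metis

lemma suc_eq_iff [simp]: "suc a = suc b \<longleftrightarrow> a = b"
  using suc_inj by blast

lemma Q_not: "Q p \<Longrightarrow> Q (\<lambda>Y x n. \<not> p Y x n)"
  using Q_imp[OF _ Q_False] by simp

lemma Q_or: "Q p \<Longrightarrow> Q q \<Longrightarrow> Q (\<lambda>Y x n. p Y x n \<or> q Y x n)"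
  using Q_imp[OF Q_not, of p q] by (simp add: disj_imp)

lemmas definable = R_num R_zero R_suc R_plus R_times R_monus R_pow2 R_fun Q_eq Q_False Q_imp Q_not Q_or

text \<open>Induction with two number parameters, enough for the algebraic laws below.
  \<open>Q_induct\<close> wants a whole context, so some function and \<open>E\<close> fill the
  places that \<open>P\<close> does not mention.\<close>

lemma num_induct:
  assumes "Q (\<lambda>Y x n. P (n 0) (n 1) (n 2))"
    and "P zero a b" and "\<And>m. P m a b \<Longrightarrow> P (suc m) a b"
  shows "P m a b"
proof -
  obtain x where "x \<in> D1" using D1_nonempty by blast
  then have "\<forall>m. P m a b"
    using assms(2,3) by (intro Q_induct[OF assms(1) E_in_D2, where x = "\<lambda>_. x" and n = "a ## b ## (\<lambda>_. zero)"]) auto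
  then show ?thesis ..
qed

lemma zero_plus [simp]: "zero \<oplus> a = a"
  by (rule num_induct[where P = "\<lambda>m a b. zero \<oplus> m = m"]) (intro definable, auto)

lemma suc_plus [simp]: "suc a \<oplus> b = suc (a \<oplus> b)"
  by (rule num_induct[where P = "\<lambda>m a b. suc a \<oplus> m = suc (a \<oplus> m)"]) (intro definable, auto)

lemma plus_commute: "a \<oplus> b = b \<oplus> a"
  by (rule num_induct[where P = "\<lambda>m a b. a \<oplus> m = m \<oplus> a"]) (intro definable, auto)

lemma plus_assoc: "a \<oplus> b \<oplus> c = a \<oplus> (b \<oplus> c)"
  by (rule num_induct[where P = "\<lambda>m a b. a \<oplus> b \<oplus> m = a \<oplus> (b \<oplus> m)"]) (intro definable, auto)

lemma plus_left_commute: "a \<oplus> (b \<oplus> c) = b \<oplus> (a \<oplus> c)"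
  by (metis plus_assoc plus_commute)

lemma zero_times [simp]: "zero \<otimes> a = zero"
  by (rule num_induct[where P = "\<lambda>m a b. zero \<otimes> m = zero"]) (intro definable, auto)

lemma suc_times [simp]: "suc a \<otimes> b = b \<oplus> a \<otimes> b"
  by (rule num_induct[where P = "\<lambda>m a b. suc a \<otimes> m = m \<oplus> a \<otimes> m"])
    (intro definable, auto simp: plus_left_commute)

lemma times_commute: "a \<otimes> b = b \<otimes> a"
  by (rule num_induct[where P = "\<lambda>m a b. a \<otimes> m = m \<otimes> a"]) (intro definable, auto)

lemma plus_times: "(a \<oplus> b) \<otimes> c = a \<otimes> c \<oplus> b \<otimes> c"
  by (rule num_induct[where P = "\<lambda>m a b. (a \<oplus> b) \<otimes> m = a \<otimes> m \<oplus> b \<otimes> m"])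
    (intro definable, auto simp: plus_left_commute plus_assoc)

lemma times_assoc: "a \<otimes> b \<otimes> c = a \<otimes> (b \<otimes> c)"
  by (rule num_induct[where P = "\<lambda>m a b. a \<otimes> b \<otimes> m = a \<otimes> (b \<otimes> m)"])
    (intro definable, auto simp: plus_times times_commute[of a])

lemma suc_monus_suc: "suc a \<ominus> suc b = a \<ominus> b"
  by (rule num_induct[where P = "\<lambda>m a b. suc a \<ominus> suc m = a \<ominus> m"]) (intro definable, auto)

lemma zero_monus [simp]: "zero \<ominus> a = zero"
  by (rule num_induct[where P = "\<lambda>m a b. zero \<ominus> m = zero"]) (intro definable, auto)

lemma plus_monus_cancel: "a \<oplus> c \<ominus> c = a"
  by (rule num_induct[where P = "\<lambda>m a b. a \<oplus> m \<ominus> m = a"])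
    (intro definable, auto simp: suc_monus_suc simp del: monus_suc)

lemma monus_plus_zero: "a \<ominus> (a \<oplus> c) = zero"
  by (rule num_induct[where P = "\<lambda>m a b. m \<ominus> (m \<oplus> a) = zero"])
    (intro definable, auto simp: suc_monus_suc simp del: monus_suc)

lemma monus_monus: "a \<ominus> b \<ominus> c = a \<ominus> (b \<oplus> c)"
  by (rule num_induct[where P = "\<lambda>m a b. a \<ominus> b \<ominus> m = a \<ominus> (b \<oplus> m)"]) (intro definable, auto)

lemma num_cases: obtains "n = zero" | m where "n = suc m"
proof -
  \<comment> \<open>The predecessor is written as a cut-off subtraction, to which the closure rules
    for \<open>R\<close> apply.\<close>
  have "n = zero \<or> n = suc (n \<ominus> suc zero)"
    by (rule num_induct[where P = "\<lambda>m a b. m = zero \<or> m = suc (m \<ominus> suc zero)"])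
      (intro definable, auto simp: suc_monus_suc simp del: monus_suc)
  then show ?thesis using that by blast
qed

text \<open>Induction on \<open>a\<close>: one of the two cut-off differences is the true distance,
  and increasing \<open>m\<close> changes the alternative exactly where \<open>m\<close> and
  \<open>b\<close> coincide.\<close>

lemma monus_total: "a \<oplus> (b \<ominus> a) = b \<or> b \<oplus> (a \<ominus> b) = a"
proof (rule num_induct[where P = "\<lambda>m a b. m \<oplus> (a \<ominus> m) = a \<or> a \<oplus> (m \<ominus> a) = m"])
  fix m assume "m \<oplus> (b \<ominus> m) = b \<or> b \<oplus> (m \<ominus> b) = m"
  then show "suc m \<oplus> (b \<ominus> suc m) = b \<or> b \<oplus> (suc m \<ominus> b) = suc m"
  proof
    assume m: "m \<oplus> (b \<ominus> m) = b"
    show ?thesis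
    proof (cases "b \<ominus> m" rule: num_cases)
      \<comment> \<open>Here \<open>b = m\<close>, so the successor of \<open>m\<close> is the first
        number to exceed \<open>b\<close>.\<close>
      case 1
      then have "suc m \<ominus> b = suc zero"
        using m plus_monus_cancel[of "suc zero" m] by simp
      then show ?thesis using m 1 by simp
    next
      case (2 c)
      then show ?thesis using m by auto
    qed
  next
    assume m: "b \<oplus> (m \<ominus> b) = m"
    then have "suc m = suc (m \<ominus> b) \<oplus> b" by (metis plus_commute suc_plus)
    then have "suc m \<ominus> b = suc (m \<ominus> b)" by (metis plus_monus_cancel)
    then show ?thesis using m by simp
  qed
qed (intro definable, simp)

lemma plus_right_cancel: "a \<oplus> c = b \<oplus> c \<Longrightarrow> a = b"
  by (metis plus_monus_cancel)

lemma monus_eq_zero_iff: "a \<ominus> b = zero \<longleftrightarrow> (\<exists>c. b = a \<oplus> c)"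
proof
  assume "a \<ominus> b = zero"
  then show "\<exists>c. b = a \<oplus> c" using monus_total[of a b] by (metis plus_zero)
qed (auto simp: monus_plus_zero)

lemma plus_eq_zero: "a \<oplus> b = zero \<Longrightarrow> a = zero"
  by (cases b rule: num_cases) auto

lemma times_eq_zero: "a \<otimes> b = zero \<Longrightarrow> a = zero \<or> b = zero"
  by (cases a rule: num_cases; cases b rule: num_cases) auto

text \<open>From here on \<open>a \<ominus> b = zero\<close> is read as \<open>a \<le> b\<close>.\<close>

lemma le_refl: "a \<ominus> a = zero"
  using monus_plus_zero[of a zero] by simp

lemma le_trans: "a \<ominus> b = zero \<Longrightarrow> b \<ominus> c = zero \<Longrightarrow> a \<ominus> c = zero"
  unfolding monus_eq_zero_iff using plus_assoc by metis

lemma le_antisym: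
  assumes "a \<ominus> b = zero" "b \<ominus> a = zero" shows "a = b"
proof -
  obtain c d where "b = a \<oplus> c" "a = b \<oplus> d" using assms unfolding monus_eq_zero_iff by blast
  then have "(c \<oplus> d) \<oplus> a = zero \<oplus> a" by (metis plus_assoc plus_commute zero_plus)
  then have "c = zero" by (metis plus_right_cancel plus_eq_zero)
  with \<open>b = a \<oplus> c\<close> show ?thesis by simp
qed

lemma le_linear: "a \<ominus> b = zero \<or> b \<ominus> a = zero"
  using monus_total[of a b] unfolding monus_eq_zero_iff by metis

lemma plus_le_mono: "a \<ominus> b = zero \<Longrightarrow> (c \<oplus> a) \<ominus> (c \<oplus> b) = zero"
  unfolding monus_eq_zero_iff using plus_assoc by metis

lemma le_monus_plus: "b \<ominus> a = zero \<Longrightarrow> a \<ominus> b \<oplus> b = a"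
  using monus_total[of a b] by (metis plus_commute plus_zero)

text \<open>Discreteness of the order, with \<open>b \<ominus> a \<noteq> zero\<close> read as
  \<open>a < b\<close>.\<close>

lemma less_iff: "b \<ominus> a \<noteq> zero \<longleftrightarrow> suc a \<ominus> b = zero"
proof
  assume "b \<ominus> a \<noteq> zero"
  then obtain c where "b = a \<oplus> c" "c \<noteq> zero" using le_linear le_refl
    by (metis monus_eq_zero_iff plus_zero)
  then show "suc a \<ominus> b = zero"
    unfolding monus_eq_zero_iff by (cases c rule: num_cases) auto
next
  assume "suc a \<ominus> b = zero"
  then obtain c where "b = suc a \<oplus> c" using monus_eq_zero_iff by blast
  then have "b = suc c \<oplus> a" by (simp add: plus_commute)
  then show "b \<ominus> a \<noteq> zero" using plus_monus_cancel[of "suc c" a] by simp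
qed

lemma times_less_mono:
  assumes "b \<ominus> a \<noteq> zero" "c \<ominus> zero \<noteq> zero"
  shows "c \<otimes> b \<ominus> c \<otimes> a \<noteq> zero"
proof -
  have "suc a \<ominus> b = zero" using assms(1) less_iff by blast
  then obtain d where "b = suc a \<oplus> d" using monus_eq_zero_iff by blast
  then have "b = suc d \<oplus> a" by (simp add: plus_commute)
  then have "c \<otimes> b = c \<otimes> suc d \<oplus> c \<otimes> a" by (metis plus_times times_commute)
  then have "c \<otimes> b \<ominus> c \<otimes> a = c \<otimes> suc d" by (simp only: plus_monus_cancel)
  then show ?thesis using assms(2) times_eq_zero[of c "suc d"] by auto
qed

lemma times_monus: "a \<otimes> (b \<ominus> c) = a \<otimes> b \<ominus> a \<otimes> c"
proof (cases "b \<ominus> c = zero")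
  case True
  then obtain d where "c = b \<oplus> d" unfolding monus_eq_zero_iff by blast
  then have "a \<otimes> c = a \<otimes> b \<oplus> a \<otimes> d" by (metis plus_times times_commute)
  then show ?thesis using True by (simp add: monus_plus_zero)
next
  case False
  then have "b = (b \<ominus> c) \<oplus> c" using le_linear le_monus_plus by metis
  then have "a \<otimes> b = a \<otimes> (b \<ominus> c) \<oplus> a \<otimes> c" by (metis plus_times times_commute)
  then show ?thesis by (simp only: plus_monus_cancel)
qed

end

text \<open>Bundling the locale parameters makes a model a single value, so that one can be picked
  by \<open>SOME\<close> and type class instances can refer to it.\<close>

record 'n omega_structure =
  zero_of :: 'n
  suc_of :: "'n \<Rightarrow> 'n"
  pr_of :: "'n \<Rightarrow> 'n"
  plus_of :: "'n \<Rightarrow> 'n \<Rightarrow> 'n"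
  times_of :: "'n \<Rightarrow> 'n \<Rightarrow> 'n"
  monus_of :: "'n \<Rightarrow> 'n \<Rightarrow> 'n"
  pow2_of :: "'n \<Rightarrow> 'n"
  D1_of :: "('n \<Rightarrow> 'n) set"
  D2_of :: "(('n \<Rightarrow> 'n) \<Rightarrow> 'n) set"
  E_of :: "('n \<Rightarrow> 'n) \<Rightarrow> 'n"
  R_of :: "'n ctx_fun \<Rightarrow> bool"
  Q_of :: "'n ctx_pred \<Rightarrow> bool"

definition is_omega_model :: "'n omega_structure \<Rightarrow> bool" where
  "is_omega_model S \<longleftrightarrow> omega_model (zero_of S) (suc_of S) (pr_of S) (plus_of S) (times_of S)
     (monus_of S) (pow2_of S) (D1_of S) (D2_of S) (E_of S) (R_of S) (Q_of S)"

definition satisfies_equivalences :: "'n omega_structure \<Rightarrow> bool" where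
  "satisfies_equivalences S \<longleftrightarrow> omega_model.nin_equivalent (zero_of S) (suc_of S) (plus_of S) (times_of S)
     (monus_of S) (pow2_of S) (D1_of S) (D2_of S)"

text \<open>This makes the choice of \<open>the_structure\<close> below meaningful even if there is no term model.\<close>

lemma standard_model: "\<exists>S :: onum omega_structure. is_omega_model S"
proof -
  let ?op = "\<lambda>f a b. Abs_onum (f (Rep_onum a) (Rep_onum b))"
  let ?z = "Abs_onum 0"
  let ?s = "\<lambda>a. Abs_onum (Suc (Rep_onum a))"
  let ?S = "\<lparr>zero_of = ?z, suc_of = ?s, pr_of = (\<lambda>a. Abs_onum (Rep_onum a - 1)),
    plus_of = ?op (+), times_of = ?op (*), monus_of = ?op (-), pow2_of = (\<lambda>a. Abs_onum (2 ^ Rep_onum a)),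
    D1_of = UNIV, D2_of = UNIV, E_of = (\<lambda>f. if \<exists>n. f n = ?z then ?z else ?s ?z),
    R_of = (\<lambda>_. True), Q_of = (\<lambda>_. True)\<rparr>"
  note [simp] = Abs_onum_inverse Rep_onum_inverse Abs_onum_inject
  have induct: "\<forall>m. P m" if "P ?z" "\<And>m. P m \<Longrightarrow> P (?s m)" for P
  proof
    fix m
    have "P (Abs_onum k)" for k
    proof (induction k)
      case (Suc k)
      then show ?case using that(2)[of "Abs_onum k"] by simp
    qed (rule that(1))
    from this[of "Rep_onum m"] show "P m" by simp
  qed
  have rec: "\<exists>r. \<forall>Y x n. r Y x (?z ## n) = h Y x n \<and>
      (\<forall>m. r Y x (?s m ## n) = g Y x (r Y x (m ## n) ## m ## n))" for g h :: "onum ctx_fun"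
    by (rule exI[of _ "\<lambda>Y x n. rec_nat (h Y x (\<lambda>i. n (Suc i)))
      (\<lambda>m v. g Y x (v ## Abs_onum m ## (\<lambda>i. n (Suc i)))) (Rep_onum (n 0))"]) simp
  have "is_omega_model ?S"
    unfolding is_omega_model_def
  proof (unfold_locales, goal_cases)
    case 27 then show ?case using rec by simp
  next
    case (33 p Y x P n) then show ?case using induct[of P] by simp
  qed (auto simp: Rep_onum_inject[symmetric])
  then show ?thesis by blast
qed

section \<open>The ordered field over the numbers of a model\<close>

text \<open>
  A counterexample to the equivalences is preferred, so that it suffices to prove them in this structure.
\<close>

definition the_structure :: "onum omega_structure" where
  "the_structure = (SOME S. is_omega_model S \<and>
     (satisfies_equivalences S \<longrightarrow> (\<forall>S' :: onum omega_structure. is_omega_model S' \<longrightarrow> satisfies_equivalences S')))"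

lemma the_structure: "is_omega_model the_structure"
  and the_structure_generic:
    "satisfies_equivalences the_structure \<Longrightarrow> is_omega_model (S :: onum omega_structure) \<Longrightarrow> satisfies_equivalences S"
proof -
  obtain S0 :: "onum omega_structure" where "is_omega_model S0" using standard_model by blast
  \<comment> \<open>A model that violates the equivalences meets the condition vacuously; if there
    is none, \<open>S0\<close> meets it.\<close>
  then have "\<exists>S :: onum omega_structure. is_omega_model S \<and> (satisfies_equivalences S \<longrightarrow>
      (\<forall>S' :: onum omega_structure. is_omega_model S' \<longrightarrow> satisfies_equivalences S'))"
    by (cases "\<forall>S' :: onum omega_structure. is_omega_model S' \<longrightarrow> satisfies_equivalences S'") blast+
  from someI_ex[OF this, folded the_structure_def]
  show "is_omega_model the_structure"
    and "satisfies_equivalences the_structure \<Longrightarrow> is_omega_model S \<Longrightarrow> satisfies_equivalences S"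
    by blast+
qed

instantiation onum :: "{zero, one, plus, minus, times, ord}"
begin
definition "0 = zero_of the_structure"
definition "1 = suc_of the_structure 0"
definition "a + b = plus_of the_structure a b" for a b :: onum
definition "a - b = monus_of the_structure a b" for a b :: onum
definition "a * b = times_of the_structure a b" for a b :: onum
definition "a \<le> b \<longleftrightarrow> a - b = 0" for a b :: onum
definition "a < b \<longleftrightarrow> b - a \<noteq> 0" for a b :: onum
instance ..
end

definition npr :: "onum \<Rightarrow> onum" where "npr = pr_of the_structure"
definition npow2 :: "onum \<Rightarrow> onum" where "npow2 = pow2_of the_structure"
definition nfuns :: "(onum \<Rightarrow> onum) set" where "nfuns = D1_of the_structure"
definition nfunctionals :: "((onum \<Rightarrow> onum) \<Rightarrow> onum) set" where "nfunctionals = D2_of the_structure"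
definition nE :: "(onum \<Rightarrow> onum) \<Rightarrow> onum" where "nE = E_of the_structure"
definition nR :: "onum ctx_fun \<Rightarrow> bool" where "nR = R_of the_structure"
definition nQ :: "onum ctx_pred \<Rightarrow> bool" where "nQ = Q_of the_structure"

lemmas structure_defs = zero_onum_def plus_onum_def minus_onum_def times_onum_def npr_def npow2_def
  nfuns_def nfunctionals_def nE_def nR_def nQ_def

text \<open>Writing the successor as addition of \<open>1\<close> makes the algebraic rules of the
  type classes applicable to it.\<close>

lemma suc_of_the_structure: "suc_of the_structure = (\<lambda>a. a + 1)"
proof -
  interpret omega_model "zero_of the_structure" "suc_of the_structure" "pr_of the_structure"
    "plus_of the_structure" "times_of the_structure" "monus_of the_structure" "pow2_of the_structure"
    "D1_of the_structure" "D2_of the_structure" "E_of the_structure" "R_of the_structure" "Q_of the_structure"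
    using the_structure by (simp add: is_omega_model_def)
  show ?thesis by (simp add: fun_eq_iff plus_onum_def one_onum_def zero_onum_def)
qed

interpretation onum: omega_model "0 :: onum" "\<lambda>a. a + 1" npr "(+)" "(*)" "(-)" npow2
  nfuns nfunctionals nE nR nQ
proof -
  have "(+) = plus_of the_structure" "(*) = times_of the_structure" "(-) = monus_of the_structure"
    by (simp_all add: fun_eq_iff structure_defs)
  then show "omega_model (0 :: onum) (\<lambda>a. a + 1) npr (+) (*) (-) npow2 nfuns nfunctionals nE nR nQ"
    using the_structure unfolding is_omega_model_def
    by (simp add: zero_onum_def npr_def npow2_def nfuns_def nfunctionals_def nE_def nR_def nQ_def
        flip: suc_of_the_structure)
qed

lemma satisfies_equivalences_the_structure:
  "satisfies_equivalences the_structure \<longleftrightarrow> onum.nin_equivalent"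
proof -
  have "(+) = plus_of the_structure" "(*) = times_of the_structure" "(-) = monus_of the_structure"
    by (simp_all add: fun_eq_iff structure_defs)
  then show ?thesis
    unfolding satisfies_equivalences_def
    by (simp add: zero_onum_def npow2_def nfuns_def nfunctionals_def flip: suc_of_the_structure)
qed

instance onum :: linordered_semidom
proof
  fix a b c :: onum
  show "a + b + c = a + (b + c)" by (rule onum.plus_assoc)
  show "a + b = b + a" by (rule onum.plus_commute)
  show "0 + a = a" by (rule onum.zero_plus)
  show "a * b * c = a * (b * c)" by (rule onum.times_assoc)
  show "a * b = b * a" by (rule onum.times_commute)
  show "1 * a = a" using onum.suc_times[of 0 a] by (simp add: onum.zero_plus onum.zero_times onum.plus_zero)
  show "(a + b) * c = a * c + b * c" by (rule onum.plus_times)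
  show "a * (b + c) = a * b + a * c" by (metis onum.plus_times onum.times_commute)
  show "0 * a = 0" "a * 0 = 0" by (rule onum.zero_times onum.times_zero)+
  show "a + b - a = b" by (metis onum.plus_commute onum.plus_monus_cancel)
  show "a - b - c = a - (b + c)" by (rule onum.monus_monus)
  show "a * (b - c) = a * b - a * c" by (rule onum.times_monus)
  show "(0 :: onum) \<noteq> 1" using onum.suc_nonzero[of 0] by (metis onum.zero_plus)
  show "a < b \<longleftrightarrow> a \<le> b \<and> \<not> b \<le> a"
    using onum.le_linear[of a b] by (auto simp: less_onum_def less_eq_onum_def)
  show "a \<le> a" by (simp add: less_eq_onum_def onum.le_refl)
  show "a \<le> b \<Longrightarrow> b \<le> c \<Longrightarrow> a \<le> c" unfolding less_eq_onum_def by (rule onum.le_trans)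
  show "a \<le> b \<Longrightarrow> b \<le> a \<Longrightarrow> a = b" unfolding less_eq_onum_def by (rule onum.le_antisym)
  show "a \<le> b \<or> b \<le> a" unfolding less_eq_onum_def by (rule onum.le_linear)
  show "a \<le> b \<Longrightarrow> c + a \<le> c + b" unfolding less_eq_onum_def by (rule onum.plus_le_mono)
  show "a < b \<Longrightarrow> 0 < c \<Longrightarrow> c * a < c * b" unfolding less_onum_def by (rule onum.times_less_mono)
  show "b \<le> a \<Longrightarrow> a - b + b = a" unfolding less_eq_onum_def by (rule onum.le_monus_plus)
  show "(0 :: onum) < 1"
    using onum.suc_nonzero[of 0] unfolding less_onum_def
    by (metis onum.zero_plus onum.monus_zero)
  show "a \<noteq> 0 \<Longrightarrow> b \<noteq> 0 \<Longrightarrow> a * b \<noteq> 0" using onum.times_eq_zero by blast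
qed

lemma onum_less_iff: "a < b \<longleftrightarrow> a + 1 \<le> b" for a b :: onum
  unfolding less_onum_def less_eq_onum_def by (rule onum.less_iff)

lemma onum_nonneg [simp]: "0 \<le> a" for a :: onum
  by (simp add: less_eq_onum_def onum.zero_monus)

section \<open>The ring of differences and its field of fractions\<close>

definition diffrel :: "'a::linordered_semidom \<times> 'a \<Rightarrow> 'a \<times> 'a \<Rightarrow> bool" where
  "diffrel = (\<lambda>(x, y) (u, v). x + v = u + y)"

lemma diffrel_iff [simp]: "diffrel (x, y) (u, v) \<longleftrightarrow> x + v = u + y"
  by (simp add: diffrel_def)

\<comment> \<open>Formal differences \<open>x - y\<close>, in the way the integers arise from the
  natural numbers. The type \<open>int\<close> would not do, as the semiring can be
  nonstandard.\<close>
quotient_type (overloaded) 'a difference = "'a::linordered_semidom \<times> 'a" / diffrel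
  morphisms rep_difference make_difference
proof (rule equivpI)
  show "reflp (diffrel :: 'a \<times> 'a \<Rightarrow> _)" by (auto simp: reflp_def)
  show "symp (diffrel :: 'a \<times> 'a \<Rightarrow> _)" by (auto simp: symp_def)
  show "transp (diffrel :: 'a \<times> 'a \<Rightarrow> _)"
  proof (rule transpI, clarsimp)
    fix a b c d e f :: 'a
    assume "a + d = c + b" "c + f = e + d"
    then have "(a + f) + (c + d) = (e + b) + (c + d)" by (metis add.assoc add.commute)
    then show "a + f = e + b" by simp
  qed
qed

instantiation difference :: (linordered_semidom) comm_ring_1
begin

lift_definition zero_difference :: "'a difference" is "(0, 0)" .

lift_definition one_difference :: "'a difference" is "(1, 0)" .

lift_definition plus_difference :: "'a difference \<Rightarrow> 'a difference \<Rightarrow> 'a difference"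
  is "\<lambda>(x, y) (u, v). (x + u, y + v)"
  by clarsimp (metis add.assoc add.commute)

lift_definition uminus_difference :: "'a difference \<Rightarrow> 'a difference" is "\<lambda>(x, y). (y, x)"
  by (clarsimp simp: add.commute)

lift_definition minus_difference :: "'a difference \<Rightarrow> 'a difference \<Rightarrow> 'a difference"
  is "\<lambda>(x, y) (u, v). (x + v, y + u)"
  by clarsimp (metis add.assoc add.commute)

lift_definition times_difference :: "'a difference \<Rightarrow> 'a difference \<Rightarrow> 'a difference"
  is "\<lambda>(x, y) (u, v). (x * u + y * v, x * v + y * u)"
proof (unfold diffrel_def, clarify)
  fix s t u v w x y z :: 'a
  assume "s + v = u + t" and "w + z = y + x"
  \<comment> \<open>Mixed products are added on both sides so that the two hypotheses can be
    applied, and are cancelled afterwards.\<close>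
  then have "(s + v) * w + (u + t) * x + u * (w + z) + v * (y + x) =
    (u + t) * w + (s + v) * x + u * (y + x) + v * (w + z)"
    by simp
  then have "(s * w + t * x + (u * z + v * y)) + (u * w + v * w + u * x + v * x) =
     (u * y + v * z + (s * x + t * w)) + (u * w + v * w + u * x + v * x)"
    by (simp add: algebra_simps)
  then show "s * w + t * x + (u * z + v * y) = u * y + v * z + (s * x + t * w)"
    by (rule add_right_imp_eq)
qed

instance
  by standard (transfer; clarsimp simp: algebra_simps)+

end

instantiation difference :: (linordered_semidom) linordered_idom
begin

lift_definition less_eq_difference :: "'a difference \<Rightarrow> 'a difference \<Rightarrow> bool"
  is "\<lambda>(x, y) (u, v). x + v \<le> u + y"
proof (clarsimp)
  fix a b c d e f g h :: 'a
  assume "a + d = c + b" "e + h = g + f"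
  then have "(a + d) + (f + h) = (c + b) + (f + h)" "(e + h) + (b + d) = (g + f) + (b + d)"
    by simp_all
  then have "(a + f) + (d + h) = (c + h) + (b + f)" "(e + b) + (d + h) = (g + d) + (b + f)"
    by (simp_all add: ac_simps)
  then show "a + f \<le> e + b \<longleftrightarrow> c + h \<le> g + d" by (metis add_le_cancel_right)
qed

definition less_difference :: "'a difference \<Rightarrow> 'a difference \<Rightarrow> bool" where
  "less_difference z w \<longleftrightarrow> \<not> w \<le> z"

definition "\<bar>z\<bar> = (if z < 0 then - z else z)" for z :: "'a difference"

definition "sgn z = (if z = 0 then 0 else if 0 < z then 1 else - 1)" for z :: "'a difference"

instance
proof
  fix z w r :: "'a difference"
  show "z \<le> z" by transfer auto
  show "z \<le> w \<Longrightarrow> w \<le> z \<Longrightarrow> z = w" by transfer auto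
  show linear: "z \<le> w \<or> w \<le> z" for z w :: "'a difference" by transfer auto
  show "z < w \<longleftrightarrow> z \<le> w \<and> \<not> w \<le> z" using linear by (auto simp: less_difference_def)
  show "z \<le> w \<Longrightarrow> w \<le> r \<Longrightarrow> z \<le> r"
  proof (transfer, clarsimp)
    fix a b c d e f :: 'a
    assume "a + d \<le> c + b" "c + f \<le> e + d"
    then have "(a + d) + (c + f) \<le> (c + b) + (e + d)" by (rule add_mono)
    then have "(a + f) + (c + d) \<le> (e + b) + (c + d)" by (simp add: algebra_simps)
    then show "a + f \<le> e + b" by simp
  qed
  show "z \<le> w \<Longrightarrow> r + z \<le> r + w"
    by (transfer, clarsimp simp: algebra_simps)
  show "z < w \<Longrightarrow> 0 < r \<Longrightarrow> r * z < r * w"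
    unfolding less_difference_def
  proof (transfer, clarsimp simp: not_le)
    fix a b c d p q :: 'a
    assume "a + d < c + b" "q < p"
      and le: "p * c + q * d + (p * b + q * a) \<le> p * a + q * b + (p * d + q * c)"
    \<comment> \<open>The terms with \<open>q\<close> occur on both sides, which reduces the claim
      to multiplication by the positive \<open>k\<close> in the semiring.\<close>
    then obtain k where k: "p = q + k" "0 < k" by (metis add.commute le_add_diff_inverse less_imp_le less_add_same_cancel1)
    have "k * (a + d) < k * (c + b)" using \<open>a + d < c + b\<close> k(2) by (rule mult_strict_left_mono)
    then have "(q * (a + d) + q * (c + b)) + k * (a + d) < (q * (a + d) + q * (c + b)) + k * (c + b)"
      by simp
    then have "p * a + q * b + (p * d + q * c) < p * c + q * d + (p * b + q * a)"
      unfolding k(1) by (simp add: algebra_simps)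
    with le show False by simp
  qed
  show "\<bar>z\<bar> = (if z < 0 then - z else z)" by (rule abs_difference_def)
  show "sgn z = (if z = 0 then 0 else if 0 < z then 1 else - 1)" by (rule sgn_difference_def)
qed

end

lift_definition diff_of :: "'a::linordered_semidom \<Rightarrow> 'a difference" is "\<lambda>a. (a, 0)" .

lemma diff_of_hom [simp]:
  "diff_of 0 = 0" "diff_of 1 = 1" "diff_of (a + b) = diff_of a + diff_of b"
  "diff_of (a * b) = diff_of a * diff_of b" "diff_of a \<le> diff_of b \<longleftrightarrow> a \<le> b"
  by (transfer; simp)+

text \<open>The values of rational codes live in this ordered field of fractions; no limits are
  formed in it.\<close>

type_synonym oreal = "onum difference fract"

definition emb :: "onum \<Rightarrow> oreal" where "emb a = Fract (diff_of a) 1"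

lemma emb_hom [simp]:
  "emb 0 = 0" "emb 1 = 1" "emb (a + b) = emb a + emb b" "emb (a * b) = emb a * emb b"
  "emb a \<le> emb b \<longleftrightarrow> a \<le> b"
  by (simp_all add: emb_def Zero_fract_def One_fract_def)

lemma emb_eq [simp]: "emb a = emb b \<longleftrightarrow> a = b"
  by (metis antisym emb_hom(5) order_refl)

lemma emb_less [simp]: "emb a < emb b \<longleftrightarrow> a < b"
  by (simp add: less_le)

lemma emb_nonneg [simp]: "0 \<le> emb a"
  using emb_hom(5)[of 0 a] by simp

text \<open>Cut-off subtraction becomes an ordinary difference truncated at zero, so inequalities
  between numbers can be settled by field arithmetic.\<close>

lemma emb_diff: "emb (a - b) = max 0 (emb a - emb b)"
proof (cases "b \<le> a")
  case True
  then have "emb (a - b) + emb b = emb a" by (simp flip: emb_hom(3))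
  moreover have "emb b \<le> emb a" using True by simp
  ultimately show ?thesis by (simp add: algebra_simps max_def)
next
  case False
  then have "a - b = 0" "emb a \<le> emb b" by (simp_all add: less_eq_onum_def[symmetric])
  then show ?thesis by simp
qed

section \<open>Rational and real numbers in a model\<close>

text \<open>Truth is coded by the value zero, in keeping with \<open>E\<close>, which detects
  whether a function has a zero. Thus \<open>E\<close> absorbs number quantifiers, and the class is
  closed under all first-order operations on numbers.\<close>

definition arith_pred :: "onum ctx_pred \<Rightarrow> bool" where
  "arith_pred p \<longleftrightarrow> (\<exists>g. nR g \<and>
     (\<forall>Y\<in>nfunctionals. \<forall>x n. (\<forall>i. x i \<in> nfuns) \<longrightarrow> (p Y x n \<longleftrightarrow> g Y x n = 0)))"

lemma R_one: "nR (\<lambda>Y x n. 1)"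
  using onum.R_suc[OF onum.R_zero] by simp

lemma arith_pred_le: "nR g \<Longrightarrow> nR h \<Longrightarrow> arith_pred (\<lambda>Y x n. g Y x n \<le> h Y x n)"
  unfolding arith_pred_def less_eq_onum_def
  by (intro exI[of _ "\<lambda>Y x n. g Y x n - h Y x n"]) (simp add: onum.R_monus)

lemma arith_pred_not:
  assumes "arith_pred p" shows "arith_pred (\<lambda>Y x n. \<not> p Y x n)"
proof -
  obtain g where g: "nR g"
    "\<And>Y x n. Y \<in> nfunctionals \<Longrightarrow> (\<forall>i. x i \<in> nfuns) \<Longrightarrow> p Y x n \<longleftrightarrow> g Y x n = 0"
    using assms unfolding arith_pred_def by metis
  have "a \<noteq> 0 \<longleftrightarrow> 1 - a = 0" for a :: onum
  proof -
    have "1 - a = 0 \<longleftrightarrow> 1 \<le> a" by (simp only: less_eq_onum_def)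
    also have "\<dots> \<longleftrightarrow> 0 < a" using onum_less_iff[of 0 a] by simp
    finally show ?thesis using onum_nonneg[of a] by (auto simp only: less_le)
  qed
  then show ?thesis unfolding arith_pred_def using g onum.R_monus[OF R_one g(1)]
    by (intro exI[of _ "\<lambda>Y x n. 1 - g Y x n"]) simp
qed

lemma arith_pred_conj:
  assumes "arith_pred p" "arith_pred q" shows "arith_pred (\<lambda>Y x n. p Y x n \<and> q Y x n)"
proof -
  obtain g where g: "nR g"
    "\<And>Y x n. Y \<in> nfunctionals \<Longrightarrow> (\<forall>i. x i \<in> nfuns) \<Longrightarrow> p Y x n \<longleftrightarrow> g Y x n = 0"
    using assms unfolding arith_pred_def by metis
  obtain h where h: "nR h"
    "\<And>Y x n. Y \<in> nfunctionals \<Longrightarrow> (\<forall>i. x i \<in> nfuns) \<Longrightarrow> q Y x n \<longleftrightarrow> h Y x n = 0"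
    using assms unfolding arith_pred_def by metis
  have "a + b = 0 \<longleftrightarrow> a = 0 \<and> b = 0" for a b :: onum
    by (simp add: add_nonneg_eq_0_iff)
  then show ?thesis unfolding arith_pred_def using g h onum.R_plus[OF g(1) h(1)]
    by (intro exI[of _ "\<lambda>Y x n. g Y x n + h Y x n"]) simp
qed

lemma arith_pred_eq:
  assumes "nR g" "nR h" shows "arith_pred (\<lambda>Y x n. g Y x n = h Y x n)"
  using arith_pred_conj[OF arith_pred_le[OF assms] arith_pred_le[OF assms(2,1)]]
  by (simp add: eq_iff)

lemma arith_pred_less: "nR g \<Longrightarrow> nR h \<Longrightarrow> arith_pred (\<lambda>Y x n. g Y x n < h Y x n)"
  using arith_pred_not[OF arith_pred_le[of h g]] by (simp add: not_le)

lemma arith_pred_ex: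
  assumes "arith_pred p" and P: "\<And>Y x n. P Y x n \<longleftrightarrow> (\<exists>m. p Y x (m ## n))"
  shows "arith_pred P"
proof -
  obtain g where g: "nR g"
    "\<And>Y x n. Y \<in> nfunctionals \<Longrightarrow> (\<forall>i. x i \<in> nfuns) \<Longrightarrow> p Y x n \<longleftrightarrow> g Y x n = 0"
    using assms unfolding arith_pred_def by metis
  define h where "h = (\<lambda>Y x n. nE (\<lambda>m. g Y x (m ## n)))"
  have "nR h" unfolding h_def by (rule onum.R_E[OF g(1)])
  moreover have "P Y x n \<longleftrightarrow> h Y x n = 0"
    if c: "Y \<in> nfunctionals" "\<forall>i. x i \<in> nfuns" for Y x n
  proof -
    define f where "f = (\<lambda>m. g Y x (m ## n))"
    have "f \<in> nfuns" by (rule onum.R_D1[OF g(1) c(1)]) (use c in \<open>auto simp: f_def\<close>)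
    then have "nE f = 0 \<longleftrightarrow> (\<exists>m. f m = 0)" by (rule onum.E_zero)
    then show ?thesis using g(2)[OF c] by (simp only: h_def f_def P)
  qed
  ultimately show ?thesis unfolding arith_pred_def by blast
qed

lemmas arith_intros = arith_pred_le arith_pred_less arith_pred_eq arith_pred_conj arith_pred_not
  R_one onum.R_num onum.R_zero onum.R_plus onum.R_times onum.R_monus onum.R_pow2 onum.R_fun

text \<open>An arithmetical predicate has the form \<open>g = 0\<close> with a definable
  \<open>g\<close>, so quantifier-free induction already covers it. The place of the functional is
  filled by \<open>nE\<close>.\<close>

lemma onum_induct:
  assumes p: "arith_pred p" and x: "\<And>i. x i \<in> nfuns" and P: "\<And>m. P m = p nE x (m ## n)"
    and base: "P 0" and step: "\<And>m. P m \<Longrightarrow> P (m + 1)"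
  shows "P k"
proof -
  obtain g where g: "nR g"
    "\<And>Y x n. Y \<in> nfunctionals \<Longrightarrow> (\<forall>i. x i \<in> nfuns) \<Longrightarrow> p Y x n \<longleftrightarrow> g Y x n = 0"
    using p unfolding arith_pred_def by metis
  have eq: "P m = (g nE x (m ## n) = 0)" for m using g(2) x by (simp add: P onum.E_in_D2)
  have "\<forall>m. P m"
    using onum.Q_induct[where p = "\<lambda>Y x n. g Y x n = 0" and Y = nE and x = x and n = n and P = P]
      onum.Q_eq[OF g(1) onum.R_zero] onum.E_in_D2 x eq base step by blast
  then show ?thesis ..
qed

lemma const_fun: "(\<lambda>_. c) \<in> nfuns"
proof -
  obtain x where "x \<in> nfuns" using onum.D1_nonempty by blast
  then show ?thesis
    by (rule onum.R_D1[OF onum.R_num[of 1] onum.E_in_D2, where x = "\<lambda>_. x" and n = "\<lambda>_. c"]) simp_all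
qed

text \<open>The constructions below have at most two function parameters; zero functions fill the
  other entries, so that the context stays in the model.\<close>

definition slots :: "(onum \<Rightarrow> onum) \<Rightarrow> (onum \<Rightarrow> onum) \<Rightarrow> nat \<Rightarrow> onum \<Rightarrow> onum" where
  "slots f g = f ## g ## (\<lambda>_ _. 0)"

lemma slots_simps [simp]: "slots f g 0 = f" "slots f g (Suc 0) = g"
  by (simp_all add: slots_def)

lemma slots_in: "f \<in> nfuns \<Longrightarrow> g \<in> nfuns \<Longrightarrow> slots f g i \<in> nfuns"
  unfolding slots_def by (cases i; cases "i - 1") (simp_all add: const_fun)

section \<open>Powers of two and the Archimedean property\<close>

definition two_pow :: "onum \<Rightarrow> oreal" where "two_pow n = emb (npow2 n)"

lemma npow2_zero [simp]: "npow2 0 = 1" and npow2_suc [simp]: "npow2 (n + 1) = 2 * npow2 n"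
  using onum.pow2_zero onum.pow2_suc[of n] by (simp_all add: one_add_one)

lemma emb_numeral [simp]: "emb (numeral k) = numeral k"
  by (induction k) (simp_all only: numeral.simps emb_hom)

lemma two_pow_zero [simp]: "two_pow 0 = 1" and two_pow_suc [simp]: "two_pow (n + 1) = 2 * two_pow n"
  by (simp_all add: two_pow_def)

lemma less_npow2: "n < npow2 n"
proof (rule onum_induct[where P = "\<lambda>n. n < npow2 n" and x = "slots (\<lambda>_. 0) (\<lambda>_. 0)"
      and p = "\<lambda>Y x n. n 0 < npow2 (n 0)" and n = "\<lambda>_. 0"])
  fix m :: onum assume "m < npow2 m"
  then have "m + 1 \<le> npow2 m" by (simp only: onum_less_iff)
  moreover from this have "1 \<le> npow2 m" by (rule order_trans[rotated]) simp
  ultimately have "m + 1 + 1 \<le> npow2 m + npow2 m" by (rule add_mono)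
  then show "m + 1 < npow2 (m + 1)" by (simp only: onum_less_iff npow2_suc mult_2)
qed (auto intro!: arith_intros slots_in const_fun)

lemma less_two_pow: "emb n < two_pow n"
  by (simp add: two_pow_def less_npow2)

lemma two_pow_pos [simp]: "0 < two_pow n"
  using less_two_pow[of n] emb_nonneg[of n] by linarith

lemma npow2_add: "npow2 (n + i) = npow2 n * npow2 i"
  by (rule onum_induct[where P = "\<lambda>i. npow2 (n + i) = npow2 n * npow2 i" and x = "slots (\<lambda>_. 0) (\<lambda>_. 0)"
      and p = "\<lambda>Y x n. npow2 (n 1 + n 0) = npow2 (n 1) * npow2 (n 0)" and n = "\<lambda>_. n"])
    (auto intro!: arith_intros slots_in const_fun simp: mult.left_commute simp flip: add.assoc)

lemma two_pow_add: "two_pow (n + i) = two_pow n * two_pow i"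
  by (simp add: two_pow_def npow2_add)

lemma one_le_two_pow: "1 \<le> two_pow n"
proof -
  have "1 \<le> n + 1" by simp
  also have "\<dots> \<le> npow2 n" using less_npow2[of n] by (simp only: onum_less_iff)
  finally have "1 \<le> npow2 n" .
  then have "emb 1 \<le> emb (npow2 n)" by (simp only: emb_hom(5))
  then show ?thesis by (simp add: two_pow_def)
qed

lemma one_le_pos_difference: "0 < b \<Longrightarrow> 1 \<le> b" for b :: "onum difference"
  unfolding less_difference_def by transfer (auto simp: not_le onum_less_iff add.commute)

text \<open>Archimedean relative to the numbers of the model, not to \<open>nat\<close>: a positive
  denominator is at least \<open>1\<close>, so a nonnegative bound for the numerator bounds the
  fraction.\<close>

lemma archimedean: "\<exists>m. k < emb m"
proof (induction k rule: fract_induct_pos)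
  case (Fract a b)
  have "\<exists>m. a < diff_of m"
  proof -
    have "\<exists>m. a \<le> diff_of m" by transfer auto
    then obtain m where "a \<le> diff_of m" ..
    also have "diff_of m < diff_of m + 1" by simp
    finally show ?thesis by (metis diff_of_hom(2,3))
  qed
  then obtain m where m: "a < diff_of m" ..
  have "0 \<le> diff_of m" using diff_of_hom(5)[of 0 m] by simp
  then have "diff_of m \<le> diff_of m * b"
    using one_le_pos_difference[OF Fract] mult_left_mono[of 1 b "diff_of m"] by simp
  with m have "a < diff_of m * b" by simp
  then have "a * b < diff_of m * b * b" using Fract by simp
  then have "Fract a b < emb m" using Fract by (simp add: emb_def)
  then show ?case ..
qed

text \<open>Pairs with sum \<open>s\<close> have codes from \<open>s * s\<close> to
  \<open>s * s + s\<close>, all below \<open>(s + 1) * (s + 1)\<close>. So the code determines the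
  sum, and then \<open>m\<close>.\<close>

lemma pair_inject:
  assumes "onum.pair m n = onum.pair m' n'" shows "m = m'" "n = n'"
proof -
  have less: "onum.pair m n < onum.pair m' n'" if "m + n < m' + n'" for m n m' n' :: onum
  proof -
    have "m < (m + n) + 1" by (simp only: onum_less_iff) simp
    also have "\<dots> \<le> (m + n) + ((m + n) + 1)" by simp
    finally have "m < (m + n) + ((m + n) + 1)" .
    then have "(m + n) * (m + n) + m < (m + n) * (m + n) + ((m + n) + ((m + n) + 1))"
      by (rule add_strict_left_mono)
    also have "\<dots> = (m + n + 1) * (m + n + 1)" by (simp add: algebra_simps)
    also have "\<dots> \<le> (m' + n') * (m' + n')"
      using that[unfolded onum_less_iff] by (intro mult_mono) simp_all
    also have "\<dots> \<le> (m' + n') * (m' + n') + m'" by simp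
    finally show ?thesis by (simp add: onum.pair_def)
  qed
  have "m + n = m' + n'" using less[of m n m' n'] less[of m' n' m n] assms by (metis neqE less_irrefl)
  then show "m = m'" using assms by (simp add: onum.pair_def)
  with \<open>m + n = m' + n'\<close> show "n = n'" by simp
qed

definition is_code :: "onum \<Rightarrow> bool" where "is_code k \<longleftrightarrow> (\<exists>a b c. k = onum.code a b c)"

text \<open>Unique because codes are injective. Not every number is a code, and elsewhere the value
  is unspecified.\<close>

definition val :: "onum \<Rightarrow> oreal" where
  "val k = (SOME v. \<exists>a b c. k = onum.code a b c \<and> v = (emb a - emb b) / (emb c + 1))"

lemma code_inject: "onum.code a b c = onum.code a' b' c' \<longleftrightarrow> a = a' \<and> b = b' \<and> c = c'"
  unfolding onum.code_def using pair_inject by metis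

lemma val_code: "val (onum.code a b c) = (emb a - emb b) / (emb c + 1)"
  unfolding val_def by (rule some_equality) (auto simp: code_inject)

lemma is_code_code [simp]: "is_code (onum.code a b c)"
  by (auto simp: is_code_def)

lemma emb_add_1_pos [simp]: "0 < emb c + 1"
  using emb_nonneg[of c] by linarith

text \<open>Over the common denominator \<open>D\<close> the difference of the two fractions is
  \<open>(P - Q) / D\<close>, so a comparison of \<open>P\<close>, \<open>Q\<close> and
  \<open>D\<close> becomes a property of the difference of the values.\<close>

lemma diff_holds_iff:
  assumes "\<And>P Q D. 0 < emb D \<Longrightarrow> A P Q D n \<longleftrightarrow> B ((emb P - emb Q) / emb D)"
  shows "onum.diff_holds A q r n \<longleftrightarrow> is_code q \<and> is_code r \<and> B (val q - val r)"
proof -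
  have "A (a * (f + 1) + e * (c + 1)) (b * (f + 1) + d * (c + 1)) ((c + 1) * (f + 1)) n \<longleftrightarrow>
      B (val (onum.code a b c) - val (onum.code d e f))" for a b c d e f
  proof -
    have pos: "emb c + 1 \<noteq> 0" "emb f + 1 \<noteq> 0" by (metis emb_add_1_pos less_irrefl)+
    then have "(emb a - emb b) / (emb c + 1) - (emb d - emb e) / (emb f + 1) =
      (emb (a * (f + 1) + e * (c + 1)) - emb (b * (f + 1) + d * (c + 1))) / emb ((c + 1) * (f + 1))"
      by (simp add: diff_frac_eq) (simp add: algebra_simps)
    moreover have "0 < emb ((c + 1) * (f + 1))"
      by (simp only: emb_hom mult_pos_pos emb_add_1_pos)
    ultimately show ?thesis by (simp add: assms val_code)
  qed
  then show ?thesis unfolding onum.diff_holds_def is_code_def by metis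
qed

lemma emb_abs_diff: "emb (P - Q + (Q - P)) = \<bar>emb P - emb Q\<bar>"
  using linear[of P Q] by (auto simp: emb_diff max_def)

lemma real_seq_iff: "onum.real_seq x \<longleftrightarrow> (\<forall>n. is_code (x n)) \<and>
    (\<forall>n i. two_pow n * \<bar>val (x n) - val (x (n + i))\<bar> < 1)"
proof -
  have *: "npow2 n * (P - Q + (Q - P)) + 1 - D = 0 \<longleftrightarrow> two_pow n * \<bar>(emb P - emb Q) / emb D\<bar> < 1"
    if "0 < emb D" for P Q D n
  proof -
    have "npow2 n * (P - Q + (Q - P)) + 1 - D = 0 \<longleftrightarrow> npow2 n * (P - Q + (Q - P)) < D"
      by (simp only: onum_less_iff less_eq_onum_def)
    also have "\<dots> \<longleftrightarrow> two_pow n * \<bar>emb P - emb Q\<bar> < emb D"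
      by (simp only: emb_less[symmetric] emb_hom(4) emb_abs_diff two_pow_def)
    also have "\<dots> \<longleftrightarrow> two_pow n * \<bar>(emb P - emb Q) / emb D\<bar> < 1"
      using that by (simp add: abs_divide)
    finally show ?thesis .
  qed
  have "onum.diff_holds (\<lambda>P Q D n. npow2 n * (P - Q + (Q - P)) + 1 - D = 0) q r n \<longleftrightarrow>
      is_code q \<and> is_code r \<and> (\<lambda>v. two_pow n * \<bar>v\<bar> < 1) (val q - val r)" for q r n
    using diff_holds_iff[where B = "\<lambda>v. two_pow n * \<bar>v\<bar> < 1" and n = n
      and A = "\<lambda>P Q D n. npow2 n * (P - Q + (Q - P)) + 1 - D = 0"] by (simp only: *)
  then show ?thesis by (simp only: onum.real_seq_def) blast
qed

lemma real_eq_iff: "onum.real_eq x y \<longleftrightarrow> (\<forall>n. is_code (x n) \<and> is_code (y n) \<and>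
    two_pow n * \<bar>val (x n) - val (y n)\<bar> \<le> 2)"
proof -
  have *: "npow2 n * (P - Q + (Q - P)) - (0 + 1 + 1) * D = 0 \<longleftrightarrow> two_pow n * \<bar>(emb P - emb Q) / emb D\<bar> \<le> 2"
    if "0 < emb D" for P Q D n
  proof -
    have "npow2 n * (P - Q + (Q - P)) - (0 + 1 + 1) * D = 0 \<longleftrightarrow> npow2 n * (P - Q + (Q - P)) \<le> 2 * D"
      by (simp add: less_eq_onum_def)
    also have "\<dots> \<longleftrightarrow> two_pow n * \<bar>emb P - emb Q\<bar> \<le> 2 * emb D"
      by (simp only: emb_hom(5)[symmetric] emb_hom(4) emb_abs_diff two_pow_def emb_numeral)
    also have "\<dots> \<longleftrightarrow> two_pow n * \<bar>(emb P - emb Q) / emb D\<bar> \<le> 2"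
      using that by (simp add: abs_divide divide_le_eq)
    finally show ?thesis .
  qed
  have "onum.diff_holds (\<lambda>P Q D n. npow2 n * (P - Q + (Q - P)) - (0 + 1 + 1) * D = 0) q r n \<longleftrightarrow>
      is_code q \<and> is_code r \<and> (\<lambda>v. two_pow n * \<bar>v\<bar> \<le> 2) (val q - val r)" for q r n
    using diff_holds_iff[where B = "\<lambda>v. two_pow n * \<bar>v\<bar> \<le> 2" and n = n
      and A = "\<lambda>P Q D n. npow2 n * (P - Q + (Q - P)) - (0 + 1 + 1) * D = 0"] by (simp only: *)
  then show ?thesis by (simp only: onum.real_eq_def)
qed

lemma real_le_iff: "onum.real_le x y \<longleftrightarrow> (\<forall>n. is_code (x n) \<and> is_code (y n) \<and>
    two_pow n * (val (x n) - val (y n)) \<le> 2)"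
proof -
  have *: "npow2 n * (P - Q) - (0 + 1 + 1) * D = 0 \<longleftrightarrow> two_pow n * ((emb P - emb Q) / emb D) \<le> 2"
    if "0 < emb D" for P Q D n
  proof -
    have "npow2 n * (P - Q) - (0 + 1 + 1) * D = 0 \<longleftrightarrow> npow2 n * (P - Q) \<le> 2 * D"
      by (simp add: less_eq_onum_def)
    also have "\<dots> \<longleftrightarrow> two_pow n * max 0 (emb P - emb Q) \<le> 2 * emb D"
      by (simp only: emb_hom(5)[symmetric] emb_hom(4) emb_diff two_pow_def emb_numeral)
    \<comment> \<open>The truncation at zero is invisible because the right-hand side is
      positive.\<close>
    also have "\<dots> \<longleftrightarrow> two_pow n * (emb P - emb Q) \<le> 2 * emb D"
      using that mult_pos_neg[OF two_pow_pos, of "emb P - emb Q" n] by (auto simp: max_def not_le)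
    also have "\<dots> \<longleftrightarrow> two_pow n * ((emb P - emb Q) / emb D) \<le> 2"
      using that by (simp add: divide_le_eq)
    finally show ?thesis .
  qed
  have "onum.diff_holds (\<lambda>P Q D n. npow2 n * (P - Q) - (0 + 1 + 1) * D = 0) q r n \<longleftrightarrow>
      is_code q \<and> is_code r \<and> (\<lambda>v. two_pow n * v \<le> 2) (val q - val r)" for q r n
    using diff_holds_iff[where B = "\<lambda>v. two_pow n * v \<le> 2" and n = n
      and A = "\<lambda>P Q D n. npow2 n * (P - Q) - (0 + 1 + 1) * D = 0"] by (simp only: *)
  then show ?thesis by (simp only: onum.real_le_def)
qed

section \<open>Dedekind cuts\<close>

lemma abs_two_pow [simp]: "\<bar>two_pow n\<bar> = two_pow n"
  by (simp add: less_imp_le)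

text \<open>The composition of \<open>Y\<close> with the map of functions that \<open>g\<close>
  defines is again a functional of the model, as far as its values on \<open>nfuns\<close> are
  concerned.\<close>

lemma reduction:
  assumes g: "nR g" and Y: "Y \<in> nfunctionals"
  obtains Z where "Z \<in> nfunctionals"
    and "\<And>z. z \<in> nfuns \<Longrightarrow> Z z = Y (\<lambda>m. g Y (slots z (\<lambda>_. 0)) (m ## (\<lambda>_. 0)))"
    and "\<And>z. z \<in> nfuns \<Longrightarrow> (\<lambda>m. g Y (slots z (\<lambda>_. 0)) (m ## (\<lambda>_. 0))) \<in> nfuns"
proof -
  define x :: "nat \<Rightarrow> onum \<Rightarrow> onum" where "x = (\<lambda>_. 0) ## (\<lambda>_ _. 0)"
  have slots: "z ## x = slots z (\<lambda>_. 0)" for z by (simp add: x_def slots_def)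
  have x: "x i \<in> nfuns" for i unfolding x_def by (cases i) (simp_all add: const_fun)
  define F where "F = (\<lambda>z. Y (\<lambda>m. g Y (z ## x) (m ## (\<lambda>_. 0))))"
  define h where "h = (\<lambda>Y x n. Y (\<lambda>m. g Y x (m ## n)))"
  have "nR h" unfolding h_def by (rule onum.R_Y[OF g])
  then obtain Z where "Z \<in> nfunctionals" "\<forall>z\<in>nfuns. Z z = F z"
    using onum.R_D2[where g = h and Y = Y and x = x and n = "\<lambda>_. 0" and F = F] Y x
    by (auto simp: h_def F_def)
  moreover have "(\<lambda>m. g Y (slots z (\<lambda>_. 0)) (m ## (\<lambda>_. 0))) \<in> nfuns" if "z \<in> nfuns" for z
  proof -
    define f where "f = (\<lambda>m. g Y (slots z (\<lambda>_. 0)) (m ## (\<lambda>_. 0)))"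
    have "f \<in> nfuns"
      by (rule onum.R_D1[OF g Y slots_in[OF that const_fun]]) (simp add: f_def)
    then show ?thesis by (simp only: f_def)
  qed
  ultimately show ?thesis using that[of Z] by (simp only: F_def slots)
qed

section \<open>Characteristic functions and the map from Baire space\<close>

lemma Cantor_iff: "onum.Cantor f \<longleftrightarrow> (\<forall>n. f n \<le> 1)"
  by (simp add: onum.Cantor_def less_eq_onum_def)

lemma Cantor_cases: "f n \<le> 1 \<Longrightarrow> f n = 0 \<or> f n = 1" for n :: onum and f :: "onum \<Rightarrow> onum"
  using onum_less_iff[of "f n" 1] onum_nonneg[of "f n"] by (auto simp: le_less)

lemma Cantor_eqI:
  assumes "onum.Cantor f" "onum.Cantor g" "\<And>k. f k = 0 \<longleftrightarrow> g k = 0" shows "f = g"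
proof
  fix k show "f k = g k"
    using assms(1,2) assms(3)[of k] Cantor_cases[of f k] Cantor_cases[of g k] unfolding Cantor_iff by metis
qed

text \<open>Arithmetical comprehension as a map: \<open>F z\<close> is the characteristic function,
  with zero for truth, of the set that \<open>p\<close> defines from \<open>z\<close>.\<close>

lemma characteristic_reduction:
  assumes p: "arith_pred p" and Y: "Y \<in> nfunctionals"
  obtains Z F where "Z \<in> nfunctionals"
    and "\<And>z. z \<in> nfuns \<Longrightarrow> Z z = Y (F z)" and "\<And>z. z \<in> nfuns \<Longrightarrow> F z \<in> nfuns"
    and "\<And>z. onum.Cantor (F z)"
    and "\<And>z k. z \<in> nfuns \<Longrightarrow> F z k = 0 \<longleftrightarrow> p Y (slots z (\<lambda>_. 0)) (k ## (\<lambda>_. 0))"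
proof -
  obtain g where g: "nR g"
    "\<And>Y x n. Y \<in> nfunctionals \<Longrightarrow> (\<forall>i. x i \<in> nfuns) \<Longrightarrow> p Y x n \<longleftrightarrow> g Y x n = 0"
    using p unfolding arith_pred_def by metis
  \<comment> \<open>The double cut-off subtraction keeps zero and sends all other numbers to
    \<open>1\<close>, which puts the values into Cantor space.\<close>
  define h where "h = (\<lambda>Y x n. 1 - (1 - g Y x n))"
  have "nR h" unfolding h_def by (intro onum.R_monus R_one g(1))
  then obtain Z where Z: "Z \<in> nfunctionals"
    "\<And>z. z \<in> nfuns \<Longrightarrow> Z z = Y (\<lambda>m. h Y (slots z (\<lambda>_. 0)) (m ## (\<lambda>_. 0)))"
    "\<And>z. z \<in> nfuns \<Longrightarrow> (\<lambda>m. h Y (slots z (\<lambda>_. 0)) (m ## (\<lambda>_. 0))) \<in> nfuns"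
    using reduction[OF _ Y] by metis
  have h_le: "h Y x n \<le> 1" for Y x n
    by (simp add: h_def less_eq_onum_def onum.monus_monus add.commute[of _ 1] onum.monus_plus_zero)
  have h_zero: "h Y x n = 0 \<longleftrightarrow> g Y x n = 0" for Y x n
  proof -
    have "h Y x n = 0 \<longleftrightarrow> 1 \<le> 1 - g Y x n" by (simp only: h_def less_eq_onum_def)
    also have "\<dots> \<longleftrightarrow> 1 \<le> emb (1 - g Y x n)" using emb_hom(5)[of 1] by simp
    also have "\<dots> \<longleftrightarrow> g Y x n = 0"
    proof (cases "g Y x n = 0")
      case False
      then have "0 < emb (g Y x n)" using emb_less[of 0 "g Y x n"] onum_nonneg[of "g Y x n"] by (simp add: le_less)
      then show ?thesis using False by (simp add: emb_diff max_def)
    qed (simp add: emb_diff)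
    finally show ?thesis .
  qed
  define F where "F = (\<lambda>z m. h Y (slots z (\<lambda>_. 0)) (m ## (\<lambda>_. 0)))"
  have "onum.Cantor (F z)" for z by (simp add: Cantor_iff F_def h_le)
  moreover have "F z k = 0 \<longleftrightarrow> p Y (slots z (\<lambda>_. 0)) (k ## (\<lambda>_. 0))" if "z \<in> nfuns" for z k
    using g(2)[OF Y, of "slots z (\<lambda>_. 0)"] slots_in[OF that const_fun] by (simp add: F_def h_zero)
  ultimately show ?thesis using that[of Z F] Z by (simp only: F_def)
qed

lemma arith_pred_ex': "arith_pred p \<Longrightarrow> arith_pred (\<lambda>Y x n. \<exists>m. p Y x (m ## n))"
  using arith_pred_ex[of p "\<lambda>Y x n. \<exists>m. p Y x (m ## n)"] by simp

lemma nin_Baire_imp_Cantor: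
  assumes "onum.nin_Baire" shows "onum.nin_Cantor"
  unfolding onum.nin_Cantor_def
proof
  fix Y assume Y: "Y \<in> nfunctionals"
  \<comment> \<open>The quantifier still to be added binds entry \<open>0\<close>, so the argument
    of the characteristic function is entry \<open>1\<close>.\<close>
  have "arith_pred (\<lambda>Y x n. n 1 = onum.pair (n 0) (x 0 (n 0)))"
    unfolding onum.pair_def by (intro arith_intros)
  from arith_pred_ex'[OF this]
  have p: "arith_pred (\<lambda>Y x n. \<exists>m. n 0 = onum.pair m (x 0 m))" by simp
  obtain Z F where Z: "Z \<in> nfunctionals" and ZF: "\<And>z. z \<in> nfuns \<Longrightarrow> Z z = Y (F z)"
    and F: "\<And>z. z \<in> nfuns \<Longrightarrow> F z \<in> nfuns" "\<And>z. onum.Cantor (F z)"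
    and graph: "\<And>z k. z \<in> nfuns \<Longrightarrow> F z k = 0 \<longleftrightarrow> (\<exists>m. k = onum.pair m (z m))"
    using characteristic_reduction[OF p Y] by simp metis
  obtain x y where xy: "x \<in> nfuns" "y \<in> nfuns" "x \<noteq> y" "Z x = Z y"
    using assms Z unfolding onum.nin_Baire_def by blast
  have "F x \<noteq> F y"
  proof
    assume "F x = F y"
    have "x m = y m" for m
    proof -
      have "F y (onum.pair m (x m)) = 0" using graph[OF xy(1)] \<open>F x = F y\<close> by metis
      then show ?thesis using graph[OF xy(2)] pair_inject by metis
    qed
    with \<open>x \<noteq> y\<close> show False by blast
  qed
  moreover have "Y (F x) = Y (F y)" using ZF xy by metis
  ultimately show "\<exists>x\<in>nfuns. \<exists>y\<in>nfuns. onum.Cantor x \<and> onum.Cantor y \<and> x \<noteq> y \<and> Y x = Y y"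
    using F xy(1,2) by blast
qed

text \<open>\<open>cut x k\<close> says that \<open>k\<close> codes a rational number below the real number \<open>x\<close>; it is stated with
  codes in order to be arithmetical.\<close>

definition cut :: "(onum \<Rightarrow> onum) \<Rightarrow> onum \<Rightarrow> bool" where
  "cut x k \<longleftrightarrow> (\<exists>p r s j a b c. k = onum.code p r s \<and> x j = onum.code a b c \<and>
     (c + 1) * (s + 1) + npow2 j * (b * (s + 1) + p * (c + 1)) < npow2 j * (a * (s + 1) + r * (c + 1)))"

lemma arith_pred_cut: "arith_pred (\<lambda>Y x n. cut (x 0) (n 0))"
proof -
  \<comment> \<open>The seven quantified numbers occupy the entries \<open>6\<close> down to
    \<open>0\<close>, which leaves \<open>k\<close> at entry \<open>7\<close>.\<close>
  have "arith_pred (\<lambda>Y x n. n 7 = onum.code (n 6) (n 5) (n 4) \<and> x 0 (n 3) = onum.code (n 2) (n 1) (n 0) \<and>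
     (n 0 + 1) * (n 4 + 1) + npow2 (n 3) * (n 1 * (n 4 + 1) + n 6 * (n 0 + 1)) <
     npow2 (n 3) * (n 2 * (n 4 + 1) + n 5 * (n 0 + 1)))"
    unfolding onum.code_def onum.pair_def by (intro arith_intros)
  from this[THEN arith_pred_ex', THEN arith_pred_ex', THEN arith_pred_ex', THEN arith_pred_ex',
    THEN arith_pred_ex', THEN arith_pred_ex', THEN arith_pred_ex']
  show ?thesis by (simp add: cut_def)
qed

text \<open>The inequality between numbers arises by clearing denominators and moving every term to
  the side where it is positive. As \<open>x j\<close> is within \<open>1 / 2 ^ j\<close> of the
  real number, one such \<open>j\<close> certifies that \<open>k\<close> lies below it.\<close>

lemma cut_iff: "cut x k \<longleftrightarrow> is_code k \<and> (\<exists>j. is_code (x j) \<and> 1 < two_pow j * (val (x j) - val k))"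
proof -
  have "(c + 1) * (s + 1) + npow2 j * (b * (s + 1) + p * (c + 1)) < npow2 j * (a * (s + 1) + r * (c + 1)) \<longleftrightarrow>
    1 < two_pow j * (val (onum.code a b c) - val (onum.code p r s))" (is "?l < ?r \<longleftrightarrow> _") for p r s j a b c
  proof -
    define C S where "C = emb c + 1" and "S = emb s + 1"
    have pos: "0 < C" "0 < S" "0 < C * S" by (simp_all add: C_def S_def)
    have "?l < ?r \<longleftrightarrow> emb ?l < emb ?r" by (simp only: emb_less)
    also have "\<dots> \<longleftrightarrow> 1 * (C * S) < two_pow j * ((emb a - emb b) * S - (emb p - emb r) * C)"
      by (simp add: C_def S_def two_pow_def algebra_simps)
    also have "\<dots> \<longleftrightarrow> 1 < two_pow j * ((emb a - emb b) * S - (emb p - emb r) * C) / (C * S)"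
      using pos(3) by (simp only: pos_less_divide_eq)
    also have "two_pow j * ((emb a - emb b) * S - (emb p - emb r) * C) / (C * S) =
        two_pow j * ((emb a - emb b) / C - (emb p - emb r) / S)"
      using pos by (simp add: diff_frac_eq)
    finally show ?thesis by (simp only: val_code C_def S_def)
  qed
  then show ?thesis unfolding cut_def is_code_def by metis
qed

text \<open>A witness \<open>n\<close> for \<open>x\<close> leaves a positive slack
  \<open>e\<close>. Far enough out, both the distance between \<open>x\<close> and \<open>y\<close>
  and the margin demanded by \<open>cut\<close> fit into it.\<close>

lemma cut_respects:
  assumes x: "onum.real_seq x" and eq: "onum.real_eq x y" and cut: "cut x k"
  shows "cut y k"
proof -
  obtain n where k: "is_code k" and n: "1 < two_pow n * (val (x n) - val k)"
    using cut unfolding cut_iff by blast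
  define e where "e = val (x n) - val k - 1 / two_pow n"
  have "1 / two_pow n < val (x n) - val k" using n by (simp add: pos_divide_less_eq mult.commute)
  then have e: "0 < e" by (simp add: e_def)
  \<comment> \<open>At stage \<open>n + i\<close> the sequences may differ by
    \<open>2 / 2 ^ (n + i)\<close>, and \<open>cut\<close> demands a margin of
    \<open>1 / 2 ^ (n + i)\<close>; hence the \<open>3\<close>.\<close>
  obtain i where i: "3 / e < emb i" using archimedean by blast
  let ?m = "n + i"
  have "3 / e < two_pow i" using i less_two_pow[of i] by simp
  also have "\<dots> \<le> two_pow ?m"
    using one_le_two_pow[of n] mult_right_mono[of 1 "two_pow n" "two_pow i"]
    by (simp add: two_pow_add less_imp_le)
  finally have "3 < e * two_pow ?m" using e by (simp add: field_simps)
  moreover have "two_pow n * \<bar>val (x n) - val (x ?m)\<bar> < 1" using x unfolding real_seq_iff by blast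
  then have "\<bar>val (x n) - val (x ?m)\<bar> < 1 / two_pow n" by (simp add: field_simps)
  then have "e < val (x ?m) - val k" by (simp add: e_def abs_less_iff)
  then have "e * two_pow ?m < (val (x ?m) - val k) * two_pow ?m" by simp
  moreover have "two_pow ?m * \<bar>val (x ?m) - val (y ?m)\<bar> \<le> 2" using eq unfolding real_eq_iff by blast
  then have "\<bar>two_pow ?m * (val (x ?m) - val (y ?m))\<bar> \<le> 2" by (simp add: abs_mult)
  then have "two_pow ?m * (val (x ?m) - val (y ?m)) \<le> 2" by (simp only: abs_le_iff)
  ultimately have "1 < two_pow ?m * (val (y ?m) - val k)" by (simp add: algebra_simps)
  then show ?thesis using eq k unfolding cut_iff real_eq_iff by blast
qed

text \<open>The rational \<open>y n + 1 / 2 ^ n\<close> separates: \<open>x n\<close> exceeds it by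
  more than \<open>1 / 2 ^ n\<close>, whereas no \<open>y m\<close> exceeds it by more than
  \<open>1 / 2 ^ m\<close>.\<close>

lemma cut_separates:
  assumes x: "onum.real_seq x" and y: "onum.real_seq y" and n: "2 < two_pow n * (val (x n) - val (y n))"
  shows "\<exists>k. cut x k \<and> \<not> cut y k"
proof -
  have codes: "is_code (x i)" "is_code (y i)" for i using x y unfolding real_seq_iff by blast+
  obtain a b c where abc: "y n = onum.code a b c" using codes unfolding is_code_def by metis
  \<comment> \<open>\<open>y n + 1 / 2 ^ n\<close> over the denominator
    \<open>(c + 1) * 2 ^ n\<close>; a code stores the denominator diminished by one.\<close>
  define k where "k = onum.code (a * npow2 n + c + 1) (b * npow2 n) ((c + 1) * npow2 n - 1)"
  have "1 \<le> (emb c + 1) * two_pow n"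
    using one_le_two_pow[of n] mult_mono[of 1 "emb c + 1" 1 "two_pow n"] by simp
  then have "emb 1 \<le> emb ((c + 1) * npow2 n)" by (simp only: emb_hom two_pow_def)
  then have "emb ((c + 1) * npow2 n - 1) + 1 = (emb c + 1) * two_pow n"
    by (simp only: emb_diff emb_hom two_pow_def)
  moreover have "emb c + 1 \<noteq> 0" by (metis emb_add_1_pos less_irrefl)
  ultimately have val_k: "val k = val (y n) + 1 / two_pow n"
    using two_pow_pos[of n] by (simp add: k_def abc val_code add_frac_eq two_pow_def algebra_simps)
  have "cut x k"
    unfolding cut_iff using n codes two_pow_pos[of n]
    by (auto simp: val_k k_def[symmetric] algebra_simps intro!: exI[of _ n]) (simp add: k_def)
  moreover have "two_pow m * (val (y m) - val k) \<le> 1" for m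
  \<comment> \<open>The Cauchy condition at the smaller index bounds the distance of
    \<open>y m\<close> from \<open>y n\<close>: by \<open>1 / 2 ^ n\<close>, which the summand in
    \<open>k\<close> absorbs, or by \<open>1 / 2 ^ m\<close>, which is allowed.\<close>
  proof (cases "n \<le> m")
    case True
    have "two_pow n * \<bar>val (y n) - val (y (n + (m - n)))\<bar> < 1" using y unfolding real_seq_iff by blast
    then have "\<bar>val (y n) - val (y m)\<bar> < 1 / two_pow n" using True by (simp add: field_simps)
    then have "val (y m) - val k \<le> 0" by (simp add: val_k abs_less_iff)
    then have "two_pow m * (val (y m) - val k) \<le> 0" by (simp add: mult_nonneg_nonpos less_imp_le)
    then show ?thesis by simp
  next
    case False
    have "two_pow m * \<bar>val (y m) - val (y (m + (n - m)))\<bar> < 1" using y unfolding real_seq_iff by blast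
    then have "\<bar>two_pow m * (val (y m) - val (y n))\<bar> < 1" using False by (simp add: abs_mult)
    then have "two_pow m * (val (y m) - val (y n)) < 1" by (simp only: abs_less_iff)
    moreover have "0 < two_pow m * (1 / two_pow n)" by simp
    moreover have "two_pow m * (val (y m) - val k) =
        two_pow m * (val (y m) - val (y n)) - two_pow m * (1 / two_pow n)"
      by (simp add: val_k algebra_simps)
    ultimately show ?thesis by linarith
  qed
  then have "\<not> cut y k" unfolding cut_iff by (meson not_le)
  ultimately show ?thesis by blast
qed

lemma cut_inject:
  assumes "onum.real_seq x" "onum.real_seq y" "\<And>k. cut x k \<longleftrightarrow> cut y k"
  shows "onum.real_eq x y"
proof (rule ccontr)
  assume "\<not> onum.real_eq x y"
  then obtain n where "2 < two_pow n * \<bar>val (x n) - val (y n)\<bar>"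
    using assms(1,2) unfolding real_eq_iff real_seq_iff by (meson not_le)
  then have "2 < two_pow n * (val (x n) - val (y n)) \<or> 2 < two_pow n * (val (y n) - val (x n))"
    by (auto simp: abs_if split: if_splits)
  then show False using cut_separates assms by metis
qed

lemma real_eq_sym: "onum.real_eq x y \<Longrightarrow> onum.real_eq y x"
  unfolding real_eq_iff by (metis abs_minus_commute)

text \<open>Covers the interval and the line at once. That cuts do not depend on representations
  gives the hypothesis of \<open>nin_reals\<close> for \<open>Z\<close>; that they determine the
  real number carries the collision of \<open>Z\<close> over to \<open>Y\<close>.\<close>

lemma nin_reals_imp_Cantor:
  assumes nin: "onum.nin_reals D" and D: "\<And>x. D x \<Longrightarrow> onum.real_seq x"
  shows "onum.nin_Cantor"
  unfolding onum.nin_Cantor_def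
proof
  fix Y assume Y: "Y \<in> nfunctionals"
  obtain Z F where Z: "Z \<in> nfunctionals" and ZF: "\<And>z. z \<in> nfuns \<Longrightarrow> Z z = Y (F z)"
    and F: "\<And>z. z \<in> nfuns \<Longrightarrow> F z \<in> nfuns" "\<And>z. onum.Cantor (F z)"
    and F_cut: "\<And>z k. z \<in> nfuns \<Longrightarrow> F z k = 0 \<longleftrightarrow> cut z k"
    using characteristic_reduction[OF arith_pred_cut Y] by simp metis
  have "Z x = Z y" if "x \<in> nfuns" "y \<in> nfuns" "D x" "D y" "onum.real_eq x y" for x y
  proof -
    have "cut x k \<longleftrightarrow> cut y k" for k
      using that D cut_respects real_eq_sym by blast
    then have "F x = F y" using that F F_cut by (intro Cantor_eqI) auto
    then show ?thesis using ZF that by simp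
  qed
  then obtain x y where xy: "x \<in> nfuns" "y \<in> nfuns" "D x" "D y" "\<not> onum.real_eq x y" "Z x = Z y"
    using nin Z unfolding onum.nin_reals_def by blast
  have "F x \<noteq> F y"
  proof
    assume "F x = F y"
    then have "cut x k \<longleftrightarrow> cut y k" for k using F_cut xy(1,2) by metis
    then show False using cut_inject D xy by blast
  qed
  moreover have "Y (F x) = Y (F y)" using ZF xy by metis
  ultimately show "\<exists>x\<in>nfuns. \<exists>y\<in>nfuns. onum.Cantor x \<and> onum.Cantor y \<and> x \<noteq> y \<and> Y x = Y y"
    using F xy(1,2) by blast
qed

section \<open>Base-4 expansions\<close>

text \<open>The rational \<open>a k / 4 ^ k\<close>, with the power of four as a square and one
  subtracted because codes store denominators diminished by one.\<close>

definition base4_real :: "(onum \<Rightarrow> onum) \<Rightarrow> onum \<Rightarrow> onum" where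
  "base4_real a k = onum.code (a k) 0 (npow2 k * npow2 k - 1)"

lemma quadruple: "a + a + a + a = 4 * a" for a :: onum
proof -
  have "(4 :: onum) = 2 + 2" by simp
  then show ?thesis by (simp only: distrib_right mult_2 add.assoc)
qed

lemma base4_reduction:
  assumes Y: "Y \<in> nfunctionals"
  obtains Z A where "Z \<in> nfunctionals"
    and "\<And>f. f \<in> nfuns \<Longrightarrow> Z f = Y (base4_real (A f))"
    and "\<And>f. f \<in> nfuns \<Longrightarrow> base4_real (A f) \<in> nfuns"
    and "\<And>f. f \<in> nfuns \<Longrightarrow> A f \<in> nfuns"
    and "\<And>f. f \<in> nfuns \<Longrightarrow> A f 0 = 0"
    and "\<And>f k. f \<in> nfuns \<Longrightarrow> A f (k + 1) = 4 * A f k + f k"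
proof -
  \<comment> \<open>Entry \<open>0\<close> is the previous value and entry \<open>1\<close> the
    counter; the fourfold sum stands for multiplication by four.\<close>
  have "nR (\<lambda>Y x n. n 0 + n 0 + n 0 + n 0 + x 0 (n 1))" by (intro arith_intros)
  from onum.R_rec[OF this onum.R_zero]
  obtain r where r: "nR r"
    "\<And>Y x n. Y \<in> nfunctionals \<Longrightarrow> (\<forall>i. x i \<in> nfuns) \<Longrightarrow> r Y x (0 ## n) = 0"
    "\<And>Y x n m. Y \<in> nfunctionals \<Longrightarrow> (\<forall>i. x i \<in> nfuns) \<Longrightarrow>
      r Y x ((m + 1) ## n) = r Y x (m ## n) + r Y x (m ## n) + r Y x (m ## n) + r Y x (m ## n) + x 0 m"
    by auto
  define A where "A = (\<lambda>f k. r Y (slots f (\<lambda>_. 0)) (k ## (\<lambda>_. 0)))"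
  define g where "g = (\<lambda>Y x n. onum.code (r Y x n) 0 (npow2 (n 0) * npow2 (n 0) - 1))"
  have "nR g" unfolding g_def onum.code_def onum.pair_def by (intro arith_intros r(1))
  moreover have "(\<lambda>m. g Y (slots f (\<lambda>_. 0)) (m ## (\<lambda>_. 0))) = base4_real (A f)" for f
    by (simp add: g_def base4_real_def A_def fun_eq_iff)
  ultimately obtain Z where "Z \<in> nfunctionals" "\<And>f. f \<in> nfuns \<Longrightarrow> Z f = Y (base4_real (A f))"
    "\<And>f. f \<in> nfuns \<Longrightarrow> base4_real (A f) \<in> nfuns"
    using reduction[of g, OF _ Y] by metis
  moreover have slots: "\<forall>i. slots f (\<lambda>_. 0) i \<in> nfuns" if "f \<in> nfuns" for f
    using slots_in[OF that const_fun] by blast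
  have "A f \<in> nfuns" if "f \<in> nfuns" for f
    by (rule onum.R_D1[OF r(1) Y slots_in[OF that const_fun]]) (simp add: A_def)
  moreover have "A f 0 = 0" "A f (k + 1) = 4 * A f k + f k" if "f \<in> nfuns" for f k
    using r(2,3)[OF Y slots[OF that]] quadruple by (simp_all add: A_def)
  ultimately show ?thesis using that by blast
qed

lemma val_base4_real: "val (base4_real a k) = emb (a k) / (two_pow k * two_pow k)"
proof -
  have "1 \<le> two_pow k * two_pow k"
    using one_le_two_pow[of k] mult_mono[of 1 "two_pow k" 1 "two_pow k"] by simp
  then have "emb (npow2 k * npow2 k - 1) + 1 = two_pow k * two_pow k"
    by (simp add: emb_diff two_pow_def)
  then show ?thesis by (simp add: base4_real_def val_code)
qed

lemma is_code_base4_real [simp]: "is_code (base4_real a k)"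
  by (simp add: base4_real_def)

text \<open>The base-4 partial sums of a 0-1 sequence \<open>f\<close> are \<open>a k / 4 ^ k\<close>; after stage \<open>k\<close> the sum grows
  by at most \<open>1 / (3 * 4 ^ k)\<close>.\<close>

locale base4 =
  fixes f a :: "onum \<Rightarrow> onum"
  assumes f: "f \<in> nfuns" and a: "a \<in> nfuns" and f_le: "f k \<le> 1"
    and a_zero [simp]: "a 0 = 0" and a_suc: "a (k + 1) = 4 * a k + f k"
begin

lemma four_times: "4 * (x * (y * y)) = x * (2 * y * (2 * y))" for x y :: onum
proof -
  have "(4 :: onum) = 2 * 2" by simp
  then show ?thesis by (simp only: mult_ac)
qed

text \<open>Each stage multiplies by four and adds a digit, which is never negative.\<close>

lemma lower: "emb (a k) * (two_pow i * two_pow i) \<le> emb (a (k + i))"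
proof -
  have "a k * (npow2 i * npow2 i) \<le> a (k + i)"
  proof (rule onum_induct[where P = "\<lambda>i. a k * (npow2 i * npow2 i) \<le> a (k + i)" and x = "slots a (\<lambda>_. 0)"
        and p = "\<lambda>Y x n. x 0 (n 1) * (npow2 (n 0) * npow2 (n 0)) \<le> x 0 (n 1 + n 0)" and n = "\<lambda>_. k"])
    show "arith_pred (\<lambda>Y x n. x 0 (n 1) * (npow2 (n 0) * npow2 (n 0)) \<le> x 0 (n 1 + n 0))"
      by (intro arith_intros)
    show "slots a (\<lambda>_. 0) i \<in> nfuns" for i by (rule slots_in[OF a const_fun])
    fix m assume "a k * (npow2 m * npow2 m) \<le> a (k + m)"
    then have "4 * (a k * (npow2 m * npow2 m)) \<le> 4 * a (k + m) + f (k + m)"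
      by (intro add_increasing2 mult_left_mono) simp_all
    also have "\<dots> = a (k + (m + 1))" using a_suc[of "k + m"] by (simp only: add.assoc)
    also have "4 * (a k * (npow2 m * npow2 m)) = a k * (npow2 (m + 1) * npow2 (m + 1))"
      by (simp only: npow2_suc four_times)
    finally show "a k * (npow2 (m + 1) * npow2 (m + 1)) \<le> a (k + (m + 1))" .
  qed simp_all
  then have "emb (a k * (npow2 i * npow2 i)) \<le> emb (a (k + i))" by (simp only: emb_hom(5))
  then show ?thesis by (simp add: two_pow_def)
qed

text \<open>For a digit \<open>1\<close>, the quantity \<open>3 * a + 1\<close> is multiplied by
  exactly four, as \<open>3 * (4 * a + 1) + 1 = 4 * (3 * a + 1)\<close>; for a digit
  \<open>0\<close> it grows less.\<close>

lemma upper: "3 * emb (a (k + i)) + 1 \<le> (3 * emb (a k) + 1) * (two_pow i * two_pow i)"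
proof -
  \<comment> \<open>Sums replace the factor \<open>3\<close> because the closure rules for definable
    functions know the constants \<open>0\<close> and \<open>1\<close> only.\<close>
  have "a (k + i) + a (k + i) + a (k + i) + 1 \<le> (a k + a k + a k + 1) * (npow2 i * npow2 i)"
  proof (rule onum_induct[where P = "\<lambda>i. a (k + i) + a (k + i) + a (k + i) + 1 \<le> (a k + a k + a k + 1) * (npow2 i * npow2 i)"
        and p = "\<lambda>Y x n. x 0 (n 1 + n 0) + x 0 (n 1 + n 0) + x 0 (n 1 + n 0) + 1 \<le>
          (x 0 (n 1) + x 0 (n 1) + x 0 (n 1) + 1) * (npow2 (n 0) * npow2 (n 0))"
        and n = "\<lambda>_. k" and x = "slots a (\<lambda>_. 0)"])
    show "arith_pred (\<lambda>Y x n. x 0 (n 1 + n 0) + x 0 (n 1 + n 0) + x 0 (n 1 + n 0) + 1 \<le>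
          (x 0 (n 1) + x 0 (n 1) + x 0 (n 1) + 1) * (npow2 (n 0) * npow2 (n 0)))"
      by (intro arith_intros)
    show "slots a (\<lambda>_. 0) i \<in> nfuns" for i by (rule slots_in[OF a const_fun])
    fix m
    let ?l = "a (k + m)" and ?r = "(a k + a k + a k + 1) * (npow2 m * npow2 m)"
    assume "?l + ?l + ?l + 1 \<le> ?r"
    then have "4 * (?l + ?l + ?l + 1) \<le> 4 * ?r" by (intro mult_left_mono) simp_all
    define l c where "l = ?l" and "c = f (k + m)"
    have "c + c + c \<le> 1 + 1 + 1" unfolding c_def by (intro add_mono f_le)
    then have "(4 * l + 4 * l + 4 * l + 1) + (c + c + c) \<le> (4 * l + 4 * l + 4 * l + 1) + (1 + 1 + 1)"
      by (rule add_left_mono)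
    also have "(4 * l + 4 * l + 4 * l + 1) + (c + c + c) = (4 * l + c) + (4 * l + c) + (4 * l + c) + 1"
      by (simp only: add_ac)
    also have "4 * l + c = a (k + (m + 1))"
      unfolding l_def c_def using a_suc[of "k + m"] by (simp only: add.assoc)
    also have "(4 * l + 4 * l + 4 * l + 1) + (1 + 1 + 1) = 4 * (?l + ?l + ?l + 1)"
    proof -
      have "1 + (1 + 1 + 1) = (4 :: onum)" by simp
      then show ?thesis by (simp only: l_def distrib_left mult_1_right add.assoc[of _ 1 "1 + 1 + 1"])
    qed
    also note \<open>4 * (?l + ?l + ?l + 1) \<le> 4 * ?r\<close>
    also have "4 * ?r = (a k + a k + a k + 1) * (npow2 (m + 1) * npow2 (m + 1))"
      by (simp only: npow2_suc four_times)
    finally show "a (k + (m + 1)) + a (k + (m + 1)) + a (k + (m + 1)) + 1 \<le>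
        (a k + a k + a k + 1) * (npow2 (m + 1) * npow2 (m + 1))" .
  qed simp_all
  then have "emb (a (k + i) + a (k + i) + a (k + i) + 1) \<le> emb ((a k + a k + a k + 1) * (npow2 i * npow2 i))"
    by (simp only: emb_hom(5))
  then show ?thesis by (simp add: two_pow_def algebra_simps)
qed

lemma real_seq: "onum.real_seq (base4_real a)"
  unfolding real_seq_iff
proof (intro conjI allI)
  fix k i
  define P u where "P = two_pow k" and "u = two_pow i * two_pow i"
  have P: "1 \<le> P" "0 < P" "P \<le> P * P" "0 < u" "P * P \<noteq> 0" "u \<noteq> 0"
    using one_le_two_pow[of k] mult_left_mono[of 1 P P] two_pow_pos[of k] two_pow_pos[of i]
    by (auto simp: P_def u_def simp del: two_pow_pos dest: less_imp_neq)
  \<comment> \<open>The growth after stage \<open>k\<close> in units of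
    \<open>1 / 4 ^ (k + i)\<close>. Being less than \<open>u\<close>, it amounts to less than
    \<open>1 / 4 ^ k\<close>, hence to less than \<open>1 / 2 ^ k\<close>.\<close>
  define d where "d = emb (a (k + i)) - emb (a k) * u"
  have d: "0 \<le> d" "d < u"
    using lower[of k i] upper[of k i] P(4) by (auto simp: d_def u_def[symmetric] algebra_simps)
  have val: "val (base4_real a (k + i)) = emb (a (k + i)) / (P * P * u)"
    "val (base4_real a k) = emb (a k) / (P * P)"
    by (simp_all add: val_base4_real two_pow_add P_def u_def mult_ac)
  have "val (base4_real a (k + i)) - val (base4_real a k) = d / (P * P * u)"
    unfolding val d_def using P(5,6) by (simp add: diff_divide_distrib)
  moreover have "0 \<le> d / (P * P * u)" using d(1) P by simp
  moreover have "P * d \<le> P * P * d" using P(3) d(1) by (rule mult_right_mono)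
  moreover have "P * P * d < P * P * u" using d(2) P(2) by (intro mult_strict_left_mono) simp_all
  ultimately have "\<bar>val (base4_real a k) - val (base4_real a (k + i))\<bar> = d / (P * P * u)"
    and "P * d < P * P * u"
    by (simp, linarith)
  moreover from this(2) have "P * (d / (P * P * u)) < 1" using P by (simp add: pos_divide_less_eq)
  ultimately show "two_pow k * \<bar>val (base4_real a k) - val (base4_real a (k + i))\<bar> < 1"
    by (simp add: P_def)
qed simp

text \<open>The upper bound from stage \<open>0\<close>, where the sum is zero, keeps all partial
  sums below \<open>1\<close>.\<close>

lemma unit_real: "onum.unit_real (base4_real a)"
  unfolding onum.unit_real_def real_le_iff
proof (intro conjI allI real_seq)
  fix n
  have "3 * emb (a n) + 1 \<le> two_pow n * two_pow n" using upper[of 0 n] by simp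
  then have "emb (a n) \<le> two_pow n * two_pow n" using emb_nonneg[of "a n"] by linarith
  then have "val (base4_real a n) \<le> 1" "0 \<le> val (base4_real a n)"
    by (simp_all add: val_base4_real divide_le_eq)
  then have "two_pow n * (0 - val (base4_real a n)) \<le> 0" "two_pow n * (val (base4_real a n) - 1) \<le> 0"
    by (auto intro!: mult_nonneg_nonpos simp: less_imp_le)
  moreover have "val (onum.code 0 0 0) = 0" "val (onum.code (0 + 1) 0 0) = 1" by (simp_all add: val_code)
  ultimately show "two_pow n * (val (onum.code 0 0 0) - val (base4_real a n)) \<le> 2"
    "two_pow n * (val (base4_real a n) - val (onum.code (0 + 1) 0 0)) \<le> 2"
    by (auto intro: order_trans[of _ 0])
qed simp_all

end

text \<open>The larger digit of \<open>g\<close> puts \<open>b\<close> ahead by one unit, of which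
  the remaining digits of \<open>f\<close> make up at most a third. What is left contradicts
  equality at a sufficiently fine stage.\<close>

lemma base4_digit:
  assumes "base4 f a" "base4 g b" and eq: "onum.real_eq (base4_real a) (base4_real b)"
    and j: "a j = b j"
  shows "\<not> (f j = 0 \<and> g j = 1)"
proof
  interpret a: base4 f a by fact
  interpret b: base4 g b by fact
  assume fg: "f j = 0 \<and> g j = 1"
  \<comment> \<open>Stage \<open>k\<close> is the first to contain digit \<open>j\<close>. The gap
    exceeds two thirds of \<open>1 / 4 ^ k\<close>, while equality at stage \<open>k + i\<close>
    permits \<open>2 / 2 ^ (k + i)\<close>. These conflict once \<open>2 ^ i\<close> is at least
    \<open>3 * 2 ^ k\<close>, and \<open>i = k + 2\<close> achieves this.\<close>
  define k i where "k = j + 1" and "i = j + 1 + 1 + 1"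
  define P p w where "P = two_pow k" and "p = two_pow i" and "w = two_pow (k + i)"
  have w: "0 < w" by (simp only: w_def two_pow_pos)
  have p: "p = 4 * P" "0 < P" by (simp_all only: p_def P_def k_def i_def two_pow_suc two_pow_pos) simp
  have "b k = a k + 1" using fg j a.a_suc[of j] b.a_suc[of j] by (simp add: k_def)
  then have "emb (b k) = emb (a k) + 1" by simp
  then have "(emb (a k) + 1) * (p * p) \<le> emb (b (k + i))" using b.lower[of k i] by (simp add: p_def)
  moreover have "3 * emb (a (k + i)) + 1 \<le> (3 * emb (a k) + 1) * (p * p)"
    using a.upper[of k i] by (simp add: p_def)
  ultimately have large: "2 * (p * p) < 3 * (emb (b (k + i)) - emb (a (k + i)))"
    by (simp add: algebra_simps)
  have "two_pow (k + i) * \<bar>val (base4_real a (k + i)) - val (base4_real b (k + i))\<bar> \<le> 2"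
    using eq unfolding real_eq_iff by blast
  then have "w * \<bar>emb (a (k + i)) / (w * w) - emb (b (k + i)) / (w * w)\<bar> \<le> 2"
    by (simp only: val_base4_real w_def)
  moreover have "w * \<bar>x / (w * w) - y / (w * w)\<bar> = \<bar>x - y\<bar> / w" for x y
    using w by (simp add: abs_divide flip: diff_divide_distrib)
  ultimately have "\<bar>emb (a (k + i)) - emb (b (k + i))\<bar> \<le> 2 * w"
    using w by (simp only: pos_divide_le_eq)
  then have "\<bar>emb (a (k + i)) - emb (b (k + i))\<bar> \<le> 2 * (P * p)"
    by (simp only: w_def two_pow_add P_def p_def)
  then have "emb (b (k + i)) - emb (a (k + i)) \<le> 2 * (P * p)"
    unfolding abs_le_iff by linarith
  with large have "2 * (p * p) < 6 * (P * p)" by simp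
  \<comment> \<open>With \<open>p = 4 * P\<close> the coefficients are \<open>2 * 4 * 4\<close> and
    \<open>6 * 4\<close>.\<close>
  then have "32 * (P * P) < 24 * (P * P)" unfolding p(1) by simp
  moreover have "0 < P * P" using p(2) by simp
  ultimately show False by simp
qed

text \<open>Equality of the partial sums is carried from stage to stage by induction, each step
  using the equality of one digit, which \<open>base4_digit\<close> gives in both
  directions.\<close>

lemma base4_inject:
  assumes a: "base4 f a" and b: "base4 g b" and eq: "onum.real_eq (base4_real a) (base4_real b)"
  shows "f = g"
proof -
  interpret a: base4 f a by fact
  interpret b: base4 g b by fact
  have digit: "f j = g j" if "a j = b j" for j
    using base4_digit[OF a b eq that] base4_digit[OF b a real_eq_sym[OF eq] that[symmetric]]
      Cantor_cases[of f j, OF a.f_le] Cantor_cases[of g j, OF b.f_le] by auto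
  have "a j = b j" for j
  proof (rule onum_induct[where P = "\<lambda>j. a j = b j" and p = "\<lambda>Y x n. x 0 (n 0) = x 1 (n 0)"
        and x = "slots a b" and n = "\<lambda>_. 0"])
    show "arith_pred (\<lambda>Y x n. x 0 (n 0) = x 1 (n 0))" by (intro arith_intros)
    show "slots a b i \<in> nfuns" for i by (rule slots_in[OF a.a b.a])
    show "a (m + 1) = b (m + 1)" if "a m = b m" for m
      using that digit[OF that] by (simp add: a.a_suc b.a_suc)
  qed simp_all
  then show ?thesis using digit by blast
qed

text \<open>The expansions represent points of \<open>[0,1]\<close>, so one argument serves every
  \<open>D\<close> that contains the interval, in particular the line.\<close>

lemma nin_Cantor_imp_reals:
  assumes nin: "onum.nin_Cantor" and D: "\<And>x. onum.unit_real x \<Longrightarrow> D x"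
  shows "onum.nin_reals D"
  unfolding onum.nin_reals_def
proof (intro ballI impI)
  fix Y assume Y: "Y \<in> nfunctionals"
  obtain Z A where Z: "Z \<in> nfunctionals" and ZA: "\<And>f. f \<in> nfuns \<Longrightarrow> Z f = Y (base4_real (A f))"
    and A: "\<And>f. f \<in> nfuns \<Longrightarrow> base4_real (A f) \<in> nfuns"
      "\<And>f. f \<in> nfuns \<Longrightarrow> A f \<in> nfuns" "\<And>f. f \<in> nfuns \<Longrightarrow> A f 0 = 0"
      "\<And>f k. f \<in> nfuns \<Longrightarrow> A f (k + 1) = 4 * A f k + f k"
    using base4_reduction[OF Y] by blast
  obtain f g where fg: "f \<in> nfuns" "g \<in> nfuns" "onum.Cantor f" "onum.Cantor g" "f \<noteq> g" "Z f = Z g"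
    using nin Z unfolding onum.nin_Cantor_def by blast
  have base4: "base4 f (A f)" "base4 g (A g)" using fg A by (simp_all add: base4_def Cantor_iff)
  have "\<not> onum.real_eq (base4_real (A f)) (base4_real (A g))"
    using base4_inject[OF base4] fg(5) by blast
  moreover have "D (base4_real (A f))" "D (base4_real (A g))"
    using base4.unit_real[OF base4(1)] base4.unit_real[OF base4(2)] D by blast+
  moreover have "Y (base4_real (A f)) = Y (base4_real (A g))" using ZA fg by metis
  ultimately show "\<exists>x\<in>nfuns. \<exists>y\<in>nfuns. D x \<and> D y \<and> \<not> onum.real_eq x y \<and> Y x = Y y"
    using A(1) fg(1,2) by blast
qed

lemma onum_nin_equivalent: "onum.nin_equivalent"
proof -
  have unit: "onum.unit_real x \<Longrightarrow> onum.real_seq x" for x by (simp add: onum.unit_real_def)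
  have "onum.nin_reals onum.unit_real \<longleftrightarrow> onum.nin_Cantor"
    using nin_reals_imp_Cantor[OF _ unit] nin_Cantor_imp_reals by blast
  moreover have "onum.nin_reals onum.real_seq \<longleftrightarrow> onum.nin_Cantor"
    using nin_reals_imp_Cantor[of onum.real_seq] nin_Cantor_imp_reals[of onum.real_seq] unit by blast
  moreover have "onum.nin_Cantor \<Longrightarrow> onum.nin_Baire"
    unfolding onum.nin_Cantor_def onum.nin_Baire_def by blast
  ultimately show ?thesis using nin_Baire_imp_Cantor unfolding onum.nin_equivalent_def by blast
qed

text \<open>The equivalences hold in the chosen structure, hence in every model on
  \<open>onum\<close>, in particular in the one that \<open>M\<close> induces.\<close>

lemma henkin_equivalences:
  assumes "henkin ACA0_omega M"
  shows "NIN \<^bold>\<longleftrightarrow> NIN_Cantor \<in> M \<and> NIN_Cantor \<^bold>\<longleftrightarrow> NIN_Baire \<in> M \<and> NIN_Baire \<^bold>\<longleftrightarrow> NIN_Real \<in> M"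
proof -
  obtain ab :: "tm \<Rightarrow> onum" where "aca_model M ab" using aca_model_exists[OF assms] by blast
  then interpret m: aca_model M ab .
  let ?S = "\<lparr>zero_of = ab Zero, suc_of = m.suc, pr_of = m.pr, plus_of = m.plus, times_of = m.times,
    monus_of = m.monus, pow2_of = m.pow2, D1_of = m.D1, D2_of = m.D2, E_of = m.fun2 m.Phi,
    R_of = m.R, Q_of = m.Q\<rparr>"
  have "is_omega_model ?S" using m.omega_model by (simp add: is_omega_model_def)
  moreover have "satisfies_equivalences the_structure"
    using onum_nin_equivalent by (simp add: satisfies_equivalences_the_structure)
  ultimately have "satisfies_equivalences ?S" by (rule the_structure_generic[rotated])
  then show ?thesis unfolding m.equivalences_iff by (simp add: satisfies_equivalences_def)
qed

text \<open>Completeness: if \<open>\<chi>\<close> were not provable, its negation would extend to a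
  Henkin set that omits \<open>\<chi>\<close>.\<close>

lemma provableI:
  assumes "wf_fm \<chi>" "\<And>M. henkin ACA0_omega M \<Longrightarrow> \<chi> \<in> M"
  shows "ACA0_omega \<turnstile> \<chi>"
  using henkin_extension[OF ACA0_omega_fsubst ACA0_omega_wf assms(1)] assms(2) by metis

theorem theorem1:
  shows "(ACA0_omega \<turnstile> NIN \<^bold>\<longleftrightarrow> NIN_Cantor) \<and>
    (ACA0_omega \<turnstile> NIN_Cantor \<^bold>\<longleftrightarrow> NIN_Baire) \<and>
    (ACA0_omega \<turnstile> NIN_Baire \<^bold>\<longleftrightarrow> NIN_Real)"
  using henkin_equivalences by (intro conjI provableI) (simp_all add: wf_NIN)

end
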